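(* Let $(M,g_0)$ be a closed surface with negative Gauss curvature and $w\in\Gamma_1^-$. Given $\phi,\psi\in T_w\Gamma_1^-\cong C^\infty(M)$, the sectional curvature satisfies $$K(\phi,\psi)=\int_M\frac1{(-K_w)}\Big\{-|\nabla\phi|_w^2|\nabla\psi|_w^2+g_w(\nabla\phi,\nabla\psi)^2\Big\}dA_w\le0.$$
   Context: For $w\in C^\infty(M)$, $g_w=e^{2w}g_0$ has Gauss curvature $K_w$ and area form $dA_w$; subscripts $w$ refer to $g_w$, and gradients are taken with respect to $g_w$. $\Gamma_1^-=\{w\in C^\infty(M):K_w<0\}$, with tangent space $T_w\Gamma_1^-\cong C^\infty(M)$ and formal Riemannian metric $\langle\langle\alpha,\beta\rangle\rangle_w=\int_M\alpha\beta(-K_w)\,dA_w$. For a vector field $\alpha=\alpha(\cdot,t)$ along a path $w=w(\cdot,t)$ in $\Gamma_1^-$, the connection is $$\frac{D}{\partial t}\alpha=\frac{\partial\alpha}{\partial t}+\frac1{K_w}\Big\langle\nabla_w\alpha,\nabla_w\frac{\partial w}{\partial t}\Big\rangle_w.$$ The (unnormalized) sectional curvature is $K(\phi,\psi)=\big\langle\big\langle\big(\frac{D}{\partial s}\frac{D}{\partial t}-\frac{D}{\partial t}\frac{D}{\partial s}\big)\frac{\partial w}{\partial t},\frac{\partial w}{\partial s}\big\rangle\big\rangle_w$, evaluated at $(0,0)$ for a smooth two-parameter family $w(s,t)\in\Gamma_1^-$ with $w(0,0)=w$, $\frac{\partial w}{\partial s}(0,0)=\phi$, $\frac{\partial w}{\partial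 t}(0,0)=\psi$. *)

theory Defs
  imports "HOL-Analysis.Analysis"
begin

section \<open>Smooth maps between open subsets of normed spaces\<close>

text \<open>For finite-dimensional domains and open \<open>S\<close> this is the usual notion of
  \<open>C\<^sup>k\<close> (resp. smooth) map on \<open>S\<close>.\<close>

primrec Ck_on :: "nat \<Rightarrow> ('a::real_normed_vector \<Rightarrow> 'b::real_normed_vector) \<Rightarrow> 'a set \<Rightarrow> bool" where
  "Ck_on 0 f S \<longleftrightarrow> continuous_on S f"
| "Ck_on (Suc k) f S \<longleftrightarrow>
     (\<forall>x\<in>S. f differentiable (at x)) \<and>
     (\<forall>v. Ck_on k (\<lambda>x. frechet_derivative f (at x) v) S)"

definition smooth_on :: "('a::real_normed_vector \<Rightarrow> 'b::real_normed_vector) \<Rightarrow> 'a set \<Rightarrow> bool" where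
  "smooth_on f S \<longleftrightarrow> (\<forall>k. Ck_on k f S)"

definition partial :: "2 \<Rightarrow> (real^2 \<Rightarrow> real) \<Rightarrow> real^2 \<Rightarrow> real" where
  "partial i f y = frechet_derivative f (at y) (axis i 1)"

section \<open>Closed surfaces\<close>

text \<open>The surface is the whole (compact Hausdorff) type \<open>'a\<close>. A chart is a pair of its domain
  and its coordinate map; the latter is only meaningful on the domain.\<close>

type_synonym 'a chart = "'a set \<times> ('a \<Rightarrow> real^2)"

abbreviation chart_inv :: "'a chart \<Rightarrow> real^2 \<Rightarrow> 'a" where
  "chart_inv c \<equiv> inv_into (fst c) (snd c)"

abbreviation chart_image :: "'a chart \<Rightarrow> (real^2) set" where
  "chart_image c \<equiv> snd c ` fst c"

definition closed_surface :: "('a::t2_space) chart set \<Rightarrow> bool" where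
  "closed_surface A \<longleftrightarrow>
     compact (UNIV :: 'a set) \<and>
     (\<Union>c\<in>A. fst c) = UNIV \<and>
     (\<forall>c\<in>A. open (fst c) \<and> open (chart_image c) \<and>
        homeomorphism (fst c) (chart_image c) (snd c) (chart_inv c)) \<and>
     (\<forall>c\<in>A. \<forall>d\<in>A. smooth_on (snd d \<circ> chart_inv c) (snd c ` (fst c \<inter> fst d)))"

definition smooth_functions :: "'a chart set \<Rightarrow> ('a \<Rightarrow> real) set" where
  "smooth_functions A = {f. \<forall>c\<in>A. smooth_on (f \<circ> chart_inv c) (chart_image c)}"

text \<open>Pointwise quantities are computed in an arbitrary chart around the point; for the tensorial
  quantities below the choice does not matter.\<close>

definition chart_at :: "'a chart set \<Rightarrow> 'a \<Rightarrow> 'a chart" where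
  "chart_at A p = (SOME c. c \<in> A \<and> p \<in> fst c)"

section \<open>Riemannian metrics\<close>

text \<open>A metric is given by its component matrices \<open>g\<^sub>i\<^sub>j\<close>, as functions of the coordinates of each
  chart, subject to the transformation law of a covariant 2-tensor.\<close>

type_synonym 'a metric_components = "'a chart \<Rightarrow> real^2 \<Rightarrow> real^2^2"

definition riemannian_metric :: "('a::t2_space) chart set \<Rightarrow> 'a metric_components \<Rightarrow> bool" where
  "riemannian_metric A g \<longleftrightarrow>
     (\<forall>c\<in>A. smooth_on (g c) (chart_image c) \<and>
        (\<forall>y\<in>chart_image c. transpose (g c y) = g c y \<and>
           (\<forall>v. v \<noteq> 0 \<longrightarrow> v \<bullet> (g c y *v v) > 0))) \<and>
     (\<forall>c\<in>A. \<forall>d\<in>A. \<forall>p\<in>fst c \<inter> fst d.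
        let J = jacobian (snd d \<circ> chart_inv c) (at (snd c p))
        in g c (snd c p) = transpose J ** g d (snd d p) ** J)"

text \<open>The conformal metric \<open>g\<^sub>w = e\<^sup>2\<^sup>w g\<close>.\<close>

definition conformal :: "'a metric_components \<Rightarrow> ('a \<Rightarrow> real) \<Rightarrow> 'a metric_components" where
  "conformal g w = (\<lambda>c y. exp (2 * w (chart_inv c y)) *\<^sub>R g c y)"

definition gradient :: "(real^2 \<Rightarrow> real^2^2) \<Rightarrow> (real^2 \<Rightarrow> real) \<Rightarrow> real^2 \<Rightarrow> real^2" where
  "gradient h f y = matrix_inv (h y) *v (\<chi> j. partial j f y)"

text \<open>\<open>grad_inner A g \<phi> \<psi> p\<close> is \<open>g(\<nabla>\<phi>, \<nabla>\<psi>)\<close> at \<open>p\<close>, with gradients taken with respect to \<open>g\<close>.\<close>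

definition grad_inner ::
    "'a chart set \<Rightarrow> 'a metric_components \<Rightarrow> ('a \<Rightarrow> real) \<Rightarrow> ('a \<Rightarrow> real) \<Rightarrow> 'a \<Rightarrow> real" where
  "grad_inner A g \<phi> \<psi> p =
     (let c = chart_at A p; y = snd c p
      in gradient (g c) (\<phi> \<circ> chart_inv c) y \<bullet> (g c y *v gradient (g c) (\<psi> \<circ> chart_inv c) y))"

definition christoffel :: "(real^2 \<Rightarrow> real^2^2) \<Rightarrow> 2 \<Rightarrow> 2 \<Rightarrow> 2 \<Rightarrow> real^2 \<Rightarrow> real" where
  "christoffel h k i j y =
     (1/2) * (\<Sum>l\<in>UNIV. matrix_inv (h y) $ k $ l *
       (partial i (\<lambda>z. h z $ j $ l) y + partial j (\<lambda>z. h z $ i $ l) y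
        - partial l (\<lambda>z. h z $ i $ j) y))"

text \<open>\<open>riemann h l k i j\<close> is the \<open>l\<close>-th component of \<open>R(\<partial>\<^sub>i, \<partial>\<^sub>j)\<partial>\<^sub>k\<close>, with the sign convention
  \<open>R(X, Y) = \<nabla>\<^sub>X \<nabla>\<^sub>Y - \<nabla>\<^sub>Y \<nabla>\<^sub>X - \<nabla>\<^sub>[\<^sub>X\<^sub>,\<^sub>Y\<^sub>]\<close>.\<close>

definition riemann :: "(real^2 \<Rightarrow> real^2^2) \<Rightarrow> 2 \<Rightarrow> 2 \<Rightarrow> 2 \<Rightarrow> 2 \<Rightarrow> real^2 \<Rightarrow> real" where
  "riemann h l k i j y =
     partial i (christoffel h l j k) y - partial j (christoffel h l i k) y
     + (\<Sum>m\<in>UNIV. christoffel h l i m y * christoffel h m j k y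
                 - christoffel h l j m y * christoffel h m i k y)"

text \<open>The Gauss curvature \<open>\<langle>R(\<partial>\<^sub>1, \<partial>\<^sub>2)\<partial>\<^sub>2, \<partial>\<^sub>1\<rangle> / det g\<close>; it is positive on round spheres.\<close>

definition gauss_curvature :: "'a chart set \<Rightarrow> 'a metric_components \<Rightarrow> 'a \<Rightarrow> real" where
  "gauss_curvature A g p =
     (let c = chart_at A p; y = snd c p
      in (\<Sum>l\<in>UNIV. g c y $ 1 $ l * riemann (g c) l 2 1 2 y) / det (g c y))"

text \<open>The Riemannian area, as the Borel measure that is \<open>\<surd>(det g) dy\<close> in every chart. It is an
  unsigned density, so no orientation is needed.\<close>

definition area_measure :: "('a::t2_space) chart set \<Rightarrow> 'a metric_components \<Rightarrow> 'a measure" where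
  "area_measure A g = (THE \<mu>. sets \<mu> = sets borel \<and>
     (\<forall>c\<in>A. \<forall>S\<in>sets borel. S \<subseteq> fst c \<longrightarrow>
        emeasure \<mu> S = (\<integral>\<^sup>+y\<in>snd c ` S. ennreal (sqrt (det (g c y))) \<partial>lborel)))"

section \<open>The space of conformal factors of negative curvature\<close>

definition Gamma_minus :: "'a chart set \<Rightarrow> 'a metric_components \<Rightarrow> ('a \<Rightarrow> real) set" where
  "Gamma_minus A g0 =
     {w \<in> smooth_functions A. \<forall>p. gauss_curvature A (conformal g0 w) p < 0}"

text \<open>The formal Riemannian metric \<open>\<langle>\<langle>\<alpha>, \<beta>\<rangle>\<rangle>\<^sub>w\<close>.\<close>

definition formal_metric ::
    "('a::t2_space) chart set \<Rightarrow> 'a metric_components \<Rightarrow> ('a \<Rightarrow> real) \<Rightarrow>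
     ('a \<Rightarrow> real) \<Rightarrow> ('a \<Rightarrow> real) \<Rightarrow> real" where
  "formal_metric A g0 w \<alpha> \<beta> =
     (LINT p|area_measure A (conformal g0 w).
        \<alpha> p * \<beta> p * (- gauss_curvature A (conformal g0 w) p))"

text \<open>The covariant derivative \<open>(D/\<partial>t) \<alpha>\<close>, at time \<open>t\<close>, of the vector field \<open>\<alpha>\<close> along the path
  \<open>w\<close>; the first argument of \<open>\<alpha>\<close> and of \<open>w\<close> is time.\<close>

definition cov_deriv ::
    "'a chart set \<Rightarrow> 'a metric_components \<Rightarrow> (real \<Rightarrow> 'a \<Rightarrow> real) \<Rightarrow>
     (real \<Rightarrow> 'a \<Rightarrow> real) \<Rightarrow> real \<Rightarrow> 'a \<Rightarrow> real" where
  "cov_deriv A g0 w \<alpha> t p =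
     deriv (\<lambda>\<tau>. \<alpha> \<tau> p) t
     + 1 / gauss_curvature A (conformal g0 (w t)) p
       * grad_inner A (conformal g0 (w t)) (\<alpha> t) (\<lambda>q. deriv (\<lambda>\<tau>. w \<tau> q) t) p"

definition two_parameter_family ::
    "'a chart set \<Rightarrow> 'a metric_components \<Rightarrow> ('a \<Rightarrow> real) \<Rightarrow> ('a \<Rightarrow> real) \<Rightarrow> ('a \<Rightarrow> real) \<Rightarrow>
     (real \<Rightarrow> real \<Rightarrow> 'a \<Rightarrow> real) \<Rightarrow> bool" where
  "two_parameter_family A g0 w \<phi> \<psi> W \<longleftrightarrow>
     (\<exists>U. open U \<and> (0, 0) \<in> U \<and>
        (\<forall>(s, t)\<in>U. W s t \<in> Gamma_minus A g0) \<and>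
        (\<forall>c\<in>A. smooth_on (\<lambda>((s, t), y). W s t (chart_inv c y)) (U \<times> chart_image c))) \<and>
     W 0 0 = w \<and>
     (\<forall>p. deriv (\<lambda>s. W s 0 p) 0 = \<phi> p) \<and>
     (\<forall>p. deriv (\<lambda>t. W 0 t p) 0 = \<psi> p)"

text \<open>The expression \<open>\<langle>\<langle>(D\<^sub>s D\<^sub>t - D\<^sub>t D\<^sub>s) \<partial>\<^sub>t W, \<partial>\<^sub>s W\<rangle>\<rangle>\<close> at \<open>(0, 0)\<close>.\<close>

definition family_curvature ::
    "('a::t2_space) chart set \<Rightarrow> 'a metric_components \<Rightarrow> (real \<Rightarrow> real \<Rightarrow> 'a \<Rightarrow> real) \<Rightarrow> real" where
  "family_curvature A g0 W =
     (let Ws = (\<lambda>s t p. deriv (\<lambda>\<sigma>. W \<sigma> t p) s);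
          Wt = (\<lambda>s t p. deriv (\<lambda>\<tau>. W s \<tau> p) t);
          Ds = (\<lambda>\<alpha> s t. cov_deriv A g0 (\<lambda>\<sigma>. W \<sigma> t) (\<lambda>\<sigma>. \<alpha> \<sigma> t) s);
          Dt = (\<lambda>\<alpha> s t. cov_deriv A g0 (\<lambda>\<tau>. W s \<tau>) (\<lambda>\<tau>. \<alpha> s \<tau>) t)
      in formal_metric A g0 (W 0 0)
           (\<lambda>p. Ds (Dt Wt) 0 0 p - Dt (Ds Wt) 0 0 p) (Ws 0 0))"

text \<open>\<open>has_sectional_curvature A g0 w \<phi> \<psi> \<kappa>\<close> says that \<open>K(\<phi>, \<psi>)\<close> at \<open>w\<close> is well defined, i.e. does
  not depend on the family representing \<open>\<phi>\<close>, \<open>\<psi>\<close>, and has the value \<open>\<kappa>\<close>. The existence clause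
  makes \<open>\<kappa>\<close> unique.\<close>

definition has_sectional_curvature ::
    "('a::t2_space) chart set \<Rightarrow> 'a metric_components \<Rightarrow> ('a \<Rightarrow> real) \<Rightarrow>
     ('a \<Rightarrow> real) \<Rightarrow> ('a \<Rightarrow> real) \<Rightarrow> real \<Rightarrow> bool" where
  "has_sectional_curvature A g0 w \<phi> \<psi> \<kappa> \<longleftrightarrow>
     (\<exists>W. two_parameter_family A g0 w \<phi> \<psi> W) \<and>
     (\<forall>W. two_parameter_family A g0 w \<phi> \<psi> W \<longrightarrow> family_curvature A g0 W = \<kappa>)"

end

theory Submission
  imports Defs
begin

text \<open>Write \<open>g\<close> for \<open>g\<^sub>w\<close> and \<open>K\<close> for its curvature. Along a family \<open>V\<close> with \<open>V = 0\<close> at the origin,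
  \<open>K\<^sub>V = e\<^sup>-\<^sup>2\<^sup>V (K - \<Delta>V)\<close>, so the connection term \<open>1 / K\<^sub>V \<langle>\<nabla>\<alpha>, \<nabla>V\<^sub>t\<rangle>\<^sub>V\<close> equals
  \<open>\<langle>\<nabla>\<alpha>, \<nabla>V\<^sub>t\<rangle> / (K - \<Delta>V)\<close>, computed in the fixed metric \<open>g\<close>. Differentiating once more, the second and
  third derivatives of \<open>V\<close> cancel in the commutator, and with \<open>u = |\<nabla>\<psi>|\<^sup>2 / K\<close>,
  \<open>v = \<langle>\<nabla>\<psi>, \<nabla>\<phi>\<rangle> / K\<close> it becomes \<open>div (u \<nabla>\<phi> - v \<nabla>\<psi>) / K\<close>. Pairing it with \<open>\<phi>\<close> against
  \<open>- K dA\<close> and integrating by parts yields the formula; the sign is the Cauchy-Schwarz inequality.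

  That \<open>K\<close> does not depend on the chart, and its conformal law, are checked as identities between
  two-jets of the metric in Brioschi's formula.\<close>

section \<open>Calculus of smooth maps\<close>

text \<open>The divergence rests on two facts special to surfaces. Gradient product and curvature
  carry the same factor exp(-2V), so the metric along the family can be frozen; and the remaining
  denominator \<open>E\<close>, that is K - \<Delta>V, is affine in V. Differentiating 1 /
  \<open>E\<close> therefore yields the Laplacians of \<phi> and \<psi>, exactly what completes the
  gradient terms of \<open>u\<close> and \<open>v\<close> to divergences.

  To have V = 0 at the origin, a family \<open>W\<close> is replaced by \<open>W - w\<close> over
  the metric of \<open>w\<close>. The value found depends only on first derivatives at the origin,
  hence not on the family; and compactness keeps w + s \<phi> + t \<psi> negatively curved for small
  s and t, so families exist.

  The obstacle is that curvature and gradient product are read off in an arbitrarily chosen chart,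
  and the area is only described as the measure with given chart densities. Before anything is
  differentiated or integrated on the surface, each needs a formula valid in every chart, and the
  measure must be built and shown unique.\<close>

definition dir_deriv :: "'a::real_normed_vector \<Rightarrow> ('a \<Rightarrow> 'b::real_normed_vector) \<Rightarrow> 'a \<Rightarrow> 'b" where
  "dir_deriv v f x = frechet_derivative f (at x) v"

lemma partial_dir_deriv: "partial i f = dir_deriv (axis i 1) f"
  by (simp add: fun_eq_iff partial_def dir_deriv_def)

lemma Ck_on_Suc:
  "Ck_on (Suc k) f S \<longleftrightarrow> (\<forall>x\<in>S. f differentiable (at x)) \<and> (\<forall>v. Ck_on k (dir_deriv v f) S)"
  by (simp add: dir_deriv_def[abs_def])

declare Ck_on.simps(2) [simp del]

lemma dir_deriv_eqI: "(f has_derivative f') (at x) \<Longrightarrow> dir_deriv v f x = f' v"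
  by (metis dir_deriv_def frechet_derivative_at)

lemma dir_deriv_works: "f differentiable (at x) \<Longrightarrow> (f has_derivative (\<lambda>v. dir_deriv v f x)) (at x)"
  unfolding dir_deriv_def using frechet_derivative_works by fastforce

text \<open>\<open>frechet_derivative\<close> chooses among all derivatives at the point. Functions
  that agree near \<open>x\<close> have the same derivatives there, so the choice is the same, even
  where there is none.\<close>

lemma dir_deriv_cong:
  assumes "open S" "x \<in> S" "\<And>y. y \<in> S \<Longrightarrow> f y = g y"
  shows "dir_deriv v f x = dir_deriv v g x"
proof -
  have "(f has_derivative D) (at x) \<longleftrightarrow> (g has_derivative D) (at x)" for D
    using assms has_derivative_transform_within_open by (metis (full_types))
  then show ?thesis by (simp add: dir_deriv_def frechet_derivative_def)
qed

lemma differentiable_cong_open: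
  assumes "f differentiable (at x)" "open S" "x \<in> S" "\<And>y. y \<in> S \<Longrightarrow> f y = g y"
  shows "g differentiable (at x)"
  using assms has_derivative_transform_within_open unfolding differentiable_def by (metis (full_types))

lemma Ck_on_cong:
  assumes "open S" "\<And>x. x \<in> S \<Longrightarrow> f x = g x" "Ck_on k f S"
  shows "Ck_on k g S"
  using assms(2,3)
proof (induction k arbitrary: f g)
  case 0
  show ?case using continuous_on_cong[OF refl 0(1), of S] 0(2) by simp
next
  case (Suc k)
  have "Ck_on k (dir_deriv v g) S" for v
  proof (rule Suc.IH)
    show "dir_deriv v f x = dir_deriv v g x" if "x \<in> S" for x
      using that Suc.prems(1) by (rule dir_deriv_cong[OF assms(1)])
    show "Ck_on k (dir_deriv v f) S" using Suc.prems(2) by (simp add: Ck_on_Suc)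
  qed
  moreover have "g differentiable (at x)" if "x \<in> S" for x
    by (rule differentiable_cong_open[of f, OF _ assms(1) that]) (use Suc.prems that in \<open>auto simp: Ck_on_Suc\<close>)
  ultimately show ?case by (simp add: Ck_on_Suc)
qed

lemma smooth_on_cong:
  "open S \<Longrightarrow> (\<And>x. x \<in> S \<Longrightarrow> f x = g x) \<Longrightarrow> smooth_on f S \<Longrightarrow> smooth_on g S"
  unfolding smooth_on_def using Ck_on_cong[of S f g] by blast

lemma Ck_on_subset: "Ck_on k f S \<Longrightarrow> T \<subseteq> S \<Longrightarrow> Ck_on k f T"
  by (induction k arbitrary: f) (auto simp: Ck_on_Suc intro: continuous_on_subset)

lemma smooth_on_subset: "smooth_on f S \<Longrightarrow> T \<subseteq> S \<Longrightarrow> smooth_on f T"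
  unfolding smooth_on_def by (meson Ck_on_subset)

text \<open>Every clause of \<open>Ck_on\<close> is local on open sets. This is what allows a
  function given in one chart to be glued with zero outside a compact set.\<close>

lemma Ck_on_local:
  assumes "\<And>x. x \<in> S \<Longrightarrow> \<exists>T. open T \<and> x \<in> T \<and> Ck_on k f T"
  shows "Ck_on k f S"
  using assms
proof (induction k arbitrary: f)
  case 0
  then show ?case
    by (metis Ck_on.simps(1) continuous_at_imp_continuous_on continuous_on_eq_continuous_at)
next
  case (Suc k)
  have "Ck_on k (dir_deriv v f) S" for v
    using Suc.prems by (intro Suc.IH) (metis Ck_on_Suc)
  moreover have "f differentiable (at x)" if "x \<in> S" for x
    using Suc.prems[OF that] by (auto simp: Ck_on_Suc)
  ultimately show ?case by (simp add: Ck_on_Suc)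
qed

lemma Ck_on_SucD: "Ck_on (Suc k) f S \<Longrightarrow> Ck_on k f S"
proof (induction k arbitrary: f)
  case 0
  then show ?case
    by (auto simp: Ck_on_Suc differentiable_imp_continuous_within continuous_at_imp_continuous_on)
next
  case (Suc k)
  then show ?case by (simp add: Ck_on_Suc)
qed

lemma Ck_on_mono: "Ck_on k f S \<Longrightarrow> l \<le> k \<Longrightarrow> Ck_on l f S"
  by (induction k) (auto simp: le_Suc_eq dest: Ck_on_SucD)

lemma Ck_on_continuous: "Ck_on k f S \<Longrightarrow> continuous_on S f"
  using Ck_on_mono[of k f S 0] by simp

lemma smooth_on_continuous: "smooth_on f S \<Longrightarrow> continuous_on S f"
  unfolding smooth_on_def using Ck_on_continuous by blast

lemma smooth_on_differentiable: "smooth_on f S \<Longrightarrow> x \<in> S \<Longrightarrow> f differentiable (at x)"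
  unfolding smooth_on_def using Ck_on_Suc by blast

lemma smooth_on_dir_deriv: "smooth_on f S \<Longrightarrow> smooth_on (dir_deriv v f) S"
  unfolding smooth_on_def by (meson Ck_on_Suc)

lemma smooth_on_partial: "smooth_on f S \<Longrightarrow> smooth_on (partial i f) S"
  by (simp add: partial_dir_deriv smooth_on_dir_deriv)

section \<open>Linear maps, products, composites and elementary functions\<close>

lemma Ck_on_const [intro, simp]: "Ck_on k (\<lambda>x. c) S"
proof (induction k arbitrary: c)
  case (Suc k)
  then show ?case by (simp add: Ck_on_Suc dir_deriv_def[abs_def])
qed simp

lemma Ck_on_bounded_linear:
  assumes "bounded_linear L" shows "Ck_on k L S"
proof (cases k)
  case 0
  then show ?thesis using assms linear_continuous_on by auto
next
  case (Suc l)
  have "dir_deriv v L = (\<lambda>x. L v)" for v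
    using bounded_linear.has_derivative[OF assms has_derivative_ident]
    by (intro ext dir_deriv_eqI)
  then show ?thesis
    using assms by (simp add: Suc Ck_on_Suc bounded_linear_imp_differentiable)
qed

lemma Ck_on_add:
  assumes "open S" "Ck_on k f S" "Ck_on k g S" shows "Ck_on k (\<lambda>x. f x + g x) S"
  using assms(2,3)
proof (induction k arbitrary: f g)
  case 0
  then show ?case by (auto intro: continuous_on_add)
next
  case (Suc k)
  have "Ck_on k (dir_deriv v (\<lambda>x. f x + g x)) S" for v
  proof (rule Ck_on_cong[OF assms(1) _ Suc.IH[of "dir_deriv v f" "dir_deriv v g"]])
    fix x assume "x \<in> S"
    then have "(f has_derivative (\<lambda>v. dir_deriv v f x)) (at x)"
      "(g has_derivative (\<lambda>v. dir_deriv v g x)) (at x)"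
      using Suc.prems by (auto simp: Ck_on_Suc dir_deriv_works)
    from has_derivative_add[OF this]
    show "dir_deriv v f x + dir_deriv v g x = dir_deriv v (\<lambda>x. f x + g x) x"
      by (simp add: dir_deriv_eqI)
  qed (use Suc.prems in \<open>auto simp: Ck_on_Suc\<close>)
  then show ?case using Suc.prems by (auto simp: Ck_on_Suc)
qed

text \<open>The product rule sets an undifferentiated factor beside a differentiated one, so the
  induction step also uses both factors one order lower. Real products, scalar multiples and inner
  products are all instances.\<close>

lemma Ck_on_bilinear:
  assumes bb: "bounded_bilinear b" and "open S" "Ck_on k f S" "Ck_on k g S"
  shows "Ck_on k (\<lambda>x. b (f x) (g x)) S"
  using assms(3,4)
proof (induction k arbitrary: f g)
  case 0
  then show ?case by (auto intro: bounded_bilinear.continuous_on[OF bb])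
next
  case (Suc k)
  have d: "((\<lambda>x. b (f x) (g x)) has_derivative
      (\<lambda>v. b (f x) (dir_deriv v g x) + b (dir_deriv v f x) (g x))) (at x)" if "x \<in> S" for x
    using Suc.prems that
    by (intro bounded_bilinear.FDERIV[OF bb]) (auto simp: Ck_on_Suc dir_deriv_works)
  have "Ck_on k (dir_deriv v (\<lambda>x. b (f x) (g x))) S" for v
  proof (rule Ck_on_cong[OF assms(2)])
    show "Ck_on k (\<lambda>x. b (f x) (dir_deriv v g x) + b (dir_deriv v f x) (g x)) S"
      using Suc.prems Suc.prems[THEN Ck_on_SucD]
      by (intro Ck_on_add assms(2) Suc.IH) (simp_all add: Ck_on_Suc)
  qed (simp add: dir_deriv_eqI[OF d])
  then show ?case using d by (auto simp: Ck_on_Suc differentiable_def)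
qed

lemma Ck_on_sum:
  assumes "open S" "\<And>i. i \<in> I \<Longrightarrow> Ck_on k (f i) S"
  shows "Ck_on k (\<lambda>x. \<Sum>i\<in>I. f i x) S"
  using assms(2) by (induction I rule: infinite_finite_induct) (auto intro: Ck_on_add assms(1))

text \<open>The composite is differentiated along a fixed direction; the inner derivative is then expanded
  in a basis, so that the outer function is again only differentiated along fixed directions.\<close>

lemma Ck_on_compose:
  fixes f :: "'a::real_normed_vector \<Rightarrow> 'b::euclidean_space" and g :: "'b \<Rightarrow> 'c::real_normed_vector"
  assumes "open S" "f ` S \<subseteq> T" "Ck_on k f S" "Ck_on k g T"
  shows "Ck_on k (\<lambda>x. g (f x)) S"
  using assms(3,4)
proof (induction k arbitrary: g)
  case 0
  then show ?case using continuous_on_compose2[OF _ _ assms(2)] by auto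
next
  case (Suc k)
  have d: "((\<lambda>x. g (f x)) has_derivative (\<lambda>v. dir_deriv (dir_deriv v f x) g (f x))) (at x)"
    if "x \<in> S" for x
    using Suc.prems that assms(2)
    by (intro has_derivative_compose[where f = f and g = g]) (auto simp: Ck_on_Suc dir_deriv_works)
  have "Ck_on k (dir_deriv v (\<lambda>x. g (f x))) S" for v
  proof (rule Ck_on_cong[OF assms(1)])
    show "Ck_on k (\<lambda>x. \<Sum>b\<in>Basis. (dir_deriv v f x \<bullet> b) *\<^sub>R dir_deriv b g (f x)) S"
      using Suc.prems Suc.prems(1)[THEN Ck_on_SucD]
      by (intro Ck_on_sum Ck_on_bilinear[OF bounded_bilinear_scaleR] Suc.IH
          Ck_on_bilinear[OF bounded_bilinear_inner] assms(1))
        (simp_all add: Ck_on_Suc)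
    fix x assume x: "x \<in> S"
    then have lin: "linear (\<lambda>w. dir_deriv w g (f x))"
      using Suc.prems assms(2)
      by (intro has_derivative_linear[OF dir_deriv_works]) (auto simp: Ck_on_Suc)
    have "dir_deriv (\<Sum>b\<in>Basis. (dir_deriv v f x \<bullet> b) *\<^sub>R b) g (f x)
        = (\<Sum>b\<in>Basis. (dir_deriv v f x \<bullet> b) *\<^sub>R dir_deriv b g (f x))"
      by (simp only: linear_sum[OF lin, of "\<lambda>b. (dir_deriv v f x \<bullet> b) *\<^sub>R b"] linear_cmul[OF lin])
    then show "(\<Sum>b\<in>Basis. (dir_deriv v f x \<bullet> b) *\<^sub>R dir_deriv b g (f x))
        = dir_deriv v (\<lambda>x. g (f x)) x"
      by (simp add: dir_deriv_eqI[OF d[OF x]] euclidean_representation)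
  qed
  then show ?case using d by (auto simp: Ck_on_Suc differentiable_def)
qed

lemma Ck_on_mult:
  fixes f g :: "'a::real_normed_vector \<Rightarrow> real"
  shows "open S \<Longrightarrow> Ck_on k f S \<Longrightarrow> Ck_on k g S \<Longrightarrow> Ck_on k (\<lambda>x. f x * g x) S"
  by (rule Ck_on_bilinear[OF bounded_bilinear_mult])

text \<open>The derivatives of \<open>exp\<close>, \<open>inverse\<close> and \<open>sqrt\<close>
  are built from these functions themselves, so each of them gains one order of differentiability at
  a time by induction with this step.\<close>

lemma Ck_on_Suc_real:
  assumes "open S" "\<And>x. x \<in> S \<Longrightarrow> (g has_field_derivative g' x) (at x)" "Ck_on k g' S"
  shows "Ck_on (Suc k) g (S :: real set)"
proof -
  have d: "(g has_derivative (\<lambda>v. v * g' x)) (at x)" if "x \<in> S" for x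
    using assms(2)[OF that] unfolding has_field_derivative_def mult.commute[of "g' x"] .
  have "Ck_on k (dir_deriv v g) S" for v
  proof (rule Ck_on_cong[OF assms(1)])
    show "Ck_on k (\<lambda>x. v * g' x) S" using assms by (intro Ck_on_mult) auto
  qed (simp add: dir_deriv_eqI[OF d])
  then show ?thesis using d by (auto simp: Ck_on_Suc differentiable_def)
qed

lemma Ck_on_exp_real: "Ck_on k exp (UNIV :: real set)"
  by (induction k) (auto intro!: Ck_on_Suc_real DERIV_exp continuous_on_exp)

lemma Ck_on_inverse_real: "Ck_on k inverse (- {0 :: real})"
proof (induction k)
  case (Suc k)
  have "Ck_on k (\<lambda>x::real. (-1) * (inverse x * inverse x)) (- {0})"
    by (intro Ck_on_mult Suc) auto
  then show ?case
    by (rule Ck_on_Suc_real[rotated 2])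
      (auto intro!: derivative_eq_intros simp: power2_eq_square divide_inverse)
qed (auto intro: continuous_intros)

lemma Ck_on_sqrt_real: "Ck_on k sqrt {0 :: real<..}"
proof (induction k)
  case (Suc k)
  have "Ck_on k (\<lambda>x. inverse (sqrt x) * (1/2)) {0<..}"
    by (intro Ck_on_mult Ck_on_compose[OF _ _ Suc Ck_on_inverse_real]) auto
  then show ?case
    by (rule Ck_on_Suc_real[rotated 2]) (auto intro!: derivative_eq_intros simp: divide_simps)
qed (auto intro: continuous_intros)

named_theorems smooth

lemma smooth_on_const [smooth]: "smooth_on (\<lambda>x. c) S"
  by (simp add: smooth_on_def)

lemma smooth_on_bounded_linear: "bounded_linear L \<Longrightarrow> smooth_on L S"
  by (simp add: smooth_on_def Ck_on_bounded_linear)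

lemma smooth_on_add [smooth]:
  "open S \<Longrightarrow> smooth_on f S \<Longrightarrow> smooth_on g S \<Longrightarrow> smooth_on (\<lambda>x. f x + g x) S"
  by (simp add: smooth_on_def Ck_on_add)

lemma smooth_on_bilinear:
  "bounded_bilinear b \<Longrightarrow> open S \<Longrightarrow> smooth_on f S \<Longrightarrow> smooth_on g S \<Longrightarrow> smooth_on (\<lambda>x. b (f x) (g x)) S"
  by (simp add: smooth_on_def Ck_on_bilinear)

lemma smooth_on_mult [smooth]:
  fixes f g :: "'a::real_normed_vector \<Rightarrow> real"
  shows "open S \<Longrightarrow> smooth_on f S \<Longrightarrow> smooth_on g S \<Longrightarrow> smooth_on (\<lambda>x. f x * g x) S"
  by (simp add: smooth_on_def Ck_on_mult)

lemma smooth_on_scaleR [smooth]: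
  "open S \<Longrightarrow> smooth_on f S \<Longrightarrow> smooth_on g S \<Longrightarrow> smooth_on (\<lambda>x. f x *\<^sub>R g x) S"
  by (rule smooth_on_bilinear[OF bounded_bilinear_scaleR])

lemma smooth_on_compose:
  fixes f :: "'a::real_normed_vector \<Rightarrow> 'b::euclidean_space"
  shows "open S \<Longrightarrow> f ` S \<subseteq> T \<Longrightarrow> smooth_on f S \<Longrightarrow> smooth_on g T \<Longrightarrow> smooth_on (\<lambda>x. g (f x)) S"
  unfolding smooth_on_def using Ck_on_compose[of S f T] by blast

lemma smooth_on_linear_compose:
  fixes f :: "'a::real_normed_vector \<Rightarrow> 'b::euclidean_space"
  shows "bounded_linear L \<Longrightarrow> open S \<Longrightarrow> smooth_on f S \<Longrightarrow> smooth_on (\<lambda>x. L (f x)) S"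
  by (rule smooth_on_compose[where T = UNIV]) (auto intro: smooth_on_bounded_linear)

lemma smooth_on_minus [smooth]:
  fixes f :: "'a::real_normed_vector \<Rightarrow> real"
  shows "open S \<Longrightarrow> smooth_on f S \<Longrightarrow> smooth_on (\<lambda>x. - f x) S"
  using smooth_on_mult[of S "\<lambda>x. -1" f] smooth_on_const[of "-1" S] by simp

lemma smooth_on_diff [smooth]:
  fixes f :: "'a::real_normed_vector \<Rightarrow> real"
  shows "open S \<Longrightarrow> smooth_on f S \<Longrightarrow> smooth_on g S \<Longrightarrow> smooth_on (\<lambda>x. f x - g x) S"
  using smooth_on_add[of S f "\<lambda>x. - g x"] smooth_on_minus[of S g] by (simp only: diff_conv_add_uminus)

lemma smooth_on_sum [smooth]:
  "open S \<Longrightarrow> (\<And>i. i \<in> I \<Longrightarrow> smooth_on (f i) S) \<Longrightarrow> smooth_on (\<lambda>x. \<Sum>i\<in>I. f i x) S"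
  by (simp add: smooth_on_def Ck_on_sum)

lemma smooth_on_exp [smooth]:
  fixes f :: "'a::real_normed_vector \<Rightarrow> real"
  shows "open S \<Longrightarrow> smooth_on f S \<Longrightarrow> smooth_on (\<lambda>x. exp (f x)) S"
  by (rule smooth_on_compose[where T = UNIV]) (auto simp: smooth_on_def Ck_on_exp_real)

lemma smooth_on_inverse [smooth]:
  fixes g :: "'a::real_normed_vector \<Rightarrow> real"
  assumes "open S" "smooth_on g S" "\<And>x. x \<in> S \<Longrightarrow> g x \<noteq> 0"
  shows "smooth_on (\<lambda>x. inverse (g x)) S"
  by (rule smooth_on_compose[of S g "-{0}" inverse]) (use assms in
      \<open>auto simp: smooth_on_def Ck_on_inverse_real\<close>)

lemma smooth_on_divide [smooth]:
  fixes f g :: "'a::real_normed_vector \<Rightarrow> real"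
  assumes "open S" "smooth_on f S" "smooth_on g S" "\<And>x. x \<in> S \<Longrightarrow> g x \<noteq> 0"
  shows "smooth_on (\<lambda>x. f x / g x) S"
  unfolding divide_inverse using assms by (intro smooth_on_mult smooth_on_inverse)

lemma smooth_on_sqrt [smooth]:
  fixes f :: "'a::real_normed_vector \<Rightarrow> real"
  shows "open S \<Longrightarrow> smooth_on f S \<Longrightarrow> (\<And>x. x \<in> S \<Longrightarrow> 0 < f x) \<Longrightarrow> smooth_on (\<lambda>x. sqrt (f x)) S"
  by (rule smooth_on_compose[where T = "{0<..}"]) (auto simp: smooth_on_def Ck_on_sqrt_real)

lemma smooth_on_vec_nth [smooth]:
  fixes f :: "'a::real_normed_vector \<Rightarrow> 'b::euclidean_space ^ 'n"
  shows "open S \<Longrightarrow> smooth_on f S \<Longrightarrow> smooth_on (\<lambda>x. f x $ i) S"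
  by (rule smooth_on_linear_compose[OF bounded_linear_vec_nth])

declare smooth_on_dir_deriv [smooth] smooth_on_partial [smooth]

section \<open>Symmetry of mixed derivatives\<close>

lemma dir_deriv_line:
  fixes F :: "'a::real_normed_vector \<Rightarrow> real"
  assumes "F differentiable (at (y + r *\<^sub>R w))"
  shows "((\<lambda>r. F (y + r *\<^sub>R w)) has_real_derivative dir_deriv w F (y + r *\<^sub>R w)) (at r)"
proof -
  have "((\<lambda>r. F (y + r *\<^sub>R w)) has_derivative (\<lambda>d. dir_deriv (d *\<^sub>R w) F (y + r *\<^sub>R w))) (at r)"
    by (rule has_derivative_compose[where f = "\<lambda>r. y + r *\<^sub>R w" and g = F, OF _ dir_deriv_works[OF assms]])
      (auto intro!: derivative_eq_intros)
  then show ?thesis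
    using linear_cmul[OF has_derivative_linear[OF dir_deriv_works[OF assms]]]
    by (simp add: has_field_derivative_def mult_commute_abs)
qed

text \<open>Two applications of the mean value theorem write the second difference over a small
  parallelogram as \<open>h * h\<close> times one mixed derivative at some point of it. The second
  difference is symmetric in \<open>u\<close> and \<open>v\<close>, so both mixed derivatives share
  a value at nearby points, and continuity carries this to \<open>x\<close>.\<close>

lemma dir_deriv_commute:
  fixes f :: "'a::real_normed_vector \<Rightarrow> real"
  assumes "open S" "smooth_on f S" "x \<in> S"
  shows "dir_deriv u (dir_deriv v f) x = dir_deriv v (dir_deriv u f) x"
proof (rule ccontr)
  have *: "\<exists>p. dist p x < e \<and> p \<in> S \<and> f (x + h *\<^sub>R u + h *\<^sub>R v) - f (x + h *\<^sub>R u) - (f (x + h *\<^sub>R v) - f x)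
       = h * h * dir_deriv v (dir_deriv u f) p"
    if h: "0 < h" "h * (norm u + norm v) < e" and e: "ball x e \<subseteq> S" for h e u v
  proof -
    have inS: "x + a *\<^sub>R u + b *\<^sub>R v \<in> S \<and> dist (x + a *\<^sub>R u + b *\<^sub>R v) x < e"
      if "0 \<le> a" "a \<le> h" "0 \<le> b" "b \<le> h" for a b
    proof -
      have "norm (a *\<^sub>R u + b *\<^sub>R v) \<le> a * norm u + b * norm v"
        using that by (metis abs_of_nonneg norm_scaleR norm_triangle_ineq)
      also have "\<dots> \<le> h * norm u + h * norm v"
        using that by (intro add_mono mult_right_mono) auto
      finally have "dist (x + a *\<^sub>R u + b *\<^sub>R v) x < e"
        using h by (simp add: dist_norm distrib_left add.assoc)
      then show ?thesis using e by (auto simp: dist_commute)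
    qed
    have sd: "F differentiable (at p)" if "smooth_on F S" "p \<in> S" for F :: "'a \<Rightarrow> real" and p
      using that by (rule smooth_on_differentiable)
    have "\<exists>a. 0 < a \<and> a < h \<and>
       (f (x + h *\<^sub>R u + h *\<^sub>R v) - f (x + h *\<^sub>R u)) - (f (x + 0 *\<^sub>R u + h *\<^sub>R v) - f (x + 0 *\<^sub>R u))
       = (h - 0) * (dir_deriv u f (x + a *\<^sub>R u + h *\<^sub>R v) - dir_deriv u f (x + a *\<^sub>R u))"
    proof (rule MVT2[OF h(1)])
      fix r assume "0 \<le> r" "r \<le> h"
      then have "x + r *\<^sub>R u + h *\<^sub>R v \<in> S" "x + r *\<^sub>R u \<in> S"
        using inS[of r h] inS[of r 0] h by auto
      then show "((\<lambda>r. f (x + r *\<^sub>R u + h *\<^sub>R v) - f (x + r *\<^sub>R u)) has_real_derivative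
          dir_deriv u f (x + r *\<^sub>R u + h *\<^sub>R v) - dir_deriv u f (x + r *\<^sub>R u)) (at r)"
        using dir_deriv_line[of f "x + h *\<^sub>R v" r u] dir_deriv_line[of f x r u] sd[OF assms(2)]
        by (intro DERIV_diff) (auto simp: algebra_simps)
    qed
    then obtain a where a: "0 < a" "a < h" "f (x + h *\<^sub>R u + h *\<^sub>R v) - f (x + h *\<^sub>R u) - (f (x + h *\<^sub>R v) - f x)
       = h * (dir_deriv u f (x + a *\<^sub>R u + h *\<^sub>R v) - dir_deriv u f (x + a *\<^sub>R u))"
      by auto
    have "\<exists>b. 0 < b \<and> b < h \<and> dir_deriv u f (x + a *\<^sub>R u + h *\<^sub>R v) - dir_deriv u f (x + a *\<^sub>R u + 0 *\<^sub>R v)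
       = (h - 0) * dir_deriv v (dir_deriv u f) (x + a *\<^sub>R u + b *\<^sub>R v)"
    proof (rule MVT2[OF h(1)])
      fix r assume "0 \<le> r" "r \<le> h"
      then show "((\<lambda>r. dir_deriv u f (x + a *\<^sub>R u + r *\<^sub>R v)) has_real_derivative
          dir_deriv v (dir_deriv u f) (x + a *\<^sub>R u + r *\<^sub>R v)) (at r)"
        using inS[of a r] a by (intro dir_deriv_line sd smooth_on_dir_deriv assms(2)) auto
    qed
    then obtain b where "0 < b" "b < h" "dir_deriv u f (x + a *\<^sub>R u + h *\<^sub>R v) - dir_deriv u f (x + a *\<^sub>R u)
       = h * dir_deriv v (dir_deriv u f) (x + a *\<^sub>R u + b *\<^sub>R v)"
      by auto
    then show ?thesis using a inS[of a b] by (intro exI[of _ "x + a *\<^sub>R u + b *\<^sub>R v"]) simp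
  qed
  let ?F = "dir_deriv u (dir_deriv v f)" and ?G = "dir_deriv v (dir_deriv u f)"
  assume ne: "?F x \<noteq> ?G x"
  \<comment> \<open>Half the distance: two errors below \<delta> cannot bridge it.\<close>
  define \<delta> where "\<delta> = dist (?F x) (?G x) / 2"
  have d: "\<delta> > 0" using ne by (simp add: \<delta>_def)
  have "continuous_on S ?F" "continuous_on S ?G"
    using assms by (auto intro!: smooth_on_continuous smooth)
  then have "continuous (at x) ?F" "continuous (at x) ?G"
    using assms continuous_on_eq_continuous_at by blast+
  then obtain d1 d2 where d12: "d1 > 0" "d2 > 0" "\<And>p. dist p x < d1 \<Longrightarrow> dist (?F p) (?F x) < \<delta>"
    "\<And>p. dist p x < d2 \<Longrightarrow> dist (?G p) (?G x) < \<delta>"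
    using d unfolding continuous_at_eps_delta by metis
  obtain e0 where e0: "e0 > 0" "ball x e0 \<subseteq> S" using assms openE by blast
  define e where "e = min e0 (min d1 d2)"
  have e: "e > 0" "ball x e \<subseteq> S" using e0 d12 by (auto simp: e_def)
  \<comment> \<open>Small enough for the whole parallelogram to stay in the ball of radius
    \<open>e\<close>. The summand 1 keeps the denominator positive when both directions
    vanish.\<close>
  define h where "h = e / (2 * (norm u + norm v + 1))"
  have pos: "norm u + norm v + 1 > 0" by (simp add: add_nonneg_pos)
  then have h: "h > 0" using e by (simp add: h_def)
  have "h * (norm u + norm v) \<le> h * (norm u + norm v + 1)" using h by (intro mult_left_mono) auto
  also have "\<dots> = e / 2"
  proof -
    have "e / (2 * d) * d = e / 2" if "d > 0" for d :: real using that by simp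
    from this[OF pos] show ?thesis unfolding h_def .
  qed
  also have "\<dots> < e" using e by simp
  finally have hs: "h * (norm u + norm v) < e" .
  obtain p where p: "dist p x < e"
    "f (x + h *\<^sub>R u + h *\<^sub>R v) - f (x + h *\<^sub>R u) - (f (x + h *\<^sub>R v) - f x) = h * h * ?G p"
    using *[OF h hs e(2)] by blast
  obtain q where q: "dist q x < e"
    "f (x + h *\<^sub>R v + h *\<^sub>R u) - f (x + h *\<^sub>R v) - (f (x + h *\<^sub>R u) - f x) = h * h * ?F q"
    using *[OF h _ e(2), of v u] hs by (auto simp: add.commute)
  have "h * h * ?G p = h * h * ?F q" using p(2) q(2) by (simp add: algebra_simps)
  then have "?G p = ?F q" using h by simp
  moreover have "dist (?F q) (?F x) < \<delta>" "dist (?G p) (?G x) < \<delta>"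
    using p q d12 by (auto simp: e_def)
  ultimately have "dist (?F x) (?G x) < \<delta> + \<delta>" by (metis dist_commute dist_triangle_less_add)
  then show False by (simp add: \<delta>_def)
qed

section \<open>Two-jets of functions on the plane\<close>

text \<open>Listing the derivatives up to order two as separate real parameters turns statements
  about curvature into polynomial identities between numbers. The single \<open>u12\<close> for both
  mixed derivatives has their symmetry built in.\<close>

definition has_jet :: "(real^2) set \<Rightarrow> (real^2 \<Rightarrow> real) \<Rightarrow> real^2 \<Rightarrow>
    real \<Rightarrow> real \<Rightarrow> real \<Rightarrow> real \<Rightarrow> real \<Rightarrow> real \<Rightarrow> bool" where
  "has_jet S u y u0 u1 u2 u11 u12 u22 \<longleftrightarrow> open S \<and> y \<in> S \<and> smooth_on u S \<and>
     u y = u0 \<and> partial 1 u y = u1 \<and> partial 2 u y = u2 \<and> partial 1 (partial 1 u) y = u11 \<and>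
     partial 2 (partial 1 u) y = u12 \<and> partial 1 (partial 2 u) y = u12 \<and> partial 2 (partial 2 u) y = u22"

lemma partial_commute:
  "open S \<Longrightarrow> smooth_on u S \<Longrightarrow> y \<in> S \<Longrightarrow> partial i (partial j u) y = partial j (partial i u) y"
  by (simp add: partial_dir_deriv dir_deriv_commute)

lemma partial_cong:
  "open S \<Longrightarrow> y \<in> S \<Longrightarrow> (\<And>z. z \<in> S \<Longrightarrow> u z = v z) \<Longrightarrow> partial i u y = partial i v y"
  unfolding partial_dir_deriv by (rule dir_deriv_cong)

lemma dir_deriv_add:
  assumes "f differentiable (at x)" "g differentiable (at x)"
  shows "dir_deriv v (\<lambda>x. f x + g x) x = dir_deriv v f x + dir_deriv v g x"
  by (rule dir_deriv_eqI[OF has_derivative_add[OF assms[THEN dir_deriv_works]]])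

lemma dir_deriv_mult:
  fixes f g :: "'a::real_normed_vector \<Rightarrow> real"
  assumes "f differentiable (at x)" "g differentiable (at x)"
  shows "dir_deriv v (\<lambda>x. f x * g x) x = dir_deriv v f x * g x + f x * dir_deriv v g x"
  using dir_deriv_eqI[OF has_derivative_mult[OF assms[THEN dir_deriv_works]]] by simp

lemma dir_deriv_compose:
  assumes "f differentiable (at x)" "g differentiable (at (f x))"
  shows "dir_deriv v (\<lambda>x. g (f x)) x = dir_deriv (dir_deriv v f x) g (f x)"
  by (rule dir_deriv_eqI[OF has_derivative_compose[where f = f and g = g, OF assms[THEN dir_deriv_works]]])

lemma dir_deriv_expand:
  fixes g :: "real^2 \<Rightarrow> real"
  assumes "g differentiable (at x)"
  shows "dir_deriv v g x = v$1 * partial 1 g x + v$2 * partial 2 g x"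
proof -
  have lin: "linear (\<lambda>v. dir_deriv v g x)" using assms dir_deriv_works has_derivative_linear by blast
  have "v = v$1 *\<^sub>R axis 1 1 + v$2 *\<^sub>R axis 2 1" by (simp add: vec_eq_iff forall_2 axis_def)
  then have "dir_deriv v g x = dir_deriv (v$1 *\<^sub>R axis 1 1 + v$2 *\<^sub>R axis 2 1) g x" by simp
  then show ?thesis by (simp add: partial_dir_deriv linear_add[OF lin] linear_cmul[OF lin])
qed

lemma dir_deriv_linear_compose:
  assumes "bounded_linear L" "f differentiable (at x)"
  shows "dir_deriv v (\<lambda>x. L (f x)) x = L (dir_deriv v f x)"
  by (rule dir_deriv_eqI[OF bounded_linear.has_derivative[OF assms(1) dir_deriv_works[OF assms(2)]]])

lemma partial_add:
  "u differentiable (at y) \<Longrightarrow> v differentiable (at y) \<Longrightarrow>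
   partial i (\<lambda>z. u z + v z) y = partial i u y + partial i v y"
  by (simp add: partial_dir_deriv dir_deriv_add)

lemma partial_mult:
  "u differentiable (at y) \<Longrightarrow> v differentiable (at y) \<Longrightarrow>
   partial i (\<lambda>z. u z * v z) y = partial i u y * v y + u y * partial i v y"
  by (simp add: partial_dir_deriv dir_deriv_mult)

lemma partial_compose:
  fixes f :: "real^2 \<Rightarrow> real^2"
  assumes "f differentiable (at y)" "u differentiable (at (f y))"
  shows "partial i (\<lambda>z. u (f z)) y = partial 1 u (f y) * partial i (\<lambda>z. f z $ 1) y
      + partial 2 u (f y) * partial i (\<lambda>z. f z $ 2) y"
proof -
  have "partial i (\<lambda>z. u (f z)) y = dir_deriv (dir_deriv (axis i 1) f y) u (f y)"
    unfolding partial_dir_deriv by (rule dir_deriv_compose[OF assms])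
  then show ?thesis
    by (simp add: dir_deriv_expand[OF assms(2)] mult.commute
        partial_dir_deriv[of i] dir_deriv_linear_compose[OF bounded_linear_vec_nth assms(1)])
qed

lemma partial_const [simp]: "partial i (\<lambda>z. c) y = 0"
  by (simp add: partial_def)

lemma partial_cmult: "u differentiable (at y) \<Longrightarrow> partial i (\<lambda>z. c * u z) y = c * partial i u y"
  using partial_mult[of "\<lambda>z. c" y u] by simp

lemma partial_diff:
  assumes "u differentiable (at y)" "v differentiable (at y)"
  shows "partial i (\<lambda>z. u z - v z) y = partial i u y - partial i v y"
  using partial_add[OF assms(1), of "\<lambda>z. (-1) * v z"] partial_cmult[OF assms(2), of i "-1"] assms(2)
  by simp

lemma partial_cdivide:
  assumes "u differentiable (at y)" shows "partial i (\<lambda>z. u z / c) y = partial i u y / c"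
  using partial_cmult[OF assms, of i "inverse c"] by (simp add: divide_inverse mult.commute)

lemma partial_real_compose:
  fixes u :: "real^2 \<Rightarrow> real"
  assumes "u differentiable (at y)" "(F has_real_derivative F') (at (u y))"
  shows "partial i (\<lambda>z. F (u z)) y = F' * partial i u y"
proof -
  have "((\<lambda>z. F (u z)) has_derivative (\<lambda>v. F' * dir_deriv v u y)) (at y)"
    using has_derivative_compose[where f = u and g = F, OF dir_deriv_works[OF assms(1)]] assms(2)
    by (simp add: has_field_derivative_def)
  then show ?thesis by (simp add: partial_dir_deriv dir_deriv_eqI)
qed

lemma has_jet_self:
  assumes "open S" "smooth_on u S" "y \<in> S"
  shows "has_jet S u y (u y) (partial 1 u y) (partial 2 u y)
    (partial 1 (partial 1 u) y) (partial 2 (partial 1 u) y) (partial 2 (partial 2 u) y)"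
  using assms by (simp add: has_jet_def partial_commute[of S u y 1 2])

lemma has_jet_add:
  assumes "has_jet S u y u0 u1 u2 u11 u12 u22" "has_jet S v y v0 v1 v2 v11 v12 v22"
  shows "has_jet S (\<lambda>z. u z + v z) y (u0+v0) (u1+v1) (u2+v2) (u11+v11) (u12+v12) (u22+v22)"
proof -
  have S: "open S" "y \<in> S" "smooth_on u S" "smooth_on v S" using assms by (auto simp: has_jet_def)
  note d = smooth_on_differentiable
  have 1: "partial i (\<lambda>z. u z + v z) z = partial i u z + partial i v z" if "z \<in> S" for i z
    using that S by (simp add: partial_add d)
  have "partial j (partial i (\<lambda>z. u z + v z)) y = partial j (partial i u) y + partial j (partial i v) y" for i j
    using S by (simp add: partial_cong[OF S(1,2) 1] partial_add d[OF smooth_on_partial])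
  then show ?thesis using assms 1 unfolding has_jet_def by (simp add: smooth)
qed

lemma has_jet_mult:
  assumes "has_jet S u y u0 u1 u2 u11 u12 u22" "has_jet S v y w0 w1 w2 w11 w12 w22"
  shows "has_jet S (\<lambda>z. u z * v z) y (u0*w0) (u1*w0 + u0*w1) (u2*w0 + u0*w2)
    (u11*w0 + 2*u1*w1 + u0*w11) (u12*w0 + u1*w2 + u2*w1 + u0*w12) (u22*w0 + 2*u2*w2 + u0*w22)"
proof -
  have S: "open S" "y \<in> S" "smooth_on u S" "smooth_on v S" using assms by (auto simp: has_jet_def)
  note d = smooth_on_differentiable
  have 1: "partial i (\<lambda>z. u z * v z) z = partial i u z * v z + u z * partial i v z" if "z \<in> S" for i z
    using that S by (simp add: partial_mult d)
  have "partial j (partial i (\<lambda>z. u z * v z)) y =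
      partial j (\<lambda>z. partial i u z * v z + u z * partial i v z) y" for i j
    by (rule partial_cong[OF S(1,2) 1])
  also have "\<dots> i j = partial j (partial i u) y * v y + partial i u y * partial j v y
       + (partial j u y * partial i v y + u y * partial j (partial i v) y)" for i j
    by (simp add: partial_add partial_mult d[OF _ S(2)] smooth_on_partial S)
  finally show ?thesis using assms 1 unfolding has_jet_def by (simp add: smooth algebra_simps)
qed

lemma has_jet_compose:
  fixes f :: "real^2 \<Rightarrow> real^2"
  assumes f: "smooth_on f S" "f ` S \<subseteq> T"
    and p: "has_jet S (\<lambda>z. f z $ 1) y p0 p1 p2 p11 p12 p22"
    and q: "has_jet S (\<lambda>z. f z $ 2) y q0 q1 q2 q11 q12 q22"
    and u: "has_jet T u (f y) u0 u1 u2 u11 u12 u22"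
  shows "has_jet S (\<lambda>z. u (f z)) y u0 (u1*p1 + u2*q1) (u1*p2 + u2*q2)
    (u11*p1*p1 + 2*u12*p1*q1 + u22*q1*q1 + u1*p11 + u2*q11)
    (u11*p1*p2 + u12*(p1*q2+p2*q1) + u22*q1*q2 + u1*p12 + u2*q12)
    (u11*p2*p2 + 2*u12*p2*q2 + u22*q2*q2 + u1*p22 + u2*q22)"
proof -
  have S: "open S" "y \<in> S" "open T" "smooth_on u T" "smooth_on (\<lambda>z. f z $ 1) S" "smooth_on (\<lambda>z. f z $ 2) S"
    using assms by (auto simp: has_jet_def)
  note d = smooth_on_differentiable
  have sc: "smooth_on (\<lambda>z. g (f z)) S" if "smooth_on g T" for g :: "real^2 \<Rightarrow> real"
    using smooth_on_compose[OF S(1) f(2,1) that] .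
  have 1: "partial i (\<lambda>z. g (f z)) z = partial 1 g (f z) * partial i (\<lambda>z. f z $ 1) z
      + partial 2 g (f z) * partial i (\<lambda>z. f z $ 2) z" if "z \<in> S" "smooth_on g T" for g i z
    using that S f by (intro partial_compose) (auto intro: d)
  have "partial j (partial i (\<lambda>z. u (f z))) y =
      partial j (\<lambda>z. partial 1 u (f z) * partial i (\<lambda>z. f z $ 1) z
       + partial 2 u (f z) * partial i (\<lambda>z. f z $ 2) z) y" for i j
    by (rule partial_cong[OF S(1,2) 1[OF _ S(4)]])
  also have "\<dots> i j =
     partial j (\<lambda>z. partial 1 u (f z)) y * partial i (\<lambda>z. f z $ 1) y
     + partial 1 u (f y) * partial j (partial i (\<lambda>z. f z $ 1)) y
     + (partial j (\<lambda>z. partial 2 u (f z)) y * partial i (\<lambda>z. f z $ 2) y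
     + partial 2 u (f y) * partial j (partial i (\<lambda>z. f z $ 2)) y)" for i j
    by (simp add: partial_add partial_mult d[OF _ S(2)] smooth_on_partial S sc)
  finally show ?thesis
    using assms 1 sc[OF S(4)] S(2) smooth_on_partial[OF S(4)] unfolding has_jet_def
    by (simp add: algebra_simps)
qed

lemma has_jet_exp:
  assumes "has_jet S u y u0 u1 u2 u11 u12 u22"
  shows "has_jet S (\<lambda>z. exp (2 * u z)) y (exp (2*u0)) (exp (2*u0) * (2*u1)) (exp (2*u0) * (2*u2))
    (exp (2*u0) * (2*u11 + 4*u1*u1)) (exp (2*u0) * (2*u12 + 4*u1*u2)) (exp (2*u0) * (2*u22 + 4*u2*u2))"
proof -
  have S: "open S" "y \<in> S" "smooth_on u S" using assms by (auto simp: has_jet_def)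
  note d = smooth_on_differentiable
  have 1: "partial i (\<lambda>z. exp (2 * u z)) z = 2 * (exp (2 * u z) * partial i u z)" if "z \<in> S" for i z
    unfolding mult.assoc[symmetric]
    by (rule partial_real_compose[OF d[OF S(3) that]]) (auto intro!: derivative_eq_intros)
  have "partial j (partial i (\<lambda>z. exp (2 * u z))) y = partial j (\<lambda>z. 2 * (exp (2 * u z) * partial i u z)) y" for i j
    by (rule partial_cong[OF S(1,2) 1])
  also have "\<dots> i j = 2 * (partial j (\<lambda>z. exp (2 * u z)) y * partial i u y + exp (2 * u y) * partial j (partial i u) y)" for i j
    by (simp add: partial_cmult partial_mult d[OF _ S(2)] smooth_on_partial smooth_on_mult
        smooth_on_exp smooth_on_const S)
  finally show ?thesis using assms 1[OF S(2)] unfolding has_jet_def by (simp add: smooth algebra_simps)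
qed

section \<open>Curvature in a coordinate patch\<close>

definition local_curvature :: "(real^2 \<Rightarrow> real^2^2) \<Rightarrow> real^2 \<Rightarrow> real" where
  "local_curvature h y = (\<Sum>l\<in>UNIV. h y $ 1 $ l * riemann h l 2 1 2 y) / det (h y)"

text \<open>The inverse metric is written as adjugate over determinant, and the entry 1, 2 stands
  for both off-diagonal ones. Only partial derivatives and rational operations remain, so smoothness
  and parameter derivatives follow from the usual rules.\<close>

definition local_inner :: "(real^2 \<Rightarrow> real^2^2) \<Rightarrow> (real^2 \<Rightarrow> real) \<Rightarrow> (real^2 \<Rightarrow> real) \<Rightarrow> real^2 \<Rightarrow> real" where
  "local_inner h a b y =
     (h y $ 2 $ 2 * partial 1 a y * partial 1 b y
      - h y $ 1 $ 2 * (partial 1 a y * partial 2 b y + partial 2 a y * partial 1 b y)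
      + h y $ 1 $ 1 * partial 2 a y * partial 2 b y) / det (h y)"

text \<open>The flux is \<open>\<surd>(det h) h\<^sup>i\<^sup>j \<partial>\<^sub>j u\<close>, a vector density.\<close>

definition flux1 :: "(real^2 \<Rightarrow> real^2^2) \<Rightarrow> (real^2 \<Rightarrow> real) \<Rightarrow> real^2 \<Rightarrow> real" where
  "flux1 h u y = (h y $ 2 $ 2 * partial 1 u y - h y $ 1 $ 2 * partial 2 u y) * inverse (sqrt (det (h y)))"

definition flux2 :: "(real^2 \<Rightarrow> real^2^2) \<Rightarrow> (real^2 \<Rightarrow> real) \<Rightarrow> real^2 \<Rightarrow> real" where
  "flux2 h u y = (h y $ 1 $ 1 * partial 2 u y - h y $ 1 $ 2 * partial 1 u y) * inverse (sqrt (det (h y)))"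

text \<open>The Laplace-Beltrami operator in divergence form, with the sign that makes it the
  divergence of the gradient.\<close>

definition local_laplacian :: "(real^2 \<Rightarrow> real^2^2) \<Rightarrow> (real^2 \<Rightarrow> real) \<Rightarrow> real^2 \<Rightarrow> real" where
  "local_laplacian h u y = (partial 1 (flux1 h u) y + partial 2 (flux2 h u) y) / sqrt (det (h y))"

text \<open>The inverse metric applied to two covectors, multiplied by the determinant.\<close>

definition adj_form :: "real \<Rightarrow> real \<Rightarrow> real \<Rightarrow> real \<Rightarrow> real \<Rightarrow> real \<Rightarrow> real \<Rightarrow> real" where
  "adj_form e f g a1 a2 b1 b2 = g*a1*b1 - f*(a1*b2 + a2*b1) + e*a2*b2"

text \<open>Brioschi's formula for the Gauss curvature of \<open>e dx\<^sup>2 + 2 f dx dy + g dy\<^sup>2\<close>.\<close>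

definition brioschi where
  "brioschi e e1 e2 e22 f f1 f2 f12 g g1 g2 g11 =
     ((f12 - e22/2 - g11/2) * (e*g - f*f)
      - (adj_form e f g (f2 - g1/2) (g2/2) (e1/2) (f1 - e2/2)
         - adj_form e f g (e2/2) (g1/2) (e2/2) (g1/2))) / (e*g - f*f)\<^sup>2"

text \<open>The divergence form of the Laplacian multiplied out. The second fraction comes from
  differentiating the reciprocal root of the determinant; together with the outer reciprocal root,
  all roots combine to powers of \<open>e*g - f*f\<close>.\<close>

definition laplacian_expr where
  "laplacian_expr e e1 e2 f f1 f2 g g1 g2 u1 u2 u11 u12 u22 =
     (g1*u1 + g*u11 - f1*u2 - f*u12 + (e2*u2 + e*u22 - f2*u1 - f*u12)) / (e*g - f*f)
     - ((g*u1 - f*u2) * (e1*g + e*g1 - 2*f*f1) + (e*u2 - f*u1) * (e2*g + e*g2 - 2*f*f2)) / (2*(e*g - f*f)\<^sup>2)"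

text \<open>With \<open>c = exp (2 * u)\<close>, the arguments on the left are the jets of
  \<open>c\<close> times the metric components. All terms quadratic in the gradient of
  \<open>u\<close> cancel, and what is linear in the jet of \<open>u\<close> is minus the
  Laplacian.\<close>

lemma brioschi_conformal:
  assumes "c > 0" and D: "e*g - f*f > 0"
  shows "c * brioschi (c*e) (c*(2*u1)*e + c*e1) (c*(2*u2)*e + c*e2) (c*(2*u22 + 4*u2*u2)*e + 2*(c*(2*u2))*e2 + c*e22)
      (c*f) (c*(2*u1)*f + c*f1) (c*(2*u2)*f + c*f2) (c*(2*u12 + 4*u1*u2)*f + c*(2*u1)*f2 + c*(2*u2)*f1 + c*f12)
      (c*g) (c*(2*u1)*g + c*g1) (c*(2*u2)*g + c*g2) (c*(2*u11 + 4*u1*u1)*g + 2*(c*(2*u1))*g1 + c*g11)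
     = brioschi e e1 e2 e22 f f1 f2 f12 g g1 g2 g11 - laplacian_expr e e1 e2 f f1 f2 g g1 g2 u1 u2 u11 u12 u22"
proof -
  let ?D = "e*g - f*f"
  let ?N = "(f12 - e22/2 - g11/2) * ?D - (adj_form e f g (f2 - g1/2) (g2/2) (e1/2) (f1 - e2/2)
       - adj_form e f g (e2/2) (g1/2) (e2/2) (g1/2))
     - (g1*u1 + g*u11 - f1*u2 - f*u12 + (e2*u2 + e*u22 - f2*u1 - f*u12)) * ?D
     + ((g*u1 - f*u2) * (e1*g + e*g1 - 2*f*f1) + (e*u2 - f*u1) * (e2*g + e*g2 - 2*f*f2)) / 2"
  \<comment> \<open>Each term of the numerator is cubic in the metric components and their
    derivatives, which accounts for \<open>c ^ 3\<close>; the squared determinant gives the fourth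
    power, and the outer \<open>c\<close> balances the two.\<close>
  have num: "((c*(2*u12 + 4*u1*u2)*f + c*(2*u1)*f2 + c*(2*u2)*f1 + c*f12)
        - (c*(2*u22 + 4*u2*u2)*e + 2*(c*(2*u2))*e2 + c*e22)/2
        - (c*(2*u11 + 4*u1*u1)*g + 2*(c*(2*u1))*g1 + c*g11)/2) * ((c*e)*(c*g) - (c*f)*(c*f))
      - (adj_form (c*e) (c*f) (c*g) ((c*(2*u2)*f + c*f2) - (c*(2*u1)*g + c*g1)/2) ((c*(2*u2)*g + c*g2)/2)
          ((c*(2*u1)*e + c*e1)/2) ((c*(2*u1)*f + c*f1) - (c*(2*u2)*e + c*e2)/2)
       - adj_form (c*e) (c*f) (c*g) ((c*(2*u2)*e + c*e2)/2) ((c*(2*u1)*g + c*g1)/2)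
          ((c*(2*u2)*e + c*e2)/2) ((c*(2*u1)*g + c*g1)/2)) = c ^ 3 * ?N"
    unfolding adj_form_def by (simp add: field_simps power3_eq_cube)
  have den: "(c*e)*(c*g) - (c*f)*(c*f) = c\<^sup>2 * ?D" by (simp add: algebra_simps power2_eq_square)
  have "c * (c ^ 3 * n / (c\<^sup>2 * d)\<^sup>2) = n / d\<^sup>2" for n d :: real
    using assms(1) by (simp add: power_mult_distrib power3_eq_cube power2_eq_square)
  moreover have "a / d\<^sup>2 - (b / d - b' / (2 * d\<^sup>2)) = (a - b * d + b' / 2) / d\<^sup>2" if "d > 0" for a b b' d :: real
    using that by (simp add: field_simps power2_eq_square)
  ultimately show ?thesis
    unfolding brioschi_def laplacian_expr_def num unfolding den using D by metis
qed

text \<open>\<open>matrix_inv\<close> is a choice of a two-sided inverse. Inverses being unique, it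
  equals the adjugate over the determinant as soon as that matrix is known to be one.\<close>

lemma matrix_inv_2:
  fixes A :: "real^2^2"
  assumes "det A \<noteq> 0"
  shows "matrix_inv A $ 1 $ 1 = A $ 2 $ 2 / det A" "matrix_inv A $ 1 $ 2 = - A $ 1 $ 2 / det A"
    "matrix_inv A $ 2 $ 1 = - A $ 2 $ 1 / det A" "matrix_inv A $ 2 $ 2 = A $ 1 $ 1 / det A"
proof -
  define B :: "real^2^2" where "B = (\<chi> i j. if i = 1 then (if j = 1 then A$2$2 else - A$1$2) / det A
     else (if j = 1 then - A$2$1 else A$1$1) / det A)"
  have inv: "a * b / d - a' * b' / d = 1 \<and> b * a / d - b' * a' / d = 1"
    if "d = a * b - a' * b'" "d \<noteq> 0" for a b a' b' d :: real
    using that by (simp add: mult.commute flip: diff_divide_distrib)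
  from inv[OF det_2[of A] assms] have AB: "A ** B = mat 1"
    by (simp add: vec_eq_iff forall_2 matrix_matrix_mult_def sum_2 B_def mat_def mult.commute)
  then have "\<exists>A'. A ** A' = mat 1 \<and> A' ** A = mat 1" by (meson matrix_left_right_inverse)
  then have "matrix_inv A ** A = mat 1" unfolding matrix_inv_def by (metis (mono_tags, lifting) someI_ex)
  then have "matrix_inv A = B" using AB by (metis matrix_mul_assoc matrix_mul_lid matrix_mul_rid)
  then show "matrix_inv A $ 1 $ 1 = A $ 2 $ 2 / det A" "matrix_inv A $ 1 $ 2 = - A $ 1 $ 2 / det A"
    "matrix_inv A $ 2 $ 1 = - A $ 2 $ 1 / det A" "matrix_inv A $ 2 $ 2 = A $ 1 $ 1 / det A"
    by (simp_all add: B_def)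
qed

section \<open>Metrics on an open subset of the plane\<close>

locale plane_metric =
  fixes h :: "real^2 \<Rightarrow> real^2^2" and S :: "(real^2) set"
  assumes open_S [intro, simp]: "open S"
    and smooth_h: "smooth_on h S"
    and sym: "y \<in> S \<Longrightarrow> transpose (h y) = h y"
    and pos: "y \<in> S \<Longrightarrow> v \<noteq> 0 \<Longrightarrow> v \<bullet> (h y *v v) > 0"
begin

lemma h21: "y \<in> S \<Longrightarrow> h y $ 2 $ 1 = h y $ 1 $ 2"
  using sym[of y] unfolding vec_eq_iff transpose_def by simp

lemma smooth_h_nth [smooth]: "smooth_on (\<lambda>y. h y $ i $ j) S"
  by (intro smooth_on_vec_nth open_S smooth_h)

lemma h11_pos: "y \<in> S \<Longrightarrow> h y $ 1 $ 1 > 0"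
  using pos[of y "axis 1 1"] by (simp add: inner_vec_def matrix_vector_mult_def sum_2 axis_def vec_eq_iff)

lemma det_pos: assumes "y \<in> S" shows "det (h y) > 0"
proof -
  \<comment> \<open>On this vector the quadratic form takes the value
    \<open>h y $ 1 $ 1 * det (h y)\<close>.\<close>
  have "vector [- h y $ 1 $ 2, h y $ 1 $ 1] \<noteq> (0 :: real^2)"
    using h11_pos[OF assms] by (simp add: vec_eq_iff forall_2)
  from pos[OF assms this] have "h y $ 1 $ 1 * det (h y) > 0"
    using h21[OF assms] by (simp add: inner_vec_def matrix_vector_mult_def sum_2 det_2 algebra_simps)
  then show ?thesis using h11_pos[OF assms] zero_less_mult_pos by blast
qed

lemma det_h: "y \<in> S \<Longrightarrow> det (h y) = h y $ 1 $ 1 * h y $ 2 $ 2 - h y $ 1 $ 2 * h y $ 1 $ 2"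
  by (simp add: det_2 h21)

lemma smooth_det [smooth]: "smooth_on (\<lambda>y. det (h y)) S"
  unfolding det_2 by (intro smooth open_S smooth_h)

lemma smooth_flux1 [smooth]: "smooth_on u S \<Longrightarrow> smooth_on (flux1 h u) S"
  unfolding flux1_def[abs_def] by (intro smooth open_S smooth_h) (auto dest: det_pos)

lemma smooth_flux2 [smooth]: "smooth_on u S \<Longrightarrow> smooth_on (flux2 h u) S"
  unfolding flux2_def[abs_def] by (intro smooth open_S smooth_h) (auto dest: det_pos)

lemma smooth_local_inner [smooth]:
  "smooth_on a S \<Longrightarrow> smooth_on b S \<Longrightarrow> smooth_on (local_inner h a b) S"
  unfolding local_inner_def[abs_def] by (intro smooth open_S smooth_h) (auto dest: det_pos)

lemma smooth_local_laplacian [smooth]: "smooth_on u S \<Longrightarrow> smooth_on (local_laplacian h u) S"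
  unfolding local_laplacian_def[abs_def] by (intro smooth open_S smooth_h) (auto dest: det_pos)

text \<open>The rule div(f grad u) = f \<Delta>u + <grad f, grad u>, multiplied by the area density.
  It is the pointwise content of Green's formula.\<close>

lemma divergence_flux:
  assumes y: "y \<in> S" and u: "smooth_on u S" and f: "f differentiable (at y)"
  shows "partial 1 (\<lambda>z. f z * flux1 h u z) y + partial 2 (\<lambda>z. f z * flux2 h u z) y
     = sqrt (det (h y)) * (f y * local_laplacian h u y + local_inner h f u y)"
proof -
  have d: "flux1 h u differentiable (at y)" "flux2 h u differentiable (at y)"
    using smooth_flux1[OF u] smooth_flux2[OF u] y smooth_on_differentiable by blast+
  define r where "r = sqrt (det (h y))"
  have r: "r > 0" "det (h y) = r * r" using det_pos[OF y] by (auto simp: r_def)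
  show ?thesis
    unfolding partial_mult[OF f d(1)] partial_mult[OF f d(2)] local_laplacian_def local_inner_def
      r_def[symmetric] r(2)
    using r by (simp add: flux1_def flux2_def field_simps flip: r_def)
qed

lemma local_inner_gradient:
  assumes "y \<in> S"
  shows "gradient h a y \<bullet> (h y *v gradient h b y) = local_inner h a b y"
proof -
  have D: "det (h y) \<noteq> 0" using det_pos[OF assms] by simp
  define d where "d = inverse (det (h y))"
  have d: "d * (h y $ 1 $ 1 * h y $ 2 $ 2 - h y $ 1 $ 2 * h y $ 1 $ 2) = 1"
    using D det_h[OF assms] by (simp add: d_def)
  show ?thesis
    using d
    by (simp add: local_inner_def gradient_def inner_vec_def matrix_vector_mult_def sum_2 h21[OF assms]
        matrix_inv_2[OF D] divide_inverse flip: d_def) algebra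
qed

lemma local_laplacian_jet:
  assumes "has_jet S (\<lambda>z. h z $ 1 $ 1) y e e1 e2 e11 e12 e22"
    and "has_jet S (\<lambda>z. h z $ 1 $ 2) y f f1 f2 f11 f12 f22"
    and "has_jet S (\<lambda>z. h z $ 2 $ 2) y g g1 g2 g11 g12 g22"
    and "has_jet S u y u0 u1 u2 u11 u12 u22"
  shows "local_laplacian h u y = laplacian_expr e e1 e2 f f1 f2 g g1 g2 u1 u2 u11 u12 u22"
proof -
  have y: "y \<in> S" and u: "smooth_on u S" using assms by (auto simp: has_jet_def)
  note d = smooth_on_differentiable[OF _ y]
  have D: "det (h y) > 0" by (rule det_pos[OF y])
  \<comment> \<open>Naming the root keeps it out of the algebra: in the end only
    \<open>r * r\<close> survives, a polynomial in the jets.\<close>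
  define r where "r = sqrt (det (h y))"
  have r: "r > 0" "det (h y) = r * r" using D by (auto simp: r_def)
  have rr: "r * r = e * g - f * f" using det_h[OF y] assms r by (simp add: has_jet_def)
  have jd: "partial i (\<lambda>z. det (h z)) y = partial i (\<lambda>z. h z $ 1 $ 1) y * g + e * partial i (\<lambda>z. h z $ 2 $ 2) y
      - 2 * f * partial i (\<lambda>z. h z $ 1 $ 2) y" for i
  proof -
    have "partial i (\<lambda>z. det (h z)) y = partial i (\<lambda>z. h z $ 1 $ 1 * h z $ 2 $ 2 - h z $ 1 $ 2 * h z $ 1 $ 2) y"
      by (rule partial_cong[OF open_S y]) (simp add: det_h)
    also have "\<dots> = partial i (\<lambda>z. h z $ 1 $ 1) y * g + e * partial i (\<lambda>z. h z $ 2 $ 2) y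
      - 2 * f * partial i (\<lambda>z. h z $ 1 $ 2) y"
      using assms by (simp add: partial_diff partial_mult d[OF smooth_h_nth] has_jet_def)
    finally show ?thesis .
  qed
  have jr: "partial i (\<lambda>z. inverse (sqrt (det (h z)))) y = - (1 / (2 * r * (r * r))) * partial i (\<lambda>z. det (h z)) y" for i
    by (rule partial_real_compose[OF d[OF smooth_det]])
      (use r in \<open>auto intro!: derivative_eq_intros simp: field_simps power2_eq_square simp flip: r_def\<close>)
  have sr: "smooth_on (\<lambda>z. inverse (sqrt (det (h z)))) S"
    by (intro smooth open_S smooth_h) (auto dest: det_pos)
  have "partial 1 (flux1 h u) y = partial 1 (\<lambda>z. (h z $ 2 $ 2 * partial 1 u z - h z $ 1 $ 2 * partial 2 u z) * inverse (sqrt (det (h z)))) y"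
    by (rule partial_cong[OF open_S y]) (simp add: flux1_def)
  also have "\<dots> = (g1*u1 + g*u11 - f1*u2 - f*u12) * inverse r + (g*u1 - f*u2) * (- (1 / (2 * r * (r * r))) * (e1*g + e*g1 - 2*f*f1))"
    using assms by (simp add: partial_diff partial_mult d smooth_h_nth smooth_on_partial u sr jr jd has_jet_def
       flip: r_def)
  finally have 1: "partial 1 (flux1 h u) y = \<dots>" .
  have "partial 2 (flux2 h u) y = partial 2 (\<lambda>z. (h z $ 1 $ 1 * partial 2 u z - h z $ 1 $ 2 * partial 1 u z) * inverse (sqrt (det (h z)))) y"
    by (rule partial_cong[OF open_S y]) (simp add: flux2_def)
  also have "\<dots> = (e2*u2 + e*u22 - f2*u1 - f*u12) * inverse r + (e*u2 - f*u1) * (- (1 / (2 * r * (r * r))) * (e2*g + e*g2 - 2*f*f2))"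
    using assms by (simp add: partial_diff partial_mult d smooth_h_nth smooth_on_partial u sr jr jd has_jet_def
       flip: r_def)
  finally have 2: "partial 2 (flux2 h u) y = \<dots>" .
  have alg: "(a * inverse r + b * (- (1 / (2 * r * (r * r))) * c) + (a' * inverse r + b' * (- (1 / (2 * r * (r * r))) * c'))) / r
     = (a + a') / (r * r) - (b * c + b' * c') / (2 * (r * r)\<^sup>2)" for a b c a' b' c'
    using r by (simp add: field_simps power2_eq_square)
  show ?thesis
    unfolding local_laplacian_def laplacian_expr_def 1 2 r_def[symmetric] rr[symmetric] alg ..
qed

section \<open>Christoffel symbols and Brioschi's formula\<close>

definition first_kind :: "2 \<Rightarrow> 2 \<Rightarrow> 2 \<Rightarrow> real^2 \<Rightarrow> real" where
  "first_kind l i j y = (1/2) * (partial i (\<lambda>z. h z $ j $ l) y + partial j (\<lambda>z. h z $ i $ l) y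
        - partial l (\<lambda>z. h z $ i $ j) y)"

lemma christoffel_eq:
  assumes "y \<in> S"
  shows "christoffel h 1 i j y = (h y $ 2 $ 2 * first_kind 1 i j y - h y $ 1 $ 2 * first_kind 2 i j y) / det (h y)"
    "christoffel h 2 i j y = (h y $ 1 $ 1 * first_kind 2 i j y - h y $ 1 $ 2 * first_kind 1 i j y) / det (h y)"
proof -
  have D: "det (h y) \<noteq> 0" using det_pos[OF assms] by simp
  have "1 / 2 * (a * X + b * Y) = a * (1 / 2 * X) + b * (1 / 2 * Y)" for a b X Y :: real by simp
  then have *: "christoffel h k i j y = matrix_inv (h y) $ k $ 1 * first_kind 1 i j y
      + matrix_inv (h y) $ k $ 2 * first_kind 2 i j y" for k
    unfolding christoffel_def first_kind_def sum_2 .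
  have **: "a / d * x + - b / d * y = (a * x - b * y) / d" "- b / d * y + a / d * x = (a * x - b * y) / d"
    for a b d x y :: real
    by (simp_all add: diff_divide_distrib)
  show "christoffel h 1 i j y = (h y $ 2 $ 2 * first_kind 1 i j y - h y $ 1 $ 2 * first_kind 2 i j y) / det (h y)"
    "christoffel h 2 i j y = (h y $ 1 $ 1 * first_kind 2 i j y - h y $ 1 $ 2 * first_kind 1 i j y) / det (h y)"
    by (simp_all only: *[of 1] *[of 2] matrix_inv_2[OF D] h21[OF assms] **)
qed

lemma smooth_first_kind [smooth]: "smooth_on (first_kind l i j) S"
  unfolding first_kind_def[abs_def] by (intro smooth open_S smooth_h)

lemma smooth_christoffel [smooth]: "smooth_on (christoffel h k i j) S"
proof -
  have "smooth_on (christoffel h 1 i j) S"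
  proof (rule smooth_on_cong[OF open_S])
    show "smooth_on (\<lambda>y. (h y $ 2 $ 2 * first_kind 1 i j y - h y $ 1 $ 2 * first_kind 2 i j y) / det (h y)) S"
      by (intro smooth open_S smooth_h) (auto dest: det_pos)
  qed (simp add: christoffel_eq)
  moreover have "smooth_on (christoffel h 2 i j) S"
  proof (rule smooth_on_cong[OF open_S])
    show "smooth_on (\<lambda>y. (h y $ 1 $ 1 * first_kind 2 i j y - h y $ 1 $ 2 * first_kind 1 i j y) / det (h y)) S"
      by (intro smooth open_S smooth_h) (auto dest: det_pos)
  qed (simp add: christoffel_eq)
  ultimately show ?thesis using exhaust_2[of k] by auto
qed

lemma lower_christoffel:
  assumes "y \<in> S"
  shows "h y $ 1 $ 1 * christoffel h 1 i j y + h y $ 1 $ 2 * christoffel h 2 i j y = first_kind 1 i j y"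
proof -
  have D: "det (h y) \<noteq> 0" using det_pos[OF assms] by simp
  have "h y $ 1 $ 1 * christoffel h 1 i j y + h y $ 1 $ 2 * christoffel h 2 i j y
     = first_kind 1 i j y * det (h y) / det (h y)"
    unfolding christoffel_eq[OF assms] by (simp add: det_h[OF assms] algebra_simps add_divide_distrib diff_divide_distrib)
  then show ?thesis using D by simp
qed

text \<open>Lowering the index before differentiating avoids derivatives of the inverse metric.\<close>

lemma local_curvature_jet:
  assumes E: "has_jet S (\<lambda>z. h z $ 1 $ 1) y e e1 e2 e11 e12 e22"
    and F: "has_jet S (\<lambda>z. h z $ 1 $ 2) y f f1 f2 f11 f12 f22"
    and G: "has_jet S (\<lambda>z. h z $ 2 $ 2) y g g1 g2 g11 g12 g22"
  shows "local_curvature h y = brioschi e e1 e2 e22 f f1 f2 f12 g g1 g2 g11"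
proof -
  have y: "y \<in> S" using E by (auto simp: has_jet_def)
  note d = smooth_on_differentiable[OF _ y]
  let ?c = "christoffel h" and ?D = "e * g - f * f"
  have D: "det (h y) = ?D" "?D \<noteq> 0" using det_h[OF y] det_pos[OF y] assms by (simp_all add: has_jet_def)
  have p21: "partial i (\<lambda>z. h z $ 2 $ 1) z = partial i (\<lambda>z. h z $ 1 $ 2) z" if "z \<in> S" for i z
    by (rule partial_cong[OF open_S that]) (rule h21)
  have fk: "first_kind 1 1 1 z = partial 1 (\<lambda>z. h z $ 1 $ 1) z / 2"
    "first_kind 2 1 1 z = partial 1 (\<lambda>z. h z $ 1 $ 2) z - partial 2 (\<lambda>z. h z $ 1 $ 1) z / 2"
    "first_kind 1 1 2 z = partial 2 (\<lambda>z. h z $ 1 $ 1) z / 2"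
    "first_kind 2 1 2 z = partial 1 (\<lambda>z. h z $ 2 $ 2) z / 2"
    "first_kind 1 2 1 z = partial 2 (\<lambda>z. h z $ 1 $ 1) z / 2"
    "first_kind 2 2 1 z = partial 1 (\<lambda>z. h z $ 2 $ 2) z / 2"
    "first_kind 1 2 2 z = partial 2 (\<lambda>z. h z $ 1 $ 2) z - partial 1 (\<lambda>z. h z $ 2 $ 2) z / 2"
    "first_kind 2 2 2 z = partial 2 (\<lambda>z. h z $ 2 $ 2) z / 2" if "z \<in> S" for z
    using that by (simp_all add: first_kind_def p21 diff_divide_distrib)
  have dfk: "partial 1 (first_kind 1 2 2) y = f12 - g11/2" "partial 2 (first_kind 1 1 2) y = e22/2"
    using assms
    by (simp_all add: partial_cong[OF open_S y fk(3)] partial_cong[OF open_S y fk(7)] partial_diff partial_cdivide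
        d smooth_h_nth smooth_on_partial has_jet_def)
  have low: "e * partial k (?c 1 i j) y + f * partial k (?c 2 i j) y = partial k (first_kind 1 i j) y
      - partial k (\<lambda>z. h z $ 1 $ 1) y * ?c 1 i j y - partial k (\<lambda>z. h z $ 1 $ 2) y * ?c 2 i j y" for i j k
  proof -
    have "partial k (first_kind 1 i j) y = partial k (\<lambda>z. h z $ 1 $ 1 * ?c 1 i j z + h z $ 1 $ 2 * ?c 2 i j z) y"
      by (rule partial_cong[OF open_S y]) (rule lower_christoffel[symmetric])
    also have "\<dots> = partial k (\<lambda>z. h z $ 1 $ 1) y * ?c 1 i j y + e * partial k (?c 1 i j) y
       + (partial k (\<lambda>z. h z $ 1 $ 2) y * ?c 2 i j y + f * partial k (?c 2 i j) y)"
      using assms by (simp add: partial_add partial_mult d smooth_h_nth smooth_christoffel has_jet_def)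
    finally show ?thesis by simp
  qed
  note ce = christoffel_eq[OF y] and fy = fk[OF y]
  have low0: "e * ?c 1 i j y + f * ?c 2 i j y = first_kind 1 i j y" for i j
    using lower_christoffel[OF y, of i j] assms by (simp add: has_jet_def)
  \<comment> \<open>The sum over \<open>l\<close> lowers the upper index. Collecting the quadratic
    terms by their second factor lowers the first factors too, so that \<open>low\<close> and
    \<open>low0\<close> apply to every bracket.\<close>
  have "(\<Sum>l\<in>UNIV. h y $ 1 $ l * riemann h l 2 1 2 y)
    = (e * partial 1 (?c 1 2 2) y + f * partial 1 (?c 2 2 2) y)
      - (e * partial 2 (?c 1 1 2) y + f * partial 2 (?c 2 1 2) y)
      + (e * ?c 1 1 1 y + f * ?c 2 1 1 y) * ?c 1 2 2 y + (e * ?c 1 1 2 y + f * ?c 2 1 2 y) * ?c 2 2 2 y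
      - (e * ?c 1 2 1 y + f * ?c 2 2 1 y) * ?c 1 1 2 y - (e * ?c 1 2 2 y + f * ?c 2 2 2 y) * ?c 2 1 2 y"
    using E F by (simp add: sum_2 riemann_def has_jet_def algebra_simps)
  also have "\<dots> = f12 - e22/2 - g11/2
     + (first_kind 1 1 1 y - e1) * ?c 1 2 2 y + (first_kind 1 1 2 y - f1) * ?c 2 2 2 y
     - (first_kind 1 2 1 y - e2) * ?c 1 1 2 y - (first_kind 1 2 2 y - f2) * ?c 2 1 2 y"
    unfolding low low0 dfk using E F by (simp add: has_jet_def algebra_simps)
  also have "\<dots> = f12 - e22/2 - g11/2
     + (- (e1/2) * (g * (f2 - g1/2) - f * (g2/2)) + (e2/2 - f1) * (e * (g2/2) - f * (f2 - g1/2))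
     + (e2/2) * (g * (e2/2) - f * (g1/2)) + (g1/2) * (e * (g1/2) - f * (e2/2))) / ?D"
    using assms by (simp add: ce fy D has_jet_def add_divide_distrib diff_divide_distrib algebra_simps)
  finally have "local_curvature h y = (f12 - e22/2 - g11/2
     + (- (e1/2) * (g * (f2 - g1/2) - f * (g2/2)) + (e2/2 - f1) * (e * (g2/2) - f * (f2 - g1/2))
     + (e2/2) * (g * (e2/2) - f * (g1/2)) + (g1/2) * (e * (g1/2) - f * (e2/2))) / ?D) / ?D"
    by (simp add: local_curvature_def D)
  also have "\<dots> = ((f12 - e22/2 - g11/2) * ?D + (- (e1/2) * (g * (f2 - g1/2) - f * (g2/2))
     + (e2/2 - f1) * (e * (g2/2) - f * (f2 - g1/2))
     + (e2/2) * (g * (e2/2) - f * (g1/2)) + (g1/2) * (e * (g1/2) - f * (e2/2)))) / ?D\<^sup>2"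
  proof -
    have "(a + b / d) / d = (a * d + b) / d\<^sup>2" if "d \<noteq> 0" for a b d :: real
      using that by (simp add: power2_eq_square add_divide_distrib)
    from this[OF D(2)] show ?thesis .
  qed
  also have "- (e1/2) * (g * (f2 - g1/2) - f * (g2/2)) + (e2/2 - f1) * (e * (g2/2) - f * (f2 - g1/2))
     + (e2/2) * (g * (e2/2) - f * (g1/2)) + (g1/2) * (e * (g1/2) - f * (e2/2))
     = - (adj_form e f g (f2 - g1/2) (g2/2) (e1/2) (f1 - e2/2)
         - adj_form e f g (e2/2) (g1/2) (e2/2) (g1/2))"
    by (simp add: adj_form_def field_simps)
  finally show ?thesis unfolding brioschi_def add_uminus_conv_diff .
qed

lemma jets:
  assumes "y \<in> S"
  obtains e e1 e2 e11 e12 e22 f f1 f2 f11 f12 f22 g g1 g2 g11 g12 g22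
  where "has_jet S (\<lambda>z. h z $ 1 $ 1) y e e1 e2 e11 e12 e22"
    and "has_jet S (\<lambda>z. h z $ 1 $ 2) y f f1 f2 f11 f12 f22"
    and "has_jet S (\<lambda>z. h z $ 2 $ 2) y g g1 g2 g11 g12 g22"
    and "e * g - f * f > 0"
proof -
  have "h y $ 1 $ 1 * h y $ 2 $ 2 - h y $ 1 $ 2 * h y $ 1 $ 2 > 0"
    using det_h[OF assms] det_pos[OF assms] by simp
  then show ?thesis using that has_jet_self[OF open_S smooth_h_nth assms] by blast
qed

lemma smooth_local_curvature [smooth]: "smooth_on (local_curvature h) S"
  unfolding local_curvature_def[abs_def] riemann_def
  by (intro smooth open_S smooth_h) (auto dest: det_pos)

lemma plane_metric_conformal:
  assumes "smooth_on u S" shows "plane_metric (\<lambda>y. exp (2 * u y) *\<^sub>R h y) S"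
proof
  show "smooth_on (\<lambda>y. exp (2 * u y) *\<^sub>R h y) S" by (intro smooth open_S smooth_h assms)
qed (auto simp: transpose_scalar sym pos scaleR_matrix_vector_assoc[symmetric])

text \<open>The product rule gives the jets of the scaled components exactly in the shape in which
  \<open>brioschi_conformal\<close> lists its arguments.\<close>

lemma local_curvature_conformal:
  assumes u: "smooth_on u S" and y: "y \<in> S"
  shows "local_curvature (\<lambda>y. exp (2 * u y) *\<^sub>R h y) y
     = exp (- 2 * u y) * (local_curvature h y - local_laplacian h u y)"
proof -
  interpret C: plane_metric "\<lambda>y. exp (2 * u y) *\<^sub>R h y" S by (rule plane_metric_conformal[OF u])
  obtain e e1 e2 e11 e12 e22 f f1 f2 f11 f12 f22 g g1 g2 g11 g12 g22
    where E: "has_jet S (\<lambda>z. h z $ 1 $ 1) y e e1 e2 e11 e12 e22"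
    and F: "has_jet S (\<lambda>z. h z $ 1 $ 2) y f f1 f2 f11 f12 f22"
    and G: "has_jet S (\<lambda>z. h z $ 2 $ 2) y g g1 g2 g11 g12 g22"
    and D: "e * g - f * f > 0" using jets[OF y] .
  obtain u1 u2 u11 u12 u22 where U: "has_jet S u y (u y) u1 u2 u11 u12 u22"
    using has_jet_self[OF open_S u y] by blast
  note X = has_jet_exp[OF U]
  note L = C.local_curvature_jet[unfolded vector_scaleR_component real_scaleR_def,
      OF has_jet_mult[OF X E] has_jet_mult[OF X F] has_jet_mult[OF X G]]
  have "exp (2 * u y) * local_curvature (\<lambda>y. exp (2 * u y) *\<^sub>R h y) y = local_curvature h y - local_laplacian h u y"
    unfolding L brioschi_conformal[OF exp_gt_zero D] local_curvature_jet[OF E F G] local_laplacian_jet[OF E F G U] ..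
  then have "exp (- 2 * u y) * (exp (2 * u y) * local_curvature (\<lambda>y. exp (2 * u y) *\<^sub>R h y) y)
     = exp (- 2 * u y) * (local_curvature h y - local_laplacian h u y)" by simp
  then show ?thesis by (simp add: mult.assoc[symmetric] exp_add[symmetric])
qed

end

section \<open>Invariance of the curvature under coordinate changes\<close>

definition chain2 :: "real \<Rightarrow> _" where
  "chain2 x1 x2 x11 x12 x22 p q p' q' pp qq =
     x11 * p * p' + x12 * (p * q' + p' * q) + x22 * q * q' + x1 * pp + x2 * qq"

text \<open>The second derivative, in the directions k and l, of a product \<open>x * p * q\<close>.
  Likewise \<open>chain2\<close> is the second derivative of a composite: \<open>p, q\<close> and
  \<open>p', q'\<close> are the derivatives of the two inner components in the two directions,
  \<open>pp\<close> and \<open>qq\<close> their mixed second derivatives.\<close>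

definition leibniz2 :: "real \<Rightarrow> _" where
  "leibniz2 x xk xl xkl p pk pl pkl q qk ql qkl =
     xkl * p * q + xk * (pl * q + p * ql) + xl * (pk * q + p * qk)
     + x * (pkl * q + pk * ql + pl * qk + p * qkl)"

text \<open>Here \<open>e, f, g\<close> stand for the components of a metric, \<open>p, q\<close> for those of a coordinate change
  and \<open>a, b, c\<close> for the pulled-back metric; indices denote partial derivatives. Twice the Christoffel
  symbols of the first kind transform by the inhomogeneous law \<open>k\<close>; after it is inserted, \<open>B\<close>
  accounts for the second derivatives of the metric and \<open>adj3\<close> for the quadratic terms.\<close>

lemma brioschi_transform:
  fixes j :: real
  assumes j: "j = p1 * q2 - p2 * q1" "j \<noteq> 0"
    and a: "a = e * p1 * p1 + f * p1 * q1 + f * q1 * p1 + g * q1 * q1"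
    and a1: "a1 = (e1 * p1 + e2 * q1) * p1 * p1 + e * (p11 * p1 + p1 * p11)
      + (f1 * p1 + f2 * q1) * p1 * q1 + f * (p11 * q1 + p1 * q11)
      + (f1 * p1 + f2 * q1) * q1 * p1 + f * (q11 * p1 + q1 * p11)
      + (g1 * p1 + g2 * q1) * q1 * q1 + g * (q11 * q1 + q1 * q11)"
    and a2: "a2 = (e1 * p2 + e2 * q2) * p1 * p1 + e * (p12 * p1 + p1 * p12)
      + (f1 * p2 + f2 * q2) * p1 * q1 + f * (p12 * q1 + p1 * q12)
      + (f1 * p2 + f2 * q2) * q1 * p1 + f * (q12 * p1 + q1 * p12)
      + (g1 * p2 + g2 * q2) * q1 * q1 + g * (q12 * q1 + q1 * q12)"
    and b: "b = e * p1 * p2 + f * p1 * q2 + f * q1 * p2 + g * q1 * q2"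
    and b1: "b1 = (e1 * p1 + e2 * q1) * p1 * p2 + e * (p11 * p2 + p1 * p12)
      + (f1 * p1 + f2 * q1) * p1 * q2 + f * (p11 * q2 + p1 * q12)
      + (f1 * p1 + f2 * q1) * q1 * p2 + f * (q11 * p2 + q1 * p12)
      + (g1 * p1 + g2 * q1) * q1 * q2 + g * (q11 * q2 + q1 * q12)"
    and b2: "b2 = (e1 * p2 + e2 * q2) * p1 * p2 + e * (p12 * p2 + p1 * p22)
      + (f1 * p2 + f2 * q2) * p1 * q2 + f * (p12 * q2 + p1 * q22)
      + (f1 * p2 + f2 * q2) * q1 * p2 + f * (q12 * p2 + q1 * p22)
      + (g1 * p2 + g2 * q2) * q1 * q2 + g * (q12 * q2 + q1 * q22)"
    and c: "c = e * p2 * p2 + f * p2 * q2 + f * q2 * p2 + g * q2 * q2"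
    and c1: "c1 = (e1 * p1 + e2 * q1) * p2 * p2 + e * (p12 * p2 + p2 * p12)
      + (f1 * p1 + f2 * q1) * p2 * q2 + f * (p12 * q2 + p2 * q12)
      + (f1 * p1 + f2 * q1) * q2 * p2 + f * (q12 * p2 + q2 * p12)
      + (g1 * p1 + g2 * q1) * q2 * q2 + g * (q12 * q2 + q2 * q12)"
    and c2: "c2 = (e1 * p2 + e2 * q2) * p2 * p2 + e * (p22 * p2 + p2 * p22)
      + (f1 * p2 + f2 * q2) * p2 * q2 + f * (p22 * q2 + p2 * q22)
      + (f1 * p2 + f2 * q2) * q2 * p2 + f * (q22 * p2 + q2 * p22)
      + (g1 * p2 + g2 * q2) * q2 * q2 + g * (q22 * q2 + q2 * q22)"
    and a22: "a22 = leibniz2 e (e1 * p2 + e2 * q2) (e1 * p2 + e2 * q2) (chain2 e1 e2 e11 e12 e22 p2 q2 p2 q2 p22 q22)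
        p1 p12 p12 p122 p1 p12 p12 p122
      + leibniz2 f (f1 * p2 + f2 * q2) (f1 * p2 + f2 * q2) (chain2 f1 f2 f11 f12 f22 p2 q2 p2 q2 p22 q22)
        p1 p12 p12 p122 q1 q12 q12 q122
      + leibniz2 f (f1 * p2 + f2 * q2) (f1 * p2 + f2 * q2) (chain2 f1 f2 f11 f12 f22 p2 q2 p2 q2 p22 q22)
        q1 q12 q12 q122 p1 p12 p12 p122
      + leibniz2 g (g1 * p2 + g2 * q2) (g1 * p2 + g2 * q2) (chain2 g1 g2 g11 g12 g22 p2 q2 p2 q2 p22 q22)
        q1 q12 q12 q122 q1 q12 q12 q122"
    and b12: "b12 = leibniz2 e (e1 * p1 + e2 * q1) (e1 * p2 + e2 * q2) (chain2 e1 e2 e11 e12 e22 p1 q1 p2 q2 p12 q12)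
        p1 p11 p12 p112 p2 p12 p22 p122
      + leibniz2 f (f1 * p1 + f2 * q1) (f1 * p2 + f2 * q2) (chain2 f1 f2 f11 f12 f22 p1 q1 p2 q2 p12 q12)
        p1 p11 p12 p112 q2 q12 q22 q122
      + leibniz2 f (f1 * p1 + f2 * q1) (f1 * p2 + f2 * q2) (chain2 f1 f2 f11 f12 f22 p1 q1 p2 q2 p12 q12)
        q1 q11 q12 q112 p2 p12 p22 p122
      + leibniz2 g (g1 * p1 + g2 * q1) (g1 * p2 + g2 * q2) (chain2 g1 g2 g11 g12 g22 p1 q1 p2 q2 p12 q12)
        q1 q11 q12 q112 q2 q12 q22 q122"
    and c11: "c11 = leibniz2 e (e1 * p1 + e2 * q1) (e1 * p1 + e2 * q1) (chain2 e1 e2 e11 e12 e22 p1 q1 p1 q1 p11 q11)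
        p2 p12 p12 p112 p2 p12 p12 p112
      + leibniz2 f (f1 * p1 + f2 * q1) (f1 * p1 + f2 * q1) (chain2 f1 f2 f11 f12 f22 p1 q1 p1 q1 p11 q11)
        p2 p12 p12 p112 q2 q12 q12 q112
      + leibniz2 f (f1 * p1 + f2 * q1) (f1 * p1 + f2 * q1) (chain2 f1 f2 f11 f12 f22 p1 q1 p1 q1 p11 q11)
        q2 q12 q12 q112 p2 p12 p12 p112
      + leibniz2 g (g1 * p1 + g2 * q1) (g1 * p1 + g2 * q1) (chain2 g1 g2 g11 g12 g22 p1 q1 p1 q1 p11 q11)
        q2 q12 q12 q112 q2 q12 q12 q112"
  shows "brioschi a a1 a2 a22 b b1 b2 b12 c c1 c2 c11 = brioschi e e1 e2 e22 f f1 f2 f12 g g1 g2 g11"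
proof -
  define G where "G k11 k12 k22 u v u' v' = k11 * u * u' + k12 * (u * v' + u' * v) + k22 * v * v'" for k11 k12 k22 u v u' v' :: real
  \<comment> \<open>\<open>R1\<close> and \<open>R2\<close> apply twice the Christoffel symbols of
    the first kind, with lowered index 1 and 2, to two directions. \<open>X1\<close> and
    \<open>X2\<close> add twice the metric applied to a second derivative of the coordinate
    change.\<close>
  define R1 where "R1 = G e1 e2 (2 * f2 - g1)"
  define R2 where "R2 = G (2 * f1 - e2) g1 g2"
  define X1 where "X1 x y u v u' v' = 2 * (e * x + f * y) + R1 u v u' v'" for x y u v u' v'
  define X2 where "X2 x y u v u' v' = 2 * (f * x + g * y) + R2 u v u' v'" for x y u v u' v'
  note defs = G_def R1_def R2_def X1_def X2_def

  let ?D = "e * g - f * f" and ?D' = "a * c - b * b"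
  let ?adj = "adj_form e f g"
  have D: "?D' = j\<^sup>2 * ?D" unfolding a b c j by algebra
  have k: "a1 = p1 * X1 p11 q11 p1 q1 p1 q1 + q1 * X2 p11 q11 p1 q1 p1 q1"
    "2 * b1 - a2 = p2 * X1 p11 q11 p1 q1 p1 q1 + q2 * X2 p11 q11 p1 q1 p1 q1"
    "a2 = p1 * X1 p12 q12 p1 q1 p2 q2 + q1 * X2 p12 q12 p1 q1 p2 q2"
    "c1 = p2 * X1 p12 q12 p1 q1 p2 q2 + q2 * X2 p12 q12 p1 q1 p2 q2"
    "2 * b2 - c1 = p1 * X1 p22 q22 p2 q2 p2 q2 + q1 * X2 p22 q22 p2 q2 p2 q2"
    "c2 = p2 * X1 p22 q22 p2 q2 p2 q2 + q2 * X2 p22 q22 p2 q2 p2 q2"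
    unfolding a1 a2 b1 b2 c1 c2 defs by algebra+
  have adj: "adj_form a b c (p1 * x + q1 * y) (p2 * x + q2 * y) (p1 * x' + q1 * y') (p2 * x' + q2 * y') = j\<^sup>2 * ?adj x y x' y'" for x y x' y'
    unfolding adj_form_def a b c j by algebra
  have adj2: "?adj (2 * (e * x + f * y) + r) (2 * (f * x + g * y) + r') (2 * (e * z + f * w) + s) (2 * (f * z + g * w) + s')
    = ?D * (4 * (e * x * z + f * (x * w + y * z) + g * y * w) + 2 * (x * s + y * s') + 2 * (z * r + w * r')) + ?adj r r' s s'" for x y z w r r' s s'
    unfolding adj_form_def by algebra
  have adj3: "?adj (R1 p2 q2 p2 q2) (R2 p2 q2 p2 q2) (R1 p1 q1 p1 q1) (R2 p1 q1 p1 q1)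
     - ?adj (R1 p1 q1 p2 q2) (R2 p1 q1 p2 q2) (R1 p1 q1 p2 q2) (R2 p1 q1 p2 q2)
     = j\<^sup>2 * (?adj (2 * f2 - g1) g2 e1 (2 * f1 - e2) - ?adj e2 g1 e2 g1)"
    unfolding adj_form_def defs j by algebra
  have B: "4 * b12 - 2 * a22 - 2 * c11 = (4 * (e * p22 * p11 + f * (p22 * q11 + q22 * p11) + g * q22 * q11)
       + 2 * (p22 * R1 p1 q1 p1 q1 + q22 * R2 p1 q1 p1 q1) + 2 * (p11 * R1 p2 q2 p2 q2 + q11 * R2 p2 q2 p2 q2))
     - (4 * (e * p12 * p12 + f * (p12 * q12 + q12 * p12) + g * q12 * q12)
       + 2 * (p12 * R1 p1 q1 p2 q2 + q12 * R2 p1 q1 p2 q2) + 2 * (p12 * R1 p1 q1 p2 q2 + q12 * R2 p1 q1 p2 q2))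
     + j\<^sup>2 * (4 * f12 - 2 * e22 - 2 * g11)"
    unfolding a22 b12 c11 j defs chain2_def leibniz2_def by algebra
  \<comment> \<open>Third derivatives of the coordinate change are already gone in \<open>B\<close>.
    Its second derivatives occur on one side with the factor \<open>?D'\<close> and on the other,
    through \<open>adj2\<close>, with the factor \<open>j\<^sup>2 * ?D\<close>; by \<open>D\<close>
    these agree and cancel, leaving the common factor \<open>j^4\<close>.\<close>
  have num: "(4 * b12 - 2 * a22 - 2 * c11) * ?D' - (adj_form a b c (2 * b2 - c1) c2 a1 (2 * b1 - a2) - adj_form a b c a2 c1 a2 c1)
    = j^4 * ((4 * f12 - 2 * e22 - 2 * g11) * ?D - (?adj (2 * f2 - g1) g2 e1 (2 * f1 - e2) - ?adj e2 g1 e2 g1))"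
    unfolding D k(2,5) unfolding k(1,3,4,6) adj unfolding B X1_def X2_def adj2 using adj3 by algebra
  have b4: "brioschi e e1 e2 e22 f f1 f2 f12 g g1 g2 g11 = ((4 * f12 - 2 * e22 - 2 * g11) * (e * g - f * f)
     - (adj_form e f g (2 * f2 - g1) g2 e1 (2 * f1 - e2) - adj_form e f g e2 g1 e2 g1)) / 4 / (e * g - f * f)\<^sup>2"
    for e e1 e2 e22 f f1 f2 f12 g g1 g2 g11
    unfolding brioschi_def by (rule arg_cong2[of _ _ _ _ "(/)"]) (simp_all add: adj_form_def field_simps)
  have "j^4 * n / 4 / (j\<^sup>2 * d)\<^sup>2 = n / 4 / d\<^sup>2" for n d
    using j(2) by (simp add: power_mult_distrib)
  then show ?thesis unfolding b4 num unfolding D .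
qed

lemma has_jet_cong:
  assumes "has_jet S u y u0 u1 u2 u11 u12 u22" "\<And>z. z \<in> S \<Longrightarrow> u z = v z"
  shows "has_jet S v y u0 u1 u2 u11 u12 u22"
proof -
  have S: "open S" "y \<in> S" using assms by (auto simp: has_jet_def)
  have "smooth_on v S" using assms smooth_on_cong[OF S(1) assms(2)] by (simp add: has_jet_def)
  moreover have 1: "partial i v z = partial i u z" if "z \<in> S" for i z
    using assms(2) by (intro partial_cong[OF S(1) that]) auto
  have "partial i (partial j v) y = partial i (partial j u) y" for i j
    using 1 by (intro partial_cong[OF S]) auto
  ultimately show ?thesis using assms(1) 1[OF S(2)] assms(2)[OF S(2)] by (simp add: has_jet_def)
qed

text \<open>A pulled-back metric contains first derivatives of the coordinate change, so its two-jet
  reaches third derivatives. Sharing names between the jets of the two first partials records the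
  symmetry in all three indices.\<close>

lemma third_jets:
  assumes "open S" "smooth_on u S" "y \<in> S"
  obtains u0 u1 u2 u11 u12 u22 u111 u112 u122 u222
  where "has_jet S u y u0 u1 u2 u11 u12 u22"
    and "has_jet S (partial 1 u) y u1 u11 u12 u111 u112 u122"
    and "has_jet S (partial 2 u) y u2 u12 u22 u112 u122 u222"
proof
  note p = smooth_on_partial[OF assms(2)]
  have c: "partial 1 (partial 2 u) z = partial 2 (partial 1 u) z" if "z \<in> S" for z
    using assms that by (simp add: partial_commute)
  have c2: "partial i (partial 1 (partial 2 u)) y = partial i (partial 2 (partial 1 u)) y" for i
    by (rule partial_cong[OF assms(1,3) c])
  show "has_jet S u y (u y) (partial 1 u y) (partial 2 u y)
    (partial 1 (partial 1 u) y) (partial 2 (partial 1 u) y) (partial 2 (partial 2 u) y)"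
    by (rule has_jet_self[OF assms])
  show "has_jet S (partial 1 u) y (partial 1 u y) (partial 1 (partial 1 u) y) (partial 2 (partial 1 u) y)
    (partial 1 (partial 1 (partial 1 u)) y) (partial 2 (partial 1 (partial 1 u)) y) (partial 2 (partial 2 (partial 1 u)) y)"
    by (rule has_jet_self[OF assms(1) p assms(3)])
  show "has_jet S (partial 2 u) y (partial 2 u y) (partial 2 (partial 1 u) y) (partial 2 (partial 2 u) y)
    (partial 2 (partial 1 (partial 1 u)) y) (partial 2 (partial 2 (partial 1 u)) y) (partial 2 (partial 2 (partial 2 u)) y)"
    using has_jet_self[OF assms(1) p assms(3), of 2] c[OF assms(3)] c2
      partial_commute[OF assms(1) smooth_on_partial[OF assms(2)] assms(3), of 1 2 1]
    by simp
qed

lemma jacobian_nth: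
  assumes "f differentiable (at z)"
  shows "jacobian f (at z) $ a $ i = partial i (\<lambda>z. f z $ a) z"
proof -
  have "jacobian f (at z) $ a $ i = dir_deriv (axis i 1) f z $ a"
    by (simp add: jacobian_def matrix_def dir_deriv_def)
  then show ?thesis
    by (simp add: partial_dir_deriv dir_deriv_linear_compose[OF bounded_linear_vec_nth assms])
qed

locale metric_transition = source: plane_metric g S + target: plane_metric h T
  for g S h T +
  fixes f :: "real^2 \<Rightarrow> real^2"
  assumes smooth_f: "smooth_on f S" and maps: "f ` S \<subseteq> T"
    and pullback: "y \<in> S \<Longrightarrow> g y = transpose (jacobian f (at y)) ** h (f y) ** jacobian f (at y)"
begin

lemma f_in: "y \<in> S \<Longrightarrow> f y \<in> T"
  using maps by auto

lemma f_differentiable: "y \<in> S \<Longrightarrow> f differentiable (at y)"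
  using smooth_f smooth_on_differentiable by blast

text \<open>The bracketing is the one in which \<open>has_jet_add\<close> and
  \<open>has_jet_mult\<close> assemble the jet of this expression for the invariance of the
  curvature.\<close>

lemma pullback_nth:
  assumes "y \<in> S"
  shows "g y $ i $ j =
    h (f y) $ 1 $ 1 * (partial i (\<lambda>z. f z $ 1) y * partial j (\<lambda>z. f z $ 1) y) +
    (h (f y) $ 1 $ 2 * (partial i (\<lambda>z. f z $ 1) y * partial j (\<lambda>z. f z $ 2) y) +
    (h (f y) $ 1 $ 2 * (partial i (\<lambda>z. f z $ 2) y * partial j (\<lambda>z. f z $ 1) y) +
     h (f y) $ 2 $ 2 * (partial i (\<lambda>z. f z $ 2) y * partial j (\<lambda>z. f z $ 2) y)))"
  by (simp add: pullback[OF assms] matrix_matrix_mult_def sum_2 transpose_def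
      jacobian_nth[OF f_differentiable[OF assms]] target.h21[OF f_in[OF assms]] algebra_simps)

lemma det_pullback: "y \<in> S \<Longrightarrow> det (g y) = (det (jacobian f (at y)))\<^sup>2 * det (h (f y))"
  by (simp add: pullback det_mul power2_eq_square)

lemma det_jacobian: "y \<in> S \<Longrightarrow> det (jacobian f (at y)) \<noteq> 0"
  using det_pullback[of y] source.det_pos[of y] by auto

lemma det_jacobian_eq: "y \<in> S \<Longrightarrow> det (jacobian f (at y)) =
    partial 1 (\<lambda>z. f z $ 1) y * partial 2 (\<lambda>z. f z $ 2) y
    - partial 2 (\<lambda>z. f z $ 1) y * partial 1 (\<lambda>z. f z $ 2) y"
  by (simp add: det_2 jacobian_nth f_differentiable)

text \<open>The jets of the pulled-back components are assembled from those of \<open>h\<close>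
  along \<open>f\<close> and of the first partials of \<open>f\<close>. Both curvatures are Brioschi
  expressions in these jets, which reduces the claim to \<open>brioschi_transform\<close>.\<close>

lemma local_curvature_invariant:
  assumes y: "y \<in> S"
  shows "local_curvature g y = local_curvature h (f y)"
proof -
  have "smooth_on (\<lambda>z. f z $ i) S" for i by (intro smooth smooth_f source.open_S)
  note th = third_jets[OF source.open_S this y]
  obtain p0 p1 p2 p11 p12 p22 p111 p112 p122 p222
    where p: "has_jet S (\<lambda>z. f z $ 1) y p0 p1 p2 p11 p12 p22"
      "has_jet S (partial 1 (\<lambda>z. f z $ 1)) y p1 p11 p12 p111 p112 p122"
      "has_jet S (partial 2 (\<lambda>z. f z $ 1)) y p2 p12 p22 p112 p122 p222" by (rule th)
  obtain q0 q1 q2 q11 q12 q22 q111 q112 q122 q222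
    where q: "has_jet S (\<lambda>z. f z $ 2) y q0 q1 q2 q11 q12 q22"
      "has_jet S (partial 1 (\<lambda>z. f z $ 2)) y q1 q11 q12 q111 q112 q122"
      "has_jet S (partial 2 (\<lambda>z. f z $ 2)) y q2 q12 q22 q112 q122 q222" by (rule th)
  obtain e e1 e2 e11 e12 e22 k k1 k2 k11 k12 k22 l l1 l2 l11 l12 l22
    where E: "has_jet T (\<lambda>z. h z $ 1 $ 1) (f y) e e1 e2 e11 e12 e22"
    and F: "has_jet T (\<lambda>z. h z $ 1 $ 2) (f y) k k1 k2 k11 k12 k22"
    and G: "has_jet T (\<lambda>z. h z $ 2 $ 2) (f y) l l1 l2 l11 l12 l22"
    using target.jets[OF f_in[OF y]] by metis
  have j: "p1 * q2 - p2 * q1 \<noteq> 0"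
    using det_jacobian[OF y] det_jacobian_eq[OF y] p(1) q(1) by (simp add: has_jet_def)
  note C = has_jet_compose[OF smooth_f maps p(1) q(1)]
  note J = has_jet_add[OF has_jet_mult[OF C[OF E] has_jet_mult]
      has_jet_add[OF has_jet_mult[OF C[OF F] has_jet_mult]
      has_jet_add[OF has_jet_mult[OF C[OF F] has_jet_mult] has_jet_mult[OF C[OF G] has_jet_mult]]]]
  note J11 = has_jet_cong[OF J[OF p(2) p(2) p(2) q(2) q(2) p(2) q(2) q(2)], of "\<lambda>z. g z $ 1 $ 1",
      OF pullback_nth[symmetric]]
  note J12 = has_jet_cong[OF J[OF p(2) p(3) p(2) q(3) q(2) p(3) q(2) q(3)], of "\<lambda>z. g z $ 1 $ 2",
      OF pullback_nth[symmetric]]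
  note J22 = has_jet_cong[OF J[OF p(3) p(3) p(3) q(3) q(3) p(3) q(3) q(3)], of "\<lambda>z. g z $ 2 $ 2",
      OF pullback_nth[symmetric]]
  show ?thesis
    unfolding target.local_curvature_jet[OF E F G]
    by (rule trans[OF source.local_curvature_jet[OF J11 J12 J22]], assumption+,
        rule brioschi_transform[where ?p11.0 = p11 and ?p12.0 = p12 and ?p22.0 = p22 and ?p112.0 = p112 and ?p122.0 = p122 and ?q11.0 = q11 and ?q12.0 = q12 and ?q22.0 = q22
          and ?q112.0 = q112 and ?q122.0 = q122 and ?e11.0 = e11 and ?e12.0 = e12 and ?f11.0 = k11 and ?f22.0 = k22 and ?g12.0 = l12 and ?g22.0 = l22, OF refl j])
      (unfold chain2_def leibniz2_def, algebra+)
qed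

lemma partial_pullback:
  assumes y: "y \<in> S" and "a differentiable (at (f y))" and "\<And>z. z \<in> S \<Longrightarrow> a' z = a (f z)"
  shows "partial i a' y = partial 1 a (f y) * partial i (\<lambda>z. f z $ 1) y + partial 2 a (f y) * partial i (\<lambda>z. f z $ 2) y"
  by (rule trans[OF partial_cong[OF source.open_S y assms(3)] partial_compose[OF f_differentiable[OF y] assms(2)]])

text \<open>Numerator and determinant each acquire the square of the Jacobian determinant.\<close>

lemma local_inner_invariant:
  assumes y: "y \<in> S" and a: "a differentiable (at (f y))" "\<And>z. z \<in> S \<Longrightarrow> a' z = a (f z)"
    and b: "b differentiable (at (f y))" "\<And>z. z \<in> S \<Longrightarrow> b' z = b (f z)"
  shows "local_inner g a' b' y = local_inner h a b (f y)"
proof -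
  define j where "j = det (jacobian f (at y))"
  define e where "e = h (f y) $ 1 $ 1"
  define k where "k = h (f y) $ 1 $ 2"
  define l where "l = h (f y) $ 2 $ 2"
  define p where "p i = partial i (\<lambda>z. f z $ 1) y" for i
  define q where "q i = partial i (\<lambda>z. f z $ 2) y" for i
  define a1 a2 b1 b2 where "a1 = partial 1 a (f y)" "a2 = partial 2 a (f y)" "b1 = partial 1 b (f y)" "b2 = partial 2 b (f y)"
  note defs = e_def[symmetric] k_def[symmetric] l_def[symmetric] p_def[symmetric] q_def[symmetric]
    a1_a2_b1_b2_def[symmetric] j_def[symmetric]
  have jj: "j = p 1 * q 2 - p 2 * q 1" "j \<noteq> 0"
    using det_jacobian_eq[OF y] det_jacobian[OF y] unfolding defs by auto
  have num: "(e * (p 2 * p 2) + (k * (p 2 * q 2) + (k * (q 2 * p 2) + l * (q 2 * q 2)))) * (a1 * p 1 + a2 * q 1) * (b1 * p 1 + b2 * q 1)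
    - (e * (p 1 * p 2) + (k * (p 1 * q 2) + (k * (q 1 * p 2) + l * (q 1 * q 2)))) * ((a1 * p 1 + a2 * q 1) * (b1 * p 2 + b2 * q 2) + (a1 * p 2 + a2 * q 2) * (b1 * p 1 + b2 * q 1))
    + (e * (p 1 * p 1) + (k * (p 1 * q 1) + (k * (q 1 * p 1) + l * (q 1 * q 1)))) * (a1 * p 2 + a2 * q 2) * (b1 * p 2 + b2 * q 2)
    = j\<^sup>2 * (l * a1 * b1 - k * (a1 * b2 + a2 * b1) + e * a2 * b2)"
    unfolding jj by algebra
  have pa: "partial i a' y = a1 * p i + a2 * q i" and pb: "partial i b' y = b1 * p i + b2 * q i" for i
    using partial_pullback[OF y a(1), of a' i] partial_pullback[OF y b(1), of b' i] a(2) b(2) unfolding defs by auto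
  show ?thesis
    unfolding local_inner_def pullback_nth[OF y] det_pullback[OF y] pa pb defs num
    using jj(2) by simp
qed

end

section \<open>Surfaces in charts\<close>

locale surface =
  fixes A :: "('a::t2_space) chart set"
  assumes closed_surface: "closed_surface A"
begin

lemma chart_facts:
  assumes "c \<in> A"
  shows open_domain: "open (fst c)" and open_image: "open (chart_image c)"
    and homeo: "homeomorphism (fst c) (chart_image c) (snd c) (chart_inv c)"
    and inv_left: "p \<in> fst c \<Longrightarrow> chart_inv c (snd c p) = p"
    and inv_right: "y \<in> chart_image c \<Longrightarrow> snd c (chart_inv c y) = y"
    and inv_in: "y \<in> chart_image c \<Longrightarrow> chart_inv c y \<in> fst c"
  using assms closed_surface unfolding closed_surface_def homeomorphism_def by (auto simp: inv_into_into f_inv_into_f)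

lemma in_chart_image: "p \<in> fst c \<Longrightarrow> snd c p \<in> chart_image c"
  by simp

lemma chart_at: "chart_at A p \<in> A" "p \<in> fst (chart_at A p)"
proof -
  have "\<exists>c. c \<in> A \<and> p \<in> fst c" using closed_surface unfolding closed_surface_def by blast
  from someI_ex[OF this] show "chart_at A p \<in> A" "p \<in> fst (chart_at A p)" by (auto simp: chart_at_def)
qed

lemma compact_surface: "compact (UNIV :: 'a set)"
  using closed_surface by (simp add: closed_surface_def)

definition overlap :: "'a chart \<Rightarrow> 'a chart \<Rightarrow> (real^2) set" where
  "overlap c d = snd c ` (fst c \<inter> fst d)"

lemma open_overlap: assumes "c \<in> A" "d \<in> A" shows "open (overlap c d)"
proof -
  have "openin (top_of_set (fst c)) (fst c \<inter> fst d)"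
    using open_domain[OF assms(2)] by (rule openin_open_Int)
  from homeomorphism_imp_open_map[OF homeo[OF assms(1)] this] show ?thesis
    unfolding overlap_def by (rule openin_open_trans[OF _ open_image[OF assms(1)]])
qed

lemma transition_smooth: "c \<in> A \<Longrightarrow> d \<in> A \<Longrightarrow> smooth_on (snd d \<circ> chart_inv c) (overlap c d)"
  using closed_surface by (simp add: closed_surface_def overlap_def)

lemma transition_apply:
  assumes "c \<in> A" "d \<in> A" "y \<in> overlap c d"
  shows "(snd d \<circ> chart_inv c) y \<in> overlap d c" "chart_inv d ((snd d \<circ> chart_inv c) y) = chart_inv c y"
    "y \<in> chart_image c" "chart_inv c y \<in> fst c" "chart_inv c y \<in> fst d"
  using assms inv_left unfolding overlap_def by (auto simp: image_iff)

lemma overlap_image: "overlap c d \<subseteq> chart_image c"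
  by (auto simp: overlap_def)

lemma smoothD: "f \<in> smooth_functions A \<Longrightarrow> c \<in> A \<Longrightarrow> smooth_on (f \<circ> chart_inv c) (chart_image c)"
  by (simp add: smooth_functions_def)

text \<open>Serves for curvature, gradient product and Laplacian, each of which is given at every
  point by one coordinate formula in all charts.\<close>

lemma smooth_functionsI:
  assumes "\<And>c. c \<in> A \<Longrightarrow> smooth_on (F c) (chart_image c)"
    and "\<And>c p. c \<in> A \<Longrightarrow> p \<in> fst c \<Longrightarrow> f p = F c (snd c p)"
  shows "f \<in> smooth_functions A"
  unfolding smooth_functions_def
proof (safe)
  fix c assume c: "c \<in> A"
  show "smooth_on (f \<circ> chart_inv c) (chart_image c)"
    by (rule smooth_on_cong[OF open_image[OF c] _ assms(1)[OF c]])
      (simp add: assms(2)[OF c inv_in[OF c]] inv_right[OF c])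
qed

lemma sm_const: "(\<lambda>p. k) \<in> smooth_functions A"
  by (auto simp: smooth_functions_def o_def smooth_on_const)

lemma sm_add: "f \<in> smooth_functions A \<Longrightarrow> h \<in> smooth_functions A \<Longrightarrow> (\<lambda>p. f p + h p) \<in> smooth_functions A"
  by (auto simp: smooth_functions_def o_def intro!: smooth open_image)

lemma sm_diff: "f \<in> smooth_functions A \<Longrightarrow> h \<in> smooth_functions A \<Longrightarrow> (\<lambda>p. f p - h p) \<in> smooth_functions A"
  by (auto simp: smooth_functions_def o_def intro!: smooth open_image)

lemma sm_mult: "f \<in> smooth_functions A \<Longrightarrow> h \<in> smooth_functions A \<Longrightarrow> (\<lambda>p. f p * h p) \<in> smooth_functions A"
  by (auto simp: smooth_functions_def o_def intro!: smooth open_image)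

lemma sm_divide: "f \<in> smooth_functions A \<Longrightarrow> h \<in> smooth_functions A \<Longrightarrow> (\<And>p. h p \<noteq> 0) \<Longrightarrow>
    (\<lambda>p. f p / h p) \<in> smooth_functions A"
  by (auto simp: smooth_functions_def o_def intro!: smooth open_image)

definition differentiable_at :: "('a \<Rightarrow> real) \<Rightarrow> 'a \<Rightarrow> bool" where
  "differentiable_at f p \<longleftrightarrow> (\<forall>c\<in>A. p \<in> fst c \<longrightarrow> (f \<circ> chart_inv c) differentiable (at (snd c p)))"

lemma sm_differentiable: "f \<in> smooth_functions A \<Longrightarrow> differentiable_at f p"
  unfolding differentiable_at_def using smooth_on_differentiable[OF smoothD] by auto

end

section \<open>Curvature, gradient product and Laplacian on the surface\<close>

locale riemannian_surface = surface A for A :: "('a::t2_space) chart set" +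
  fixes g :: "'a metric_components"
  assumes metric: "riemannian_metric A g"
begin

lemma plane_metric: "c \<in> A \<Longrightarrow> plane_metric (g c) (chart_image c)"
  using metric open_image unfolding riemannian_metric_def plane_metric_def by auto

lemma plane_metric_overlap:
  assumes "c \<in> A" "d \<in> A" shows "plane_metric (g c) (overlap c d)"
proof -
  interpret plane_metric "g c" "chart_image c" by (rule plane_metric[OF assms(1)])
  show ?thesis
  proof (rule plane_metric.intro)
    fix y assume "y \<in> overlap c d"
    then have y: "y \<in> chart_image c" using overlap_image[of c d] by (rule subsetD[rotated])
    show "transpose (g c y) = g c y" by (rule sym[OF y])
    show "v \<bullet> (g c y *v v) > 0" if "v \<noteq> 0" for v by (rule pos[OF y that])
  qed (rule open_overlap[OF assms] smooth_on_subset[OF smooth_h overlap_image])+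
qed

lemma transition: assumes "c \<in> A" "d \<in> A"
  shows "metric_transition (g c) (overlap c d) (g d) (chart_image d) (snd d \<circ> chart_inv c)"
proof (intro metric_transition.intro plane_metric_overlap plane_metric metric_transition_axioms.intro assms
    transition_smooth)
  show "(snd d \<circ> chart_inv c) ` overlap c d \<subseteq> chart_image d"
    using transition_apply(1)[OF assms] overlap_image by blast
  fix y assume "y \<in> overlap c d"
  then obtain p where p: "p \<in> fst c \<inter> fst d" "y = snd c p" unfolding overlap_def by auto
  then have "let J = jacobian (snd d \<circ> chart_inv c) (at (snd c p))
        in g c (snd c p) = transpose J ** g d (snd d p) ** J"
    using metric assms unfolding riemannian_metric_def by blast
  then show "g c y = transpose (jacobian (snd d \<circ> chart_inv c) (at y)) ** g d ((snd d \<circ> chart_inv c) y)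
      ** jacobian (snd d \<circ> chart_inv c) (at y)"
    using p inv_left[OF assms(1)] by (simp add: Let_def)
qed

lemma overlapI: "p \<in> fst c \<Longrightarrow> p \<in> fst d \<Longrightarrow> snd c p \<in> overlap c d"
  by (auto simp: overlap_def)

text \<open>The transition to the chart chosen by \<open>chart_at\<close> leaves the coordinate
  expression unchanged, so every chart around the point may be used.\<close>

lemma gauss_curvature_chart:
  assumes "c \<in> A" "p \<in> fst c"
  shows "gauss_curvature A g p = local_curvature (g c) (snd c p)"
proof -
  interpret metric_transition "g c" "overlap c (chart_at A p)" "g (chart_at A p)" "chart_image (chart_at A p)"
    "snd (chart_at A p) \<circ> chart_inv c"
    by (rule transition[OF assms(1) chart_at(1)])
  have "gauss_curvature A g p = local_curvature (g (chart_at A p)) (snd (chart_at A p) p)"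
    by (simp add: gauss_curvature_def local_curvature_def Let_def)
  then show ?thesis
    using local_curvature_invariant[OF overlapI[OF assms(2) chart_at(2)]] inv_left[OF assms] by simp
qed

lemma grad_inner_chart:
  assumes "c \<in> A" "p \<in> fst c" "differentiable_at a p" "differentiable_at b p"
  shows "grad_inner A g a b p = local_inner (g c) (a \<circ> chart_inv c) (b \<circ> chart_inv c) (snd c p)"
proof -
  let ?d = "chart_at A p"
  interpret metric_transition "g c" "overlap c ?d" "g ?d" "chart_image ?d" "snd ?d \<circ> chart_inv c"
    by (rule transition[OF assms(1) chart_at(1)])
  have y: "(snd ?d \<circ> chart_inv c) (snd c p) = snd ?d p" using inv_left[OF assms(1,2)] by simp
  have "grad_inner A g a b p = local_inner (g ?d) (a \<circ> chart_inv ?d) (b \<circ> chart_inv ?d) (snd ?d p)"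
    using plane_metric.local_inner_gradient[OF plane_metric[OF chart_at(1)] in_chart_image[OF chart_at(2)]]
    by (simp add: grad_inner_def Let_def)
  also have "\<dots> = local_inner (g c) (a \<circ> chart_inv c) (b \<circ> chart_inv c) (snd c p)"
    using local_inner_invariant[OF overlapI[OF assms(2) chart_at(2)], of "a \<circ> chart_inv ?d" "a \<circ> chart_inv c"
        "b \<circ> chart_inv ?d" "b \<circ> chart_inv c"] assms(3,4) chart_at[of p] transition_apply(2)[OF assms(1) chart_at(1)]
    unfolding y differentiable_at_def by auto
  finally show ?thesis .
qed

lemma sm_gauss_curvature: "gauss_curvature A g \<in> smooth_functions A"
  by (rule smooth_functionsI[OF plane_metric.smooth_local_curvature[OF plane_metric] gauss_curvature_chart])

lemma sm_grad_inner:
  assumes "a \<in> smooth_functions A" "b \<in> smooth_functions A" shows "grad_inner A g a b \<in> smooth_functions A"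
  by (rule smooth_functionsI[OF plane_metric.smooth_local_inner[OF plane_metric smoothD smoothD] grad_inner_chart])
    (use assms sm_differentiable in auto)

text \<open>The conformal law lets us define the Laplacian through curvatures, so that it inherits their
  independence of the chart.\<close>

definition laplacian :: "('a \<Rightarrow> real) \<Rightarrow> 'a \<Rightarrow> real" where
  "laplacian u p = gauss_curvature A g p - exp (2 * u p) * gauss_curvature A (conformal g u) p"

lemma conformal_chart:
  "conformal g w c = (\<lambda>y. exp (2 * (w \<circ> chart_inv c) y) *\<^sub>R g c y)"
  by (simp add: conformal_def)

lemma riemannian_conformal:
  assumes "w \<in> smooth_functions A" shows "riemannian_surface A (conformal g w)"
proof (intro riemannian_surface.intro surface_axioms riemannian_surface_axioms.intro)
  have "plane_metric (conformal g w c) (chart_image c)" if "c \<in> A" for c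
    unfolding conformal_chart using plane_metric.plane_metric_conformal[OF plane_metric[OF that] smoothD[OF assms that]] .
  then have "\<forall>c\<in>A. smooth_on (conformal g w c) (chart_image c) \<and>
        (\<forall>y\<in>chart_image c. transpose (conformal g w c y) = conformal g w c y \<and>
           (\<forall>v. v \<noteq> 0 \<longrightarrow> v \<bullet> (conformal g w c y *v v) > 0))"
    unfolding plane_metric_def by blast
  moreover have "conformal g w c (snd c p) = transpose J ** conformal g w d (snd d p) ** J"
    if "c \<in> A" "d \<in> A" "p \<in> fst c \<inter> fst d" "J = jacobian (snd d \<circ> chart_inv c) (at (snd c p))" for c d p J
  proof -
    have "g c (snd c p) = transpose J ** g d (snd d p) ** J"
      using metric that unfolding riemannian_metric_def Let_def by blast
    then show ?thesis using inv_left that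
      by (simp add: conformal_def matrix_scalar_ac scalar_matrix_assoc)
  qed
  ultimately show "riemannian_metric A (conformal g w)" unfolding riemannian_metric_def Let_def by blast
qed

text \<open>The conformal law in the chart, solved for the Laplacian. This is where the definition
  through curvatures meets the differential operator.\<close>

lemma laplacian_chart:
  assumes "c \<in> A" "p \<in> fst c" "u \<in> smooth_functions A"
  shows "laplacian u p = local_laplacian (g c) (u \<circ> chart_inv c) (snd c p)"
proof -
  interpret C: riemannian_surface A "conformal g u" by (rule riemannian_conformal[OF assms(3)])
  have "gauss_curvature A (conformal g u) p = exp (- 2 * u p) *
     (local_curvature (g c) (snd c p) - local_laplacian (g c) (u \<circ> chart_inv c) (snd c p))"
    unfolding C.gauss_curvature_chart[OF assms(1,2)] conformal_chart
    using plane_metric.local_curvature_conformal[OF plane_metric[OF assms(1)] smoothD[OF assms(3,1)] in_chart_image[OF assms(2)]]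
      inv_left[OF assms(1,2)] by (simp add: o_def)
  then show ?thesis unfolding laplacian_def gauss_curvature_chart[OF assms(1,2)]
    by (simp add: exp_minus flip: mult.assoc)
qed

text \<open>Immediate from the way \<open>laplacian\<close> is defined; the substance of the
  conformal law lies in \<open>laplacian_chart\<close>.\<close>

lemma gauss_curvature_conformal:
  "gauss_curvature A (conformal g u) p = exp (- 2 * u p) * (gauss_curvature A g p - laplacian u p)"
  by (simp add: laplacian_def exp_minus flip: mult.assoc)

lemma sm_laplacian: "u \<in> smooth_functions A \<Longrightarrow> laplacian u \<in> smooth_functions A"
  by (rule smooth_functionsI[OF plane_metric.smooth_local_laplacian[OF plane_metric smoothD] laplacian_chart])

end

section \<open>The area measure\<close>

lemma disjoint_family_Int:
  assumes "disjoint_family B" shows "disjoint_family_on (\<lambda>i. S \<inter> B i) I"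
proof -
  have "B i \<inter> B j = {}" if "i \<noteq> j" for i j using assms that by (simp add: disjoint_family_on_def)
  then show ?thesis unfolding disjoint_family_on_def by blast
qed

text \<open>Links the change of variables for gauge integrals to nonnegative Lebesgue integrals.
  Sharing all finite values is enough: if one integral is infinite, the other cannot be
  finite.\<close>

lemma nn_integral_eq_of_has_integral_iff:
  fixes u v :: "'a::euclidean_space \<Rightarrow> real"
  assumes "u \<in> borel_measurable borel" "v \<in> borel_measurable borel" "\<And>x. 0 \<le> u x" "\<And>x. 0 \<le> v x"
    and iff: "\<And>b. (u has_integral b) UNIV \<longleftrightarrow> (v has_integral b) UNIV"
  shows "(\<integral>\<^sup>+x. ennreal (u x) \<partial>lborel) = (\<integral>\<^sup>+x. ennreal (v x) \<partial>lborel)"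
proof -
  have m: "u \<in> lebesgue \<rightarrow>\<^sub>M borel" "v \<in> lebesgue \<rightarrow>\<^sub>M borel"
    using assms(1,2) by (auto intro!: measurable_completion)
  have eq: "integral\<^sup>N lebesgue u = ennreal r \<longleftrightarrow> integral\<^sup>N lebesgue v = ennreal r" if "0 \<le> r" for r
    using iff[of r] has_integral_iff_nn_integral_lebesgue[where f = u and r = r, OF assms(3)]
      has_integral_iff_nn_integral_lebesgue[where f = v and r = r, OF assms(4)] m that by simp
  have "integral\<^sup>N lebesgue u = integral\<^sup>N lebesgue v"
  proof (cases "integral\<^sup>N lebesgue u")
    case (real r)
    then show ?thesis using eq[of r] by simp
  next
    case top
    then show ?thesis using eq by (cases "integral\<^sup>N lebesgue v") auto
  qed
  then show ?thesis by (simp add: nn_integral_completion)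
qed

context surface
begin

text \<open>The inverse coordinate map made total. The constant value off the chart image keeps it
  Borel measurable; it is harmless since \<open>weight\<close> vanishes there.\<close>

definition coord :: "'a chart \<Rightarrow> real^2 \<Rightarrow> 'a" where
  "coord c y = (if y \<in> chart_image c then chart_inv c y else undefined)"

lemma coord_measurable: assumes "c \<in> A" shows "coord c \<in> borel_measurable borel"
  unfolding coord_def[abs_def]
  using homeo[OF assms] open_image[OF assms]
  by (intro borel_measurable_continuous_on_if) (auto simp: homeomorphism_def)

lemma coord_in_iff:
  assumes "c \<in> A" "S \<subseteq> fst c" "y \<in> chart_image c" shows "coord c y \<in> S \<longleftrightarrow> y \<in> snd c ` S"
proof
  assume "coord c y \<in> S"
  then show "y \<in> snd c ` S" using inv_right[OF assms(1,3)] assms(3) unfolding coord_def by (metis imageI)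
next
  assume "y \<in> snd c ` S"
  then obtain p where p: "p \<in> S" "y = snd c p" by blast
  then have "coord c y = p" using assms(2,3) inv_left[OF assms(1), of p] by (auto simp: coord_def)
  then show "coord c y \<in> S" using p by simp
qed

text \<open>The image under the coordinate map is a preimage under its inverse.\<close>

lemma borel_image:
  assumes "c \<in> A" "S \<in> sets borel" "S \<subseteq> fst c" shows "snd c ` S \<in> sets borel"
proof -
  have "snd c ` S = chart_image c \<inter> (coord c -` S \<inter> space borel)"
    using coord_in_iff[OF assms(1,3)] assms(3) by auto
  then show ?thesis
    using measurable_sets[OF coord_measurable[OF assms(1)] assms(2)] open_image[OF assms(1)] by auto
qed

text \<open>Compactness leaves finitely many charts, and overlaps are removed one after the other.
  These disjoint pieces, each inside a chart, do for the area measure what a partition of unity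
  would do.\<close>

lemma borel_partition:
  obtains N :: nat and c :: "nat \<Rightarrow> 'a chart" and B :: "nat \<Rightarrow> 'a set"
  where "\<And>i. i < N \<Longrightarrow> c i \<in> A" "\<And>i. i < N \<Longrightarrow> B i \<subseteq> fst (c i)" "\<And>i. B i \<in> sets borel"
    "disjoint_family B" "(\<Union>i<N. B i) = UNIV"
proof -
  have "UNIV \<subseteq> (\<Union>c\<in>A. fst c)"
    using closed_surface by (auto simp: closed_surface_def)
  with compact_surface obtain C where C: "C \<subseteq> A" "finite C" "UNIV \<subseteq> (\<Union>c\<in>C. fst c)"
    using open_domain by (elim compactE_image) auto
  obtain N and c :: "nat \<Rightarrow> 'a chart" where c: "C = c ` {i. i < N}"
    using finite_imp_nat_seg_image_inj_on[OF C(2)] by blast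
  \<comment> \<open>Empty beyond \<open>N\<close>, so that the infinite disjointed sequence is
    exhausted by its first \<open>N\<close> members.\<close>
  define F where "F i = (if i < N then fst (c i) else {})" for i
  have cA: "c i \<in> A" if "i < N" for i using that c C by auto
  have F: "F i \<in> sets borel" for i using open_domain[OF cA, of i] by (simp add: F_def)
  show thesis
  proof (rule that[of N c "disjointed F"])
    show "c i \<in> A" if "i < N" for i by (rule cA[OF that])
    show "disjointed F i \<subseteq> fst (c i)" if "i < N" for i using disjointed_subset[of F i] that by (simp add: F_def)
    show "disjointed F i \<in> sets borel" for i using F by (auto simp: disjointed_def)
    show "disjoint_family (disjointed F)" by (rule disjoint_family_disjointed)
    have "p \<in> (\<Union>i<N. disjointed F i)" for p
    proof -
      have "p \<in> (\<Union>i. F i)" using C(3) c by (fastforce simp: F_def)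
      then obtain i where i: "p \<in> disjointed F i" by (metis UN_E UN_disjointed_eq)
      then have "i < N" using disjointed_subset[of F i] by (auto simp: F_def split: if_splits)
      then show ?thesis using i by auto
    qed
    then show "(\<Union>i<N. disjointed F i) = UNIV" by auto
  qed
qed

end

section \<open>Gluing the chart densities to the area measure\<close>

context riemannian_surface
begin

definition weight :: "'a chart \<Rightarrow> real^2 \<Rightarrow> real" where
  "weight c y = (if y \<in> chart_image c then sqrt (det (g c y)) else 0)"

lemma continuous_weight:
  assumes "c \<in> A" shows "continuous_on (chart_image c) (\<lambda>y. sqrt (det (g c y)))"
  by (intro continuous_on_real_sqrt smooth_on_continuous plane_metric.smooth_det[OF plane_metric[OF assms]])

lemma weight_measurable: assumes "c \<in> A" shows "weight c \<in> borel_measurable borel"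
  unfolding weight_def[abs_def]
  by (intro borel_measurable_continuous_on_if continuous_weight assms borel_open open_image) auto

lemma weight_nonneg: assumes "c \<in> A" shows "0 \<le> weight c y"
  using plane_metric.det_pos[OF plane_metric[OF assms], of y] by (auto simp: weight_def intro: less_imp_le)

definition chart_measure :: "'a chart \<Rightarrow> 'a measure" where
  "chart_measure c = distr (density lborel (\<lambda>y. ennreal (weight c y))) borel (coord c)"

lemma sets_chart_measure [simp]: "sets (chart_measure c) = sets borel"
  by (simp add: chart_measure_def)

lemma emeasure_chart_measure_eq:
  assumes "c \<in> A" "S \<in> sets borel"
  shows "emeasure (chart_measure c) S = (\<integral>\<^sup>+y. ennreal (weight c y) * indicator (coord c -` S) y \<partial>lborel)"
proof -
  have "coord c -` S \<in> sets borel"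
    using measurable_sets[OF coord_measurable[OF assms(1)] assms(2)] by simp
  then show ?thesis
    unfolding chart_measure_def using coord_measurable[OF assms(1)] weight_measurable[OF assms(1)] assms(2)
    by (subst emeasure_distr) (auto simp: emeasure_density)
qed

lemma emeasure_chart_measure:
  assumes "c \<in> A" "S \<in> sets borel" "S \<subseteq> fst c"
  shows "emeasure (chart_measure c) S = (\<integral>\<^sup>+y\<in>snd c ` S. ennreal (sqrt (det (g c y))) \<partial>lborel)"
  unfolding emeasure_chart_measure_eq[OF assms(1,2)]
  using coord_in_iff[OF assms(1,3)] assms(3)
  by (intro nn_integral_cong) (auto simp: weight_def indicator_def)

text \<open>Points of \<open>S\<close> outside the chart can only be reached through the default
  value of \<open>coord\<close>, where the density is zero.\<close>

lemma emeasure_chart_measure_Int: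
  assumes "c \<in> A" "S \<in> sets borel"
  shows "emeasure (chart_measure c) S = emeasure (chart_measure c) (S \<inter> fst c)"
proof -
  have "S \<inter> fst c \<in> sets borel" using assms open_domain by auto
  then show ?thesis
    unfolding emeasure_chart_measure_eq[OF assms] emeasure_chart_measure_eq[OF assms(1) \<open>S \<inter> fst c \<in> sets borel\<close>]
    using inv_in[OF assms(1)] by (intro nn_integral_cong) (auto simp: weight_def coord_def indicator_def)
qed

text \<open>Compatibility of the chart densities. By the transformation law, the root of the
  determinant picks up the absolute Jacobian determinant, which is the factor in the change of
  variables.\<close>

lemma chart_integral_overlap:
  assumes c: "c \<in> A" and d: "d \<in> A" and S: "S \<in> sets borel" "S \<subseteq> fst c" "S \<subseteq> fst d"
  shows "(\<integral>\<^sup>+y\<in>snd c ` S. ennreal (sqrt (det (g c y))) \<partial>lborel)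
    = (\<integral>\<^sup>+y\<in>snd d ` S. ennreal (sqrt (det (g d y))) \<partial>lborel)"
proof -
  interpret cd: metric_transition "g c" "overlap c d" "g d" "chart_image d" "snd d \<circ> chart_inv c"
    by (rule transition[OF c d])
  interpret dc: metric_transition "g d" "overlap d c" "g c" "chart_image c" "snd c \<circ> chart_inv d"
    by (rule transition[OF d c])
  let ?f = "snd d \<circ> chart_inv c" and ?h = "snd c \<circ> chart_inv d"
  define E where "E = snd c ` S"
  define T where "T = snd d ` S"
  have sub: "E \<subseteq> overlap c d" "T \<subseteq> overlap d c" using S by (auto simp: E_def T_def overlap_def)
  have img: "E \<subseteq> chart_image c" "T \<subseteq> chart_image d" using S by (auto simp: E_def T_def)
  have borel: "E \<in> sets borel" "T \<in> sets borel" unfolding E_def T_def using borel_image c d S by blast+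
  have df: "(?f has_derivative frechet_derivative ?f (at x)) (at x)" if "x \<in> overlap c d" for x
    using cd.f_differentiable[OF that] frechet_derivative_works by blast
  have dh: "(?h has_derivative frechet_derivative ?h (at x)) (at x)" if "x \<in> overlap d c" for x
    using dc.f_differentiable[OF that] frechet_derivative_works by blast
  have fp: "?f (snd c p) = snd d p" "?h (snd d p) = snd c p" if "p \<in> S" for p
    using inv_left[OF c, of p] inv_left[OF d, of p] S that by auto
  have fT: "?f x \<in> T \<and> ?h (?f x) = x" if "x \<in> E" for x
  proof -
    from that obtain p where p: "p \<in> S" "x = snd c p" unfolding E_def by blast
    show ?thesis unfolding p(2) fp[OF p(1)] T_def using p(1) by simp
  qed
  have hE: "?h x \<in> E \<and> ?f (?h x) = x" if "x \<in> T" for x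
  proof -
    from that obtain p where p: "p \<in> S" "x = snd d p" unfolding T_def by blast
    show ?thesis unfolding p(2) fp[OF p(1)] E_def using p(1) by simp
  qed
  \<comment> \<open>The two transition maps are mutually inverse on the whole open overlap, so the
    chain rule makes their derivatives inverse to each other, as the change of variables
    requires.\<close>
  have id: "frechet_derivative ?h (at y) \<circ> frechet_derivative ?f (at (?h y)) = id" if "y \<in> T" for y
  proof -
    have x: "?h y \<in> overlap c d" using hE[OF that] sub by blast
    have "((\<lambda>x. ?h (?f x)) has_derivative (frechet_derivative ?h (at y) \<circ> frechet_derivative ?f (at (?h y)))) (at (?h y))"
      using diff_chain_at[OF df[OF x], of ?h "frechet_derivative ?h (at y)"] dh[of y] hE[OF that] sub(2) that
      by (auto simp: o_def)
    moreover have "((\<lambda>x. ?h (?f x)) has_derivative id) (at (?h y))"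
    proof (rule has_derivative_transform_within_open[OF _ open_overlap[OF c d] x])
      show "(id has_derivative id) (at (?h y))" by (rule has_derivative_id)
      show "id z = ?h (?f z)" if "z \<in> overlap c d" for z
        using that inv_left[OF c] inv_left[OF d] by (auto simp: overlap_def)
    qed
    ultimately show ?thesis by (rule has_derivative_unique)
  qed
  have w: "weight c x = \<bar>det (matrix (frechet_derivative ?f (at x)))\<bar> * weight d (?f x)" if "x \<in> E" for x
  proof -
    have x: "x \<in> overlap c d" "x \<in> chart_image c" "?f x \<in> chart_image d"
      using that sub img fT[OF that] by blast+
    have "sqrt (det (g c x)) = \<bar>det (jacobian ?f (at x))\<bar> * sqrt (det (g d (?f x)))"
      using cd.det_pullback[OF x(1)] by (simp add: real_sqrt_mult)
    then show ?thesis using x by (simp add: weight_def jacobian_def)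
  qed
  have "(weight c has_integral b) E \<longleftrightarrow> (weight d has_integral b) T" for b
  proof -
    have "(weight c has_integral b) E \<longleftrightarrow>
       ((\<lambda>x. \<bar>det (matrix (frechet_derivative ?f (at x)))\<bar> * weight d (?f x)) has_integral b) E"
      by (rule has_integral_cong[OF w])
    also have "\<dots> \<longleftrightarrow> (weight d has_integral b) T"
    proof (rule cov_invertible_nonneg_eq[where h = ?h])
      show "(?f has_derivative frechet_derivative ?f (at x)) (at x within E)" if "x \<in> E" for x
        using df that sub has_derivative_at_withinI by blast
      show "(?h has_derivative frechet_derivative ?h (at x)) (at x within T)" if "x \<in> T" for x
        using dh that sub has_derivative_at_withinI by blast
    qed (use fT hE id weight_nonneg[OF d] in blast)+
    finally show ?thesis .
  qed
  then have "(\<integral>\<^sup>+x. ennreal (if x \<in> E then weight c x else 0) \<partial>lborel)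
     = (\<integral>\<^sup>+x. ennreal (if x \<in> T then weight d x else 0) \<partial>lborel)"
    using borel weight_measurable[OF c] weight_measurable[OF d] weight_nonneg[OF c] weight_nonneg[OF d]
    by (intro nn_integral_eq_of_has_integral_iff measurable_If_set) (auto simp: has_integral_restrict_UNIV)
  moreover have "(\<integral>\<^sup>+y\<in>E. ennreal (sqrt (det (g c y))) \<partial>lborel) = (\<integral>\<^sup>+x. ennreal (if x \<in> E then weight c x else 0) \<partial>lborel)"
    using img by (intro nn_integral_cong) (auto simp: weight_def indicator_def)
  moreover have "(\<integral>\<^sup>+y\<in>T. ennreal (sqrt (det (g d y))) \<partial>lborel) = (\<integral>\<^sup>+x. ennreal (if x \<in> T then weight d x else 0) \<partial>lborel)"
    using img by (intro nn_integral_cong) (auto simp: weight_def indicator_def)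
  ultimately show ?thesis by (simp add: E_def T_def)
qed

definition is_area :: "'a measure \<Rightarrow> bool" where
  "is_area \<mu> \<longleftrightarrow> sets \<mu> = sets borel \<and>
     (\<forall>c\<in>A. \<forall>S\<in>sets borel. S \<subseteq> fst c \<longrightarrow>
        emeasure \<mu> S = (\<integral>\<^sup>+y\<in>snd c ` S. ennreal (sqrt (det (g c y))) \<partial>lborel))"

text \<open>On each piece of the partition the measure is prescribed by a chart, and finite
  additivity fixes it everywhere.\<close>

lemma is_area_unique:
  assumes "is_area \<mu>" "is_area \<nu>" shows "\<mu> = \<nu>"
proof -
  obtain N c B where *: "\<And>i. i < N \<Longrightarrow> c i \<in> A" "\<And>i. i < N \<Longrightarrow> B i \<subseteq> fst (c i)" "\<And>i. B i \<in> sets borel"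
    "disjoint_family B" "(\<Union>i<(N::nat). B i) = UNIV"
    using borel_partition by metis
  have sum: "emeasure \<mu> S = (\<Sum>i<N. \<integral>\<^sup>+y\<in>snd (c i) ` (S \<inter> B i). ennreal (sqrt (det (g (c i) y))) \<partial>lborel)"
    if "is_area \<mu>" "S \<in> sets borel" for \<mu> S
  proof -
    have "emeasure \<mu> S = emeasure \<mu> (\<Union>i\<in>{..<N}. S \<inter> B i)"
      using *(5) by (metis Int_UNIV_right Int_UN_distrib)
    also have "\<dots> = (\<Sum>i<N. emeasure \<mu> (S \<inter> B i))"
      using that *(3) disjoint_family_Int[OF *(4), of S] by (intro sum_emeasure[symmetric])
        (auto simp: is_area_def)
    also have "\<dots> = (\<Sum>i<N. \<integral>\<^sup>+y\<in>snd (c i) ` (S \<inter> B i). ennreal (sqrt (det (g (c i) y))) \<partial>lborel)"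
    proof (rule sum.cong[OF refl])
      fix i assume "i \<in> {..<N}"
      then have "c i \<in> A" "S \<inter> B i \<subseteq> fst (c i)" "S \<inter> B i \<in> sets borel" using * that by auto
      then show "emeasure \<mu> (S \<inter> B i) = (\<integral>\<^sup>+y\<in>snd (c i) ` (S \<inter> B i). ennreal (sqrt (det (g (c i) y))) \<partial>lborel)"
        using that(1) unfolding is_area_def by blast
    qed
    finally show ?thesis .
  qed
  show ?thesis
    using assms sum[OF assms(1)] sum[OF assms(2)] by (intro measure_eqI) (auto simp: is_area_def)
qed

text \<open>Each piece of the partition is measured in its own chart and the results are added.
  Within any other chart the pieces may be remeasured there by
  \<open>chart_integral_overlap\<close>, so the choice of the partition leaves no trace.\<close>

lemma is_area_exists: "\<exists>\<mu>. is_area \<mu>"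
proof -
  obtain N c B where *: "\<And>i. i < N \<Longrightarrow> c i \<in> A" "\<And>i. i < N \<Longrightarrow> B i \<subseteq> fst (c i)" "\<And>i. B i \<in> sets borel"
    "disjoint_family B" "(\<Union>i<(N::nat). B i) = UNIV"
    using borel_partition by metis
  define m where "m S = (\<Sum>i<N. emeasure (chart_measure (c i)) (S \<inter> B i))" for S
  define \<mu> where "\<mu> = measure_of UNIV (sets borel) m"
  have sig: "sigma_algebra UNIV (sets (borel :: 'a measure))"
    using sets.sigma_algebra_axioms[of "borel :: 'a measure"] by simp
  have "countably_additive (sets borel) m"
  proof (rule countably_additiveI)
    fix F :: "nat \<Rightarrow> 'a set" assume F: "range F \<subseteq> sets borel" "disjoint_family F"
    have "(\<Sum>n. m (F n)) = (\<Sum>i<N. \<Sum>n. emeasure (chart_measure (c i)) (F n \<inter> B i))"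
      unfolding m_def by (rule suminf_sum) (rule summableI)
    also have "\<dots> = (\<Sum>i<N. emeasure (chart_measure (c i)) (\<Union>n. F n \<inter> B i))"
      using F *(3) by (intro sum.cong[OF refl] suminf_emeasure) (auto simp: disjoint_family_on_def)
    finally show "(\<Sum>n. m (F n)) = m (\<Union>n. F n)" by (simp add: m_def)
  qed
  then have em: "emeasure \<mu> S = m S" if "S \<in> sets borel" for S
    unfolding \<mu>_def using that by (intro emeasure_measure_of_sigma[OF sig]) (auto simp: positive_def m_def)
  have sets: "sets \<mu> = sets borel"
    unfolding \<mu>_def using sigma_algebra.sets_measure_of_eq[OF sig] by simp
  have "emeasure \<mu> S = (\<integral>\<^sup>+y\<in>snd d ` S. ennreal (sqrt (det (g d y))) \<partial>lborel)"
    if d: "d \<in> A" and S: "S \<in> sets borel" "S \<subseteq> fst d" for d S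
  proof -
    have "emeasure \<mu> S = (\<Sum>i<N. emeasure (chart_measure d) (S \<inter> B i))"
      unfolding em[OF S(1)] m_def
    proof (rule sum.cong[OF refl])
      fix i assume "i \<in> {..<N}"
      then have i: "c i \<in> A" "S \<inter> B i \<subseteq> fst (c i)" "S \<inter> B i \<subseteq> fst d" "S \<inter> B i \<in> sets borel" using * S by auto
      show "emeasure (chart_measure (c i)) (S \<inter> B i) = emeasure (chart_measure d) (S \<inter> B i)"
        unfolding emeasure_chart_measure[OF i(1,4,2)] emeasure_chart_measure[OF d i(4,3)]
        by (rule chart_integral_overlap[OF i(1) d i(4,2,3)])
    qed
    also have "\<dots> = emeasure (chart_measure d) (\<Union>i\<in>{..<N}. S \<inter> B i)"
      using S(1) *(3) disjoint_family_Int[OF *(4), of S] by (intro sum_emeasure) auto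
    also have "(\<Union>i\<in>{..<N}. S \<inter> B i) = S" using *(5) by (metis Int_UNIV_right Int_UN_distrib)
    finally show ?thesis using emeasure_chart_measure[OF d S] by simp
  qed
  then show ?thesis unfolding is_area_def using sets by blast
qed

lemma is_area_area_measure: "is_area (area_measure A g)"
proof -
  have "area_measure A g = (THE \<mu>. is_area \<mu>)" unfolding area_measure_def is_area_def ..
  then show ?thesis using is_area_exists is_area_unique theI'[of is_area] by metis
qed

lemma sets_area [simp, measurable_cong]: "sets (area_measure A g) = sets borel"
  using is_area_area_measure by (simp add: is_area_def)

lemma emeasure_area:
  "c \<in> A \<Longrightarrow> S \<in> sets borel \<Longrightarrow> S \<subseteq> fst c \<Longrightarrow> emeasure (area_measure A g) S = emeasure (chart_measure c) S"
  using is_area_area_measure emeasure_chart_measure by (simp add: is_area_def)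

text \<open>On a closed coordinate ball the density is continuous, hence bounded. Together with
  compactness this makes the total area finite, so continuous functions are integrable.\<close>

lemma locally_finite_area: "\<exists>V. open V \<and> p \<in> V \<and> emeasure (area_measure A g) V < \<infinity>"
proof -
  define c where "c = chart_at A p"
  have c: "c \<in> A" "p \<in> fst c" using chart_at by (auto simp: c_def)
  obtain r where r: "r > 0" "cball (snd c p) r \<subseteq> chart_image c"
    using open_image[OF c(1)] in_chart_image[OF c(2)] open_contains_cball by blast
  define V where "V = chart_inv c ` ball (snd c p) r"
  have sub: "ball (snd c p) r \<subseteq> chart_image c" using r by auto
  have V: "V \<subseteq> fst c" using sub inv_in[OF c(1)] by (auto simp: V_def)
  have sV: "snd c ` V = ball (snd c p) r"
    using sub inv_right[OF c(1)] unfolding V_def image_image by (force simp: image_iff)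
  have "openin (top_of_set (fst c)) V" unfolding V_def
    using sub by (intro homeomorphism_imp_open_map[OF homeomorphism_sym[THEN iffD1, OF homeo[OF c(1)]]])
      (auto simp: openin_open)
  then have oV: "open V" using openin_open_trans open_domain[OF c(1)] by blast
  have "compact ((\<lambda>y. sqrt (det (g c y))) ` cball (snd c p) r)"
    by (intro compact_continuous_image continuous_on_subset[OF continuous_weight[OF c(1)] r(2)]) auto
  then obtain K where K: "\<And>y. y \<in> cball (snd c p) r \<Longrightarrow> \<bar>sqrt (det (g c y))\<bar> \<le> K"
    using compact_imp_bounded bounded_real by (metis (mono_tags) imageI)
  have "emeasure (area_measure A g) V = (\<integral>\<^sup>+y\<in>ball (snd c p) r. ennreal (sqrt (det (g c y))) \<partial>lborel)"
    using emeasure_area[OF c(1) _ V] emeasure_chart_measure[OF c(1) _ V] oV sV by simp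
  also have "\<dots> \<le> (\<integral>\<^sup>+y. ennreal K * indicator (ball (snd c p) r) y \<partial>lborel)"
  proof (rule nn_integral_mono)
    fix y
    have "sqrt (det (g c y)) \<le> K" if "y \<in> ball (snd c p) r" using K[of y] that by simp
    then show "ennreal (sqrt (det (g c y))) * indicator (ball (snd c p) r) y \<le> ennreal K * indicator (ball (snd c p) r) y"
      by (cases "y \<in> ball (snd c p) r") (simp_all add: ennreal_leI)
  qed
  also have "\<dots> = ennreal K * emeasure lborel (ball (snd c p) r)" by (simp add: nn_integral_cmult_indicator)
  also have "\<dots> < \<infinity>" using emeasure_lborel_ball_finite[of "snd c p" r] by (simp add: ennreal_mult_less_top)
  finally have "emeasure (area_measure A g) V < \<infinity>" .
  moreover have "p \<in> V" using inv_left[OF c] r(1) by (auto simp: V_def intro!: image_eqI[of _ _ "snd c p"])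
  ultimately show ?thesis using oV by blast
qed

lemma finite_area: "finite_measure (area_measure A g)"
proof
  obtain V where V: "\<And>p. open (V p)" "\<And>p. p \<in> V p" "\<And>p. emeasure (area_measure A g) (V p) < \<infinity>"
    using locally_finite_area by metis
  from compact_surface obtain P where P: "finite P" "UNIV \<subseteq> (\<Union>p\<in>P. V p)"
    using V by (elim compactE_image[of _ UNIV V]) auto
  have "emeasure (area_measure A g) (\<Union>p\<in>P. V p) \<le> (\<Sum>p\<in>P. emeasure (area_measure A g) (V p))"
    using V(1) by (intro emeasure_subadditive_finite P) auto
  also have "\<dots> < \<infinity>" using V(3) P(1) by (simp add: less_top[symmetric])
  also have "(\<Union>p\<in>P. V p) = UNIV" using P(2) by blast
  finally have "emeasure (area_measure A g) UNIV < \<infinity>" .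
  then show "emeasure (area_measure A g) (space (area_measure A g)) \<noteq> \<infinity>"
    using sets_eq_imp_space_eq[OF sets_area] by simp
qed

lemma integrable_continuous:
  fixes f :: "'a \<Rightarrow> real"
  assumes "continuous_on UNIV f" shows "integrable (area_measure A g) f"
proof -
  interpret finite_measure "area_measure A g" by (rule finite_area)
  have "bounded (range f)" using compact_surface assms compact_continuous_image compact_imp_bounded by blast
  then obtain K where "\<And>p. \<bar>f p\<bar> \<le> K" by (auto simp: bounded_real)
  then show ?thesis
    using borel_measurable_continuous_onI[OF assms] by (intro integrable_const_bound[of _ K]) auto
qed

lemma density_area: assumes c: "c \<in> A"
  shows "density (area_measure A g) (indicator (fst c)) = chart_measure c"
proof (rule measure_eqI)
  fix S assume "S \<in> sets (density (area_measure A g) (indicator (fst c)))"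
  then have S: "S \<in> sets borel" by simp
  have d: "fst c \<in> sets borel" using open_domain[OF c] by simp
  have "emeasure (density (area_measure A g) (indicator (fst c))) S = emeasure (area_measure A g) (S \<inter> fst c)"
    using S d by (subst emeasure_density)
      (auto simp: mult.commute nn_integral_indicator[symmetric] indicator_inter_arith[symmetric] simp del: nn_integral_indicator)
  also have "\<dots> = emeasure (chart_measure c) S"
    using S d emeasure_chart_measure_Int[OF c S] by (subst emeasure_area[OF c]) auto
  finally show "emeasure (density (area_measure A g) (indicator (fst c))) S = emeasure (chart_measure c) S" .
qed simp

lemma integral_area_chart:
  fixes f :: "'a \<Rightarrow> real"
  assumes c: "c \<in> A" and f: "f \<in> borel_measurable borel" and zero: "\<And>p. p \<notin> fst c \<Longrightarrow> f p = 0"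
  shows "(LINT p|area_measure A g. f p) = (LINT y|lborel. weight c y * f (coord c y))"
proof -
  note m = coord_measurable[OF c] weight_measurable[OF c]
  have d: "fst c \<in> sets borel" using open_domain[OF c] by simp
  have "(LINT p|area_measure A g. f p) = (LINT p|area_measure A g. indicator (fst c) p *\<^sub>R f p)"
    using zero by (intro Bochner_Integration.integral_cong) (auto simp: indicator_def)
  also have "\<dots> = (LINT p|density (area_measure A g) (indicator (fst c)). f p)"
    using f d by (subst integral_density[where f = f and g = "indicator (fst c)", symmetric])
      (auto simp: ennreal_indicator)
  also have "\<dots> = (LINT y|density lborel (\<lambda>y. ennreal (weight c y)). f (coord c y))"
    unfolding density_area[OF c] chart_measure_def using f m by (intro integral_distr) auto
  also have "\<dots> = (LINT y|lborel. weight c y * f (coord c y))"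
    using f m weight_nonneg[OF c] measurable_compose[OF m(1) f] by (subst integral_density) auto
  finally show ?thesis .
qed

end

section \<open>Green's formula\<close>

text \<open>\<open>C\<^sup>1\<close> bump functions are enough for Green's formula, which avoids smooth ones.\<close>

lemma Ck_on_square_pos: "Ck_on 1 (\<lambda>x::real. (max 0 x)\<^sup>2) UNIV"
proof -
  have "((\<lambda>x::real. (max 0 x)\<^sup>2) has_field_derivative 2 * max 0 x) (at x)" for x
  proof -
    consider "x < 0" | "x = 0" | "x > 0" by linarith
    then show ?thesis
    proof cases
      case 1
      then show ?thesis
        by - (rule has_field_derivative_transform_within_open[where f = "\<lambda>x. 0" and S = "{..<0}"], auto)
    next
      case 2
      have "(\<lambda>h::real. max 0 h) \<midarrow>0\<rightarrow> max 0 0" by (intro tendsto_max tendsto_const tendsto_ident_at)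
      moreover have "max 0 h = ((max 0 (0 + h))\<^sup>2 - (max 0 0)\<^sup>2) / h" if "h \<noteq> 0" for h :: real
        using that by (auto simp: max_def power2_eq_square)
      ultimately have "(\<lambda>h::real. ((max 0 (0 + h))\<^sup>2 - (max 0 0)\<^sup>2) / h) \<midarrow>0\<rightarrow> 0"
        by (subst LIM_equal[of 0 _ "max 0"]) auto
      then show ?thesis using 2 by (simp add: DERIV_def)
    next
      case 3
      have "((\<lambda>x. x\<^sup>2) has_field_derivative 2 * x) (at x)" by (auto intro!: derivative_eq_intros)
      with 3 show ?thesis
        by - (rule has_field_derivative_transform_within_open[where f = "\<lambda>x. x\<^sup>2" and S = "{0<..}"], auto)
    qed
  qed
  then have "Ck_on (Suc 0) (\<lambda>x::real. (max 0 x)\<^sup>2) UNIV"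
    by (intro Ck_on_Suc_real[where g' = "\<lambda>x. 2 * max 0 x"]) (auto intro!: continuous_intros)
  then show ?thesis by simp
qed

lemma Ck_on_divide:
  fixes f h :: "'a::real_normed_vector \<Rightarrow> real"
  assumes "open S" "Ck_on k f S" "Ck_on k h S" "\<And>x. x \<in> S \<Longrightarrow> h x \<noteq> 0"
  shows "Ck_on k (\<lambda>x. f x / h x) S"
proof -
  have "Ck_on k (\<lambda>x. inverse (h x)) S"
    by (rule Ck_on_compose[of S h "-{0}" k inverse]) (use assms Ck_on_inverse_real in auto)
  then show ?thesis unfolding divide_inverse using assms by (intro Ck_on_mult)
qed

lemma Ck_on_1_partial: "Ck_on 1 f S \<Longrightarrow> continuous_on S (partial i f)"
  unfolding One_nat_def Ck_on_Suc partial_dir_deriv by simp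

lemma Ck_on_1_differentiable: "Ck_on 1 f S \<Longrightarrow> x \<in> S \<Longrightarrow> f differentiable (at x)"
  unfolding One_nat_def Ck_on_Suc by simp

lemma smooth_on_Ck: "smooth_on f S \<Longrightarrow> Ck_on k f S"
  by (simp add: smooth_on_def)

text \<open>The integral of a partial derivative is the limit of integrals of difference quotients, which
  vanish by translation invariance.\<close>

lemma partial_compact_support:
  fixes X :: "real^2 \<Rightarrow> real"
  assumes X: "Ck_on 1 X UNIV" and supp: "\<And>y. y \<notin> cball y0 r \<Longrightarrow> X y = 0"
  shows integrable_partial: "integrable lborel (partial i X)"
    and integral_partial_eq_0: "(LINT y|lborel. partial i X y) = 0"
proof -
  define e where "e = (axis i 1 :: real^2)"
  have norm_e: "norm e = 1" by (simp add: e_def)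
  have cont: "continuous_on UNIV X" "continuous_on UNIV (partial i X)"
    using Ck_on_continuous[OF X] Ck_on_1_partial[OF X] by auto
  have d0: "partial i X y = 0" if "y \<notin> cball y0 r" for y
  proof -
    have "partial i X y = partial i (\<lambda>z. 0) y"
      by (rule partial_cong[of "- cball y0 r"]) (use that supp in auto)
    then show ?thesis by simp
  qed
  have "compact (partial i X ` cball y0 r)"
    by (intro compact_continuous_image continuous_on_subset[OF cont(2)]) auto
  then obtain M where M: "\<And>y. y \<in> cball y0 r \<Longrightarrow> \<bar>partial i X y\<bar> \<le> M"
    using compact_imp_bounded bounded_real by (metis (mono_tags) imageI)
  define K where "K = max 0 M"
  have K: "\<bar>partial i X y\<bar> \<le> K" for y
    using M[of y] d0[of y] by (cases "y \<in> cball y0 r") (auto simp: K_def)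
  \<comment> \<open>Steps of length at most 1: all difference quotients vanish outside the ball of
    radius \<open>r + 1\<close>, which therefore supports the dominating function.\<close>
  define t where "t n = inverse (real (Suc n))" for n
  have t: "0 < t n" "t n \<le> 1" for n by (auto simp: t_def field_simps)
  define D where "D n y = (X (y + t n *\<^sub>R e) - X y) / t n" for n y
  have line: "((\<lambda>s. X (y + s *\<^sub>R e)) has_real_derivative partial i X (y + s *\<^sub>R e)) (at s)" for y s
    using dir_deriv_line[OF Ck_on_1_differentiable[OF X]] by (simp add: partial_dir_deriv e_def)
  have bound: "\<bar>D n y\<bar> \<le> K * indicator (cball y0 (r + 1)) y" for n y
  proof (cases "y \<in> cball y0 (r + 1)")
    case True
    obtain s where "X (y + t n *\<^sub>R e) - X (y + 0 *\<^sub>R e) = (t n - 0) * partial i X (y + s *\<^sub>R e)"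
      using MVT2[OF t(1)[of n], of "\<lambda>s. X (y + s *\<^sub>R e)" "\<lambda>s. partial i X (y + s *\<^sub>R e)"] line by blast
    then have "D n y = partial i X (y + s *\<^sub>R e)" using t(1)[of n] by (simp add: D_def)
    then show ?thesis using K True by simp
  next
    case False
    then have y: "dist y0 y > r + 1" by simp
    have "dist y (y + t n *\<^sub>R e) = t n" using t(1)[of n] norm_e by (simp add: dist_norm)
    then have "dist y0 y \<le> dist y0 (y + t n *\<^sub>R e) + t n"
      using dist_triangle[of y0 y "y + t n *\<^sub>R e"] by (simp add: dist_commute)
    then have "y + t n *\<^sub>R e \<notin> cball y0 r" using y t(2)[of n] by simp
    moreover have "y \<notin> cball y0 r" using y by simp
    ultimately show ?thesis using False supp by (simp add: D_def)
  qed
  have intX: "integrable lborel X"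
  proof -
    have "integrable lborel (\<lambda>y. indicator (cball y0 r) y *\<^sub>R X y)"
      by (intro borel_integrable_compact continuous_on_subset[OF cont(1)]) auto
    moreover have "(\<lambda>y. indicator (cball y0 r) y *\<^sub>R X y) = X"
      using supp by (auto simp: fun_eq_iff indicator_def)
    ultimately show ?thesis by simp
  qed
  have shift: "integrable lborel (\<lambda>y. X (y + v))" "(LINT y|lborel. X (y + v)) = (LINT y|lborel. X y)" for v
  proof -
    have Xm: "X \<in> borel_measurable borel" using cont(1) by (rule borel_measurable_continuous_onI)
    have "integrable (distr lborel borel ((+) v)) X" using intX by (simp add: lborel_distr_plus)
    then show "integrable lborel (\<lambda>y. X (y + v))"
      using Xm by (subst (asm) integrable_distr_eq) (auto simp: add.commute)
    have "(LINT y|lborel. X y) = (LINT y|distr lborel borel ((+) v). X y)" by (simp add: lborel_distr_plus)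
    also have "\<dots> = (LINT y|lborel. X (v + y))" using Xm by (intro integral_distr) auto
    finally show "(LINT y|lborel. X (y + v)) = (LINT y|lborel. X y)" by (simp add: add.commute)
  qed
  have D0: "(LINT y|lborel. D n y) = 0" for n
    unfolding D_def using shift intX by simp
  have w: "integrable lborel (\<lambda>y. K * indicator (cball y0 (r + 1)) y)"
    using emeasure_lborel_cball_finite[of y0 "r + 1"]
    by (intro integrable_mult_right integrable_real_indicator) simp_all
  have lim: "(\<lambda>n. D n y) \<longlonglongrightarrow> partial i X y" for y
  proof -
    have F: "(\<lambda>s. (X (y + (0 + s) *\<^sub>R e) - X (y + 0 *\<^sub>R e)) / s) \<midarrow>0\<rightarrow> partial i X (y + 0 *\<^sub>R e)"
      using line[of y 0] unfolding DERIV_def .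
    have "t \<longlonglongrightarrow> 0" unfolding t_def by (rule LIMSEQ_inverse_real_of_nat)
    moreover have "\<forall>\<^sub>F n in sequentially. t n \<noteq> 0" using t(1) by (simp add: less_imp_neq[symmetric])
    ultimately have "filterlim t (at 0) sequentially" by (simp add: filterlim_at)
    from filterlim_compose[OF F this] show ?thesis by (simp add: D_def)
  qed
  have meas: "partial i X \<in> borel_measurable lborel" "\<And>n. D n \<in> borel_measurable lborel"
    using borel_measurable_continuous_onI[OF cont(2)] shift(1) intX
    unfolding D_def by (auto intro!: borel_measurable_divide borel_measurable_diff borel_measurable_integrable)
  have "AE y in lborel. (\<lambda>n. D n y) \<longlonglongrightarrow> partial i X y" "\<And>n. AE y in lborel. norm (D n y) \<le> K * indicator (cball y0 (r + 1)) y"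
    using lim bound by auto
  note dc = integrable_dominated_convergence[OF meas w this] integral_dominated_convergence[OF meas w this]
  show "integrable lborel (partial i X)" by (rule dc(1))
  show "(LINT y|lborel. partial i X y) = 0" 
    using dc(2) unfolding D0 by (rule LIMSEQ_unique[OF _ tendsto_const])
qed

section \<open>C^1 functions and bump functions on the surface\<close>

context surface
begin

definition C1 :: "('a \<Rightarrow> real) \<Rightarrow> bool" where
  "C1 f \<longleftrightarrow> (\<forall>c\<in>A. Ck_on 1 (f \<circ> chart_inv c) (chart_image c))"

lemma C1_smooth: "f \<in> smooth_functions A \<Longrightarrow> C1 f"
  unfolding C1_def using smoothD smooth_on_Ck by blast

lemma C1_differentiable: "C1 f \<Longrightarrow> differentiable_at f p"
  unfolding C1_def differentiable_at_def using Ck_on_1_differentiable by blast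

lemma C1_mult: "C1 f \<Longrightarrow> C1 h \<Longrightarrow> C1 (\<lambda>p. f p * h p)"
  unfolding C1_def o_def using open_image by (auto intro: Ck_on_mult)

lemma C1_divide: "C1 f \<Longrightarrow> C1 h \<Longrightarrow> (\<And>p. h p \<noteq> 0) \<Longrightarrow> C1 (\<lambda>p. f p / h p)"
  unfolding C1_def o_def using open_image by (auto intro: Ck_on_divide)

lemma C1_sum: "(\<And>i. i \<in> I \<Longrightarrow> C1 (f i)) \<Longrightarrow> C1 (\<lambda>p. \<Sum>i\<in>I. f i p)"
  unfolding C1_def o_def by (intro ballI Ck_on_sum open_image) simp_all

lemma continuous_from_charts:
  assumes "\<And>c. c \<in> A \<Longrightarrow> continuous_on (chart_image c) (F c)"
    and "\<And>c p. c \<in> A \<Longrightarrow> p \<in> fst c \<Longrightarrow> f p = F c (snd c p)"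
  shows "continuous_on UNIV f"
proof (rule continuous_at_imp_continuous_on, rule ballI)
  fix p
  let ?c = "chart_at A p"
  have "continuous_on (fst ?c) (\<lambda>q. F ?c (snd ?c q))"
    using homeo[OF chart_at(1)] by (intro continuous_on_compose2[OF assms(1)[OF chart_at(1)]]) (auto simp: homeomorphism_def)
  then have "continuous_on (fst ?c) f"
    using assms(2)[OF chart_at(1)] by (metis (no_types, lifting) continuous_on_cong)
  then show "continuous (at p) f"
    using open_domain[OF chart_at(1)] chart_at(2) continuous_on_eq_continuous_at by blast
qed

lemma C1_continuous: assumes "C1 f" shows "continuous_on UNIV f"
proof (rule continuous_from_charts)
  show "continuous_on (chart_image c) (f \<circ> chart_inv c)" if "c \<in> A" for c
    using assms that Ck_on_continuous unfolding C1_def by blast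
qed (simp add: inv_left)

text \<open>The coordinate ball is compact in the surface and hence closed, the surface being
  Hausdorff. Its complement is then a neighbourhood of every point outside the chart, which is what
  makes extension by zero differentiable.\<close>

lemma outside_support:
  assumes c: "c \<in> A" and sub: "cball y0 r \<subseteq> chart_image c" and d: "d \<in> A"
    and y: "y \<in> chart_image d" "chart_inv d y \<notin> fst c"
  obtains W where "open W" "y \<in> W" "\<And>z. z \<in> W \<Longrightarrow> chart_inv d z \<notin> fst c \<or> snd c (chart_inv d z) \<notin> cball y0 r"
proof -
  define K where "K = chart_inv c ` cball y0 r"
  define W where "W = chart_image d \<inter> chart_inv d -` (- K)"
  have "compact K" unfolding K_def
    using homeo[OF c] sub by (intro compact_continuous_image) (auto simp: homeomorphism_def intro: continuous_on_subset)
  then have K: "closed K" by (rule compact_imp_closed)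
  show thesis
  proof (rule that)
    show "open W" unfolding W_def using K homeo[OF d]
      by (intro continuous_open_preimage open_image[OF d]) (auto simp: homeomorphism_def)
    show "y \<in> W" using y inv_in[OF c] sub by (auto simp: W_def K_def)
    show "chart_inv d z \<notin> fst c \<or> snd c (chart_inv d z) \<notin> cball y0 r" if "z \<in> W" for z
      using that inv_left[OF c, of "chart_inv d z"] unfolding W_def K_def by (metis ComplD IntD2 imageI vimageD)
  qed
qed

lemma bump_exists:
  "\<exists>b c y0 r V. C1 b \<and> (\<forall>q. 0 \<le> b q) \<and> open V \<and> p \<in> V \<and> (\<forall>q\<in>V. 0 < b q) \<and>
     c \<in> A \<and> cball y0 r \<subseteq> chart_image c \<and> (\<forall>q. q \<notin> fst c \<or> snd c q \<notin> cball y0 r \<longrightarrow> b q = 0)"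
proof -
  define c where "c = chart_at A p"
  have c: "c \<in> A" "p \<in> fst c" using chart_at by (auto simp: c_def)
  define y0 where "y0 = snd c p"
  obtain r where r: "r > 0" "cball y0 r \<subseteq> chart_image c"
    using open_image[OF c(1)] in_chart_image[OF c(2)] open_contains_cball unfolding y0_def by blast
  \<comment> \<open>A squared positive part is C^1 across the boundary sphere, and the inner
    function is positive exactly on the open ball.\<close>
  define \<beta> where "\<beta> z = (max 0 (r\<^sup>2 - (z - y0) \<bullet> (z - y0)))\<^sup>2" for z :: "real^2"
  have dist: "(z - y0) \<bullet> (z - y0) = (dist y0 z)\<^sup>2" for z
    by (simp add: dist_norm dot_square_norm norm_minus_commute)
  have b0: "\<beta> z = 0" if "z \<notin> cball y0 r" for z
    using that r(1) power_strict_mono[of r "dist y0 z" 2] by (simp add: \<beta>_def dist max_def)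
  have bpos: "\<beta> z > 0" if "z \<in> ball y0 r" for z
  proof -
    have "r\<^sup>2 - (dist y0 z)\<^sup>2 > 0" using that power_strict_mono[of "dist y0 z" r 2] by simp
    then show ?thesis by (simp add: \<beta>_def dist max_def)
  qed
  have "Ck_on 1 (\<lambda>z. z - y0) UNIV"
    using Ck_on_add[OF open_UNIV Ck_on_bounded_linear[OF bounded_linear_ident] Ck_on_const, of 1 "- y0"]
    by simp
  then have "Ck_on 1 (\<lambda>z. (z - y0) \<bullet> (z - y0)) UNIV"
    by (intro Ck_on_bilinear[OF bounded_bilinear_inner]) auto
  then have "Ck_on 1 (\<lambda>z. r\<^sup>2 + (-1) * ((z - y0) \<bullet> (z - y0))) UNIV"
    by (intro Ck_on_add Ck_on_mult) auto
  then have C1\<beta>: "Ck_on 1 \<beta> UNIV"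
    unfolding \<beta>_def[abs_def] by (intro Ck_on_compose[OF _ _ _ Ck_on_square_pos]) auto
  define b where "b q = (if q \<in> fst c then \<beta> (snd c q) else 0)" for q
  have "C1 b" unfolding C1_def
  proof (intro ballI Ck_on_local)
    fix d y assume d: "d \<in> A" and y: "y \<in> chart_image d"
    show "\<exists>T. open T \<and> y \<in> T \<and> Ck_on 1 (b \<circ> chart_inv d) T"
    proof (cases "chart_inv d y \<in> fst c")
      case True
      have "Ck_on 1 (b \<circ> chart_inv d) (overlap d c)"
      proof (rule Ck_on_cong[OF open_overlap[OF d c(1)]])
        show "Ck_on 1 (\<lambda>y. \<beta> ((snd c \<circ> chart_inv d) y)) (overlap d c)"
          by (rule Ck_on_compose[OF open_overlap[OF d c(1)] subset_UNIV
                smooth_on_Ck[OF transition_smooth[OF d c(1)]] C1\<beta>])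
      qed (use transition_apply(5)[OF d c(1)] in \<open>simp add: b_def\<close>)
      moreover have "y \<in> overlap d c"
        using True inv_in[OF d y] inv_right[OF d y] unfolding overlap_def by (metis IntI imageI)
      ultimately show ?thesis using open_overlap[OF d c(1)] by blast
    next
      case False
      obtain W where W: "open W" "y \<in> W" "\<And>z. z \<in> W \<Longrightarrow> chart_inv d z \<notin> fst c \<or> snd c (chart_inv d z) \<notin> cball y0 r"
        using outside_support[OF c(1) r(2) d y False] by metis
      have "Ck_on 1 (b \<circ> chart_inv d) W"
        by (rule Ck_on_cong[OF W(1), of "\<lambda>z. 0"]) (use W(3) b0 in \<open>auto simp: b_def\<close>)
      then show ?thesis using W by blast
    qed
  qed
  moreover have "\<forall>q. 0 \<le> b q" by (simp add: b_def \<beta>_def)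
  moreover define V where "V = fst c \<inter> snd c -` ball y0 r"
  have "open V" unfolding V_def using homeo[OF c(1)]
    by (intro continuous_open_preimage open_domain[OF c(1)]) (auto simp: homeomorphism_def)
  moreover have "p \<in> V" using c r(1) by (simp add: V_def y0_def)
  moreover have "\<forall>q\<in>V. 0 < b q" using bpos by (auto simp: V_def b_def)
  moreover have "\<forall>q. q \<notin> fst c \<or> snd c q \<notin> cball y0 r \<longrightarrow> b q = 0" using b0 by (auto simp: b_def)
  ultimately show ?thesis using c(1) r(2) by blast
qed

end

section \<open>Green's formula, within a chart and globally\<close>

context riemannian_surface
begin

lemma continuous_grad_inner:
  assumes "C1 f" "C1 h" shows "continuous_on UNIV (grad_inner A g f h)"
proof (rule continuous_from_charts)
  fix c assume c: "c \<in> A"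
  interpret P: plane_metric "g c" "chart_image c" by (rule plane_metric[OF c])
  have k: "Ck_on 1 (f \<circ> chart_inv c) (chart_image c)" "Ck_on 1 (h \<circ> chart_inv c) (chart_image c)"
    using assms c by (auto simp: C1_def)
  have "det (g c y) \<noteq> 0" if "y \<in> chart_image c" for y using P.det_pos[OF that] by simp
  then have d: "\<forall>y\<in>chart_image c. det (g c y) \<noteq> 0" by blast
  show "continuous_on (chart_image c) (local_inner (g c) (f \<circ> chart_inv c) (h \<circ> chart_inv c))"
    unfolding local_inner_def[abs_def]
    by (intro continuous_on_divide continuous_on_add continuous_on_diff continuous_on_mult d
        smooth_on_continuous[OF P.smooth_h_nth] smooth_on_continuous[OF P.smooth_det]
        Ck_on_1_partial[OF k(1)] Ck_on_1_partial[OF k(2)])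
  show "grad_inner A g f h p = local_inner (g c) (f \<circ> chart_inv c) (h \<circ> chart_inv c) (snd c p)" if "p \<in> fst c" for p
    using grad_inner_chart[OF c that] C1_differentiable assms by blast
qed

lemma continuous_green_integrand:
  assumes f: "C1 f" and h: "h \<in> smooth_functions A"
  shows "continuous_on UNIV (\<lambda>p. f p * laplacian h p + grad_inner A g f h p)"
  by (intro continuous_on_add continuous_on_mult C1_continuous[OF f]
      C1_continuous[OF C1_smooth[OF sm_laplacian[OF h]]] continuous_grad_inner[OF f C1_smooth[OF h]])

lemma green_chart:
  assumes f: "C1 f" and h: "h \<in> smooth_functions A" and c: "c \<in> A" and sub: "cball y0 r \<subseteq> chart_image c"
    and supp: "\<And>q. q \<notin> fst c \<or> snd c q \<notin> cball y0 r \<Longrightarrow> f q = 0"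
  shows "(LINT p|area_measure A g. f p * laplacian h p + grad_inner A g f h p) = 0"
proof -
  interpret P: plane_metric "g c" "chart_image c" by (rule plane_metric[OF c])
  let ?f = "f \<circ> chart_inv c" and ?h = "h \<circ> chart_inv c"
  have sh: "smooth_on ?h (chart_image c)" by (rule smoothD[OF h c])
  have kf: "Ck_on 1 ?f (chart_image c)" using f c by (simp add: C1_def)
  \<comment> \<open>A component of the field \<open>f\<close> grad \<open>h\<close>, weighted by the
    area density and extended by zero. It vanishes off the coordinate ball, so the extension is C^1
    on the whole plane.\<close>
  define X where "X F y = (if y \<in> chart_image c then ?f y * F y else 0)" for F and y :: "real^2"
  have X0: "X F y = 0" if "y \<notin> cball y0 r" for F y
    using that supp[of "chart_inv c y"] inv_right[OF c, of y] by (auto simp: X_def)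
  have X1: "Ck_on 1 (X F) UNIV" if F: "smooth_on F (chart_image c)" for F
  proof (rule Ck_on_local)
    fix y
    show "\<exists>T. open T \<and> y \<in> T \<and> Ck_on 1 (X F) T"
    proof (cases "y \<in> cball y0 r")
      case True
      have "Ck_on 1 (X F) (chart_image c)"
        by (rule Ck_on_cong[OF open_image[OF c] _ Ck_on_mult[OF open_image[OF c] kf smooth_on_Ck[OF F]]])
          (simp add: X_def)
      then show ?thesis using True sub open_image[OF c] by blast
    next
      case False
      have "Ck_on 1 (X F) (- cball y0 r)"
        by (rule Ck_on_cong[of _ "\<lambda>z. 0"]) (auto simp: X0)
      then show ?thesis using False by (intro exI[of _ "- cball y0 r"]) auto
    qed
  qed
  note I = integrable_partial[OF X1 X0] integral_partial_eq_0[OF X1 X0]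
  \<comment> \<open>Outside the chart \<open>f\<close> vanishes in a neighbourhood, not just at the
    point, so its gradient vanishes too.\<close>
  have zero: "f p * laplacian h p + grad_inner A g f h p = 0" if p: "p \<notin> fst c" for p
  proof -
    let ?d = "chart_at A p"
    have "snd ?d p \<in> chart_image ?d" "chart_inv ?d (snd ?d p) \<notin> fst c"
      using chart_at[of p] inv_left[OF chart_at] p by auto
    then obtain W where W: "open W" "snd ?d p \<in> W"
      "\<And>z. z \<in> W \<Longrightarrow> chart_inv ?d z \<notin> fst c \<or> snd c (chart_inv ?d z) \<notin> cball y0 r"
      using outside_support[OF c sub chart_at(1)] by metis
    have "partial i (f \<circ> chart_inv ?d) (snd ?d p) = partial i (\<lambda>z. 0) (snd ?d p)" for i
      by (rule partial_cong[OF W(1,2)]) (use supp W(3) in simp)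
    then have "grad_inner A g f h p = 0"
      unfolding grad_inner_chart[OF chart_at C1_differentiable[OF f] sm_differentiable[OF h]] local_inner_def by simp
    then show ?thesis using supp[of p] p by simp
  qed
  have "(\<lambda>p. f p * laplacian h p + grad_inner A g f h p) \<in> borel_measurable borel"
    by (rule borel_measurable_continuous_onI[OF continuous_green_integrand[OF f h]])
  from integral_area_chart[OF c this zero]
  have "(LINT p|area_measure A g. f p * laplacian h p + grad_inner A g f h p)
    = (LINT y|lborel. weight c y * (f (coord c y) * laplacian h (coord c y) + grad_inner A g f h (coord c y)))" .
  also have "\<dots> = (LINT y|lborel. partial 1 (X (flux1 (g c) ?h)) y + partial 2 (X (flux2 (g c) ?h)) y)"
  proof (rule Bochner_Integration.integral_cong[OF refl])
    fix y
    show "weight c y * (f (coord c y) * laplacian h (coord c y) + grad_inner A g f h (coord c y))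
      = partial 1 (X (flux1 (g c) ?h)) y + partial 2 (X (flux2 (g c) ?h)) y"
    proof (cases "y \<in> chart_image c")
      case True
      have q: "chart_inv c y \<in> fst c" "snd c (chart_inv c y) = y" using inv_in inv_right c True by auto
      have "partial i (X F) y = partial i (\<lambda>z. ?f z * F z) y" for i F
        by (rule partial_cong[OF open_image[OF c] True]) (simp add: X_def)
      then have "partial 1 (X (flux1 (g c) ?h)) y + partial 2 (X (flux2 (g c) ?h)) y
         = sqrt (det (g c y)) * (?f y * local_laplacian (g c) ?h y + local_inner (g c) ?f ?h y)"
        using P.divergence_flux[OF True sh Ck_on_1_differentiable[OF kf True]] by simp
      moreover have "laplacian h (chart_inv c y) = local_laplacian (g c) ?h y"
        using laplacian_chart[OF c q(1) h] q(2) by simp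
      moreover have "grad_inner A g f h (chart_inv c y) = local_inner (g c) ?f ?h y"
        using grad_inner_chart[OF c q(1) C1_differentiable[OF f] sm_differentiable[OF h]] q(2) by simp
      ultimately show ?thesis using True by (simp add: weight_def coord_def)
    next
      case False
      then have y: "y \<in> - cball y0 r" using sub by auto
      have "partial i (X F) y = partial i (\<lambda>z. 0) y" for i F
        by (rule partial_cong[OF _ y]) (auto simp: X0)
      then show ?thesis using False by (simp add: weight_def)
    qed
  qed
  also have "\<dots> = 0"
    using I[OF P.smooth_flux1[OF sh]] I[OF P.smooth_flux2[OF sh]] by simp
  finally show ?thesis .
qed

lemma partial_sum:
  "finite I \<Longrightarrow> (\<And>k. k \<in> I \<Longrightarrow> u k differentiable (at y)) \<Longrightarrow>
    partial i (\<lambda>z. \<Sum>k\<in>I. u k z) y = (\<Sum>k\<in>I. partial i (u k) y)"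
  by (induction I rule: finite_induct) (simp_all add: partial_add)

lemma grad_inner_sum:
  assumes "finite I" "\<And>k. k \<in> I \<Longrightarrow> C1 (f k)" "C1 h"
  shows "grad_inner A g (\<lambda>p. \<Sum>k\<in>I. f k p) h p = (\<Sum>k\<in>I. grad_inner A g (f k) h p)"
proof -
  let ?c = "chart_at A p"
  have "(f k \<circ> chart_inv ?c) differentiable (at (snd ?c p))" if "k \<in> I" for k
    using C1_differentiable[OF assms(2)[OF that]] chart_at unfolding differentiable_at_def by blast
  then have s: "partial i ((\<lambda>p. \<Sum>k\<in>I. f k p) \<circ> chart_inv ?c) (snd ?c p) = (\<Sum>k\<in>I. partial i (f k \<circ> chart_inv ?c) (snd ?c p))" for i
    using partial_sum[OF assms(1), of "\<lambda>k. f k \<circ> chart_inv ?c"] by (simp add: o_def)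
  have "grad_inner A g (f k) h p = local_inner (g ?c) (f k \<circ> chart_inv ?c) (h \<circ> chart_inv ?c) (snd ?c p)" if "k \<in> I" for k
    by (rule grad_inner_chart[OF chart_at]) (use that assms C1_differentiable in auto)
  moreover have "grad_inner A g (\<lambda>p. \<Sum>k\<in>I. f k p) h p
     = local_inner (g ?c) ((\<lambda>p. \<Sum>k\<in>I. f k p) \<circ> chart_inv ?c) (h \<circ> chart_inv ?c) (snd ?c p)"
    by (intro grad_inner_chart[OF chart_at] C1_differentiable C1_sum assms(2,3))
  ultimately show ?thesis
    unfolding local_inner_def s
    by (simp add: sum_distrib_left sum_distrib_right sum_divide_distrib sum.distrib sum_subtractf
        add_divide_distrib diff_divide_distrib distrib_left)
qed

text \<open>The integrand is linear in \<open>f\<close>, so \<open>f\<close> may be cut into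
  finitely many pieces supported in coordinate balls. Dividing the bump functions by their positive
  sum \<open>B\<close> makes them a C^1 partition of unity.\<close>

lemma green:
  assumes f: "C1 f" and h: "h \<in> smooth_functions A"
  shows "(LINT p|area_measure A g. f p * laplacian h p + grad_inner A g f h p) = 0"
proof -
  have "\<forall>p. \<exists>b c y0 r V. C1 b \<and> (\<forall>q. 0 \<le> b q) \<and> open V \<and> p \<in> V \<and> (\<forall>q\<in>V. 0 < b q) \<and>
     c \<in> A \<and> cball y0 r \<subseteq> chart_image c \<and> (\<forall>q. q \<notin> fst c \<or> snd c q \<notin> cball y0 r \<longrightarrow> b q = 0)"
    using bump_exists by blast
  then obtain b c y0 r V where *: "\<And>p. C1 (b p)" "\<And>p q. 0 \<le> b p q" "\<And>p. open (V p)" "\<And>p. p \<in> V p"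
    "\<And>p q. q \<in> V p \<Longrightarrow> 0 < b p q" "\<And>p. c p \<in> A" "\<And>p. cball (y0 p) (r p) \<subseteq> chart_image (c p)"
    "\<And>p q. q \<notin> fst (c p) \<or> snd (c p) q \<notin> cball (y0 p) (r p) \<Longrightarrow> b p q = 0"
    unfolding choice_iff by blast
  from compact_surface obtain P where P: "finite P" "UNIV \<subseteq> (\<Union>p\<in>P. V p)"
    using *(3,4) by (elim compactE_image[of _ UNIV V]) auto
  define B where "B q = (\<Sum>p\<in>P. b p q)" for q
  have B: "B q > 0" for q
  proof -
    obtain p where "p \<in> P" "q \<in> V p" using P(2) by blast
    then show ?thesis unfolding B_def using P(1) *(2,5) by (intro sum_pos2[of P p]) auto
  qed
  have CB: "C1 B" unfolding B_def[abs_def] by (rule C1_sum) (rule *(1))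
  define F where "F p q = b p q * (f q / B q)" for p q
  have B0: "B q \<noteq> 0" for q using B[of q] by simp
  have CF: "C1 (F p)" for p unfolding F_def[abs_def] by (intro C1_mult C1_divide *(1) f CB B0)
  have fF: "f = (\<lambda>q. \<Sum>p\<in>P. F p q)"
  proof
    fix q
    have "(\<Sum>p\<in>P. F p q) = B q * (f q / B q)" unfolding F_def B_def by (rule sum_distrib_right[symmetric])
    then show "f q = (\<Sum>p\<in>P. F p q)" using B0 by simp
  qed
  have eq: "f q * laplacian h q + grad_inner A g f h q = (\<Sum>p\<in>P. F p q * laplacian h q + grad_inner A g (F p) h q)" for q
    by (subst (1 2) fF) (simp add: grad_inner_sum[OF P(1) CF C1_smooth[OF h]] sum.distrib sum_distrib_right)
  have "(LINT q|area_measure A g. f q * laplacian h q + grad_inner A g f h q)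
     = (\<Sum>p\<in>P. LINT q|area_measure A g. F p q * laplacian h q + grad_inner A g (F p) h q)"
    unfolding eq
    by (intro Bochner_Integration.integral_sum integrable_continuous continuous_green_integrand CF h)
  also have "\<dots> = 0"
  proof (rule sum.neutral, rule ballI)
    fix p assume "p \<in> P"
    show "(LINT q|area_measure A g. F p q * laplacian h q + grad_inner A g (F p) h q) = 0"
      by (rule green_chart[OF CF h *(6)[of p] *(7)[of p]]) (simp add: F_def *(8)[of _ p])
  qed
  finally show ?thesis .
qed

end

section \<open>Families of functions\<close>

lemma slice_derivatives:
  assumes "(f :: 'a::real_normed_vector \<times> 'b::real_normed_vector \<Rightarrow> 'c::real_normed_vector) differentiable (at (x, y))"
  shows "((\<lambda>z. f (z, y)) has_derivative (\<lambda>v. dir_deriv (v, 0) f (x, y))) (at x)"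
    and "((\<lambda>z. f (x, z)) has_derivative (\<lambda>v. dir_deriv (0, v) f (x, y))) (at y)"
proof -
  have "((\<lambda>z. (z, y)) has_derivative (\<lambda>v. (v, 0))) (at x)"
    by (intro has_derivative_Pair has_derivative_ident has_derivative_const)
  from has_derivative_compose[where g = f and f = "\<lambda>z. (z, y)", OF this dir_deriv_works[OF assms]]
  show "((\<lambda>z. f (z, y)) has_derivative (\<lambda>v. dir_deriv (v, 0) f (x, y))) (at x)" .
  have "((\<lambda>z. (x, z)) has_derivative (\<lambda>v. (0, v))) (at y)"
    by (intro has_derivative_Pair has_derivative_ident has_derivative_const)
  from has_derivative_compose[where g = f and f = "\<lambda>z. (x, z)", OF this dir_deriv_works[OF assms]]
  show "((\<lambda>z. f (x, z)) has_derivative (\<lambda>v. dir_deriv (0, v) f (x, y))) (at y)" .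
qed

text \<open>Joint smoothness in parameters and coordinates. It makes parameter and coordinate
  derivatives directional derivatives of one function, so that their interchange is the symmetry of
  mixed derivatives.\<close>

locale smooth_product =
  fixes U :: "'u::real_normed_vector set" and I :: "(real^2) set" and G :: "'u \<times> (real^2) \<Rightarrow> real"
  assumes U: "open U" and I: "open I" and smooth_G: "smooth_on G (U \<times> I)"
begin

lemma open_UI: "open (U \<times> I)"
  using U I by (rule open_Times)

lemma differentiable: "x \<in> U \<Longrightarrow> y \<in> I \<Longrightarrow> smooth_on H (U \<times> I) \<Longrightarrow> H differentiable (at (x, y))"
  by (rule smooth_on_differentiable) auto

lemma partial_slice:
  assumes "x \<in> U" "y \<in> I" "smooth_on H (U \<times> I)"
  shows "partial i (\<lambda>y. H (x, y)) y = dir_deriv (0, axis i 1) H (x, y)"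
  unfolding partial_dir_deriv by (rule dir_deriv_eqI[OF slice_derivatives(2)[OF differentiable[OF assms]]])

lemma partial2_slice:
  assumes "x \<in> U" "y \<in> I" "smooth_on H (U \<times> I)"
  shows "partial j (partial i (\<lambda>y. H (x, y))) y = dir_deriv (0, axis j 1) (dir_deriv (0, axis i 1) H) (x, y)"
proof -
  have "partial j (partial i (\<lambda>y. H (x, y))) y = partial j (\<lambda>y. dir_deriv (0, axis i 1) H (x, y)) y"
    by (rule partial_cong[OF I assms(2)]) (rule partial_slice[OF assms(1) _ assms(3)])
  also have "\<dots> = dir_deriv (0, axis j 1) (dir_deriv (0, axis i 1) H) (x, y)"
    by (rule partial_slice[OF assms(1,2) smooth_on_dir_deriv[OF assms(3)]])
  finally show ?thesis .
qed

lemma param_derivative: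
  assumes "x \<in> U" "y \<in> I" "smooth_on H (U \<times> I)"
  shows "((\<lambda>z. H (z, y)) has_derivative (\<lambda>v. dir_deriv (v, 0) H (x, y))) (at x)"
  by (rule slice_derivatives(1)[OF differentiable[OF assms]])

lemma param_derivative_partial:
  assumes "x \<in> U" "y \<in> I"
  shows "((\<lambda>z. partial i (\<lambda>y. G (z, y)) y) has_derivative
    (\<lambda>v. partial i (\<lambda>y. dir_deriv (v, 0) G (x, y)) y)) (at x)"
proof (rule has_derivative_transform_within_open[OF _ U assms(1)])
  show "((\<lambda>z. dir_deriv (0, axis i 1) G (z, y)) has_derivative
    (\<lambda>v. partial i (\<lambda>y. dir_deriv (v, 0) G (x, y)) y)) (at x)"
    using param_derivative[OF assms smooth_on_dir_deriv[OF smooth_G], of "(0, axis i 1)"]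
    by (simp add: partial_slice[OF assms smooth_on_dir_deriv[OF smooth_G]] assms
        dir_deriv_commute[OF open_UI smooth_G, of "(x, y)" "(0, axis i 1)"])
qed (simp add: partial_slice assms smooth_G)

lemma param_derivative_partial2:
  assumes "x \<in> U" "y \<in> I"
  shows "((\<lambda>z. partial j (partial i (\<lambda>y. G (z, y))) y) has_derivative
    (\<lambda>v. partial j (partial i (\<lambda>y. dir_deriv (v, 0) G (x, y))) y)) (at x)"
proof (rule has_derivative_transform_within_open[OF _ U assms(1)])
  have xy: "(x, y) \<in> U \<times> I" using assms by simp
  have "dir_deriv (v, 0) (dir_deriv (0, axis j 1) (dir_deriv (0, axis i 1) G)) (x, y)
     = dir_deriv (0, axis j 1) (dir_deriv (0, axis i 1) (dir_deriv (v, 0) G)) (x, y)" for v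
  proof -
    have "dir_deriv (v, 0) (dir_deriv (0, axis j 1) (dir_deriv (0, axis i 1) G)) (x, y)
      = dir_deriv (0, axis j 1) (dir_deriv (v, 0) (dir_deriv (0, axis i 1) G)) (x, y)"
      by (rule dir_deriv_commute[OF open_UI smooth_on_dir_deriv[OF smooth_G] xy])
    also have "\<dots> = dir_deriv (0, axis j 1) (dir_deriv (0, axis i 1) (dir_deriv (v, 0) G)) (x, y)"
      by (rule dir_deriv_cong[OF open_UI xy]) (rule dir_deriv_commute[OF open_UI smooth_G])
    finally show ?thesis .
  qed
  then show "((\<lambda>z. dir_deriv (0, axis j 1) (dir_deriv (0, axis i 1) G) (z, y)) has_derivative
    (\<lambda>v. partial j (partial i (\<lambda>y. dir_deriv (v, 0) G (x, y))) y)) (at x)"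
    using param_derivative[OF assms smooth_on_dir_deriv[OF smooth_on_dir_deriv[OF smooth_G]],
        of "(0, axis j 1)" "(0, axis i 1)"]
    by (simp add: partial2_slice[OF assms smooth_on_dir_deriv[OF smooth_G]])
qed (simp add: partial2_slice assms smooth_G)

end

section \<open>Linearity, product rule and conformal scaling\<close>

context riemannian_surface
begin

text \<open>At a fixed point the coefficients depend on the metric only. Linearity of the Laplacian
  and its derivative along a family are read off from this form.\<close>

lemma laplacian_linear_form:
  obtains k1 k2 k11 k12 k22 where "\<And>u. u \<in> smooth_functions A \<Longrightarrow> laplacian u p =
     (let c = chart_at A p; y = snd c p; v = u \<circ> chart_inv c in
       k1 * partial 1 v y + k2 * partial 2 v y + k11 * partial 1 (partial 1 v) y
       + k12 * partial 2 (partial 1 v) y + k22 * partial 2 (partial 2 v) y)"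
proof -
  let ?c = "chart_at A p"
  let ?y = "snd ?c p"
  interpret P: plane_metric "g ?c" "chart_image ?c" by (rule plane_metric[OF chart_at(1)])
  obtain e e1 e2 e11 e12 e22 f f1 f2 f11 f12 f22 l l1 l2 l11 l12 l22
    where E: "has_jet (chart_image ?c) (\<lambda>z. g ?c z $ 1 $ 1) ?y e e1 e2 e11 e12 e22"
    and F: "has_jet (chart_image ?c) (\<lambda>z. g ?c z $ 1 $ 2) ?y f f1 f2 f11 f12 f22"
    and G: "has_jet (chart_image ?c) (\<lambda>z. g ?c z $ 2 $ 2) ?y l l1 l2 l11 l12 l22"
    using P.jets[OF in_chart_image[OF chart_at(2)]] by metis
  define N where "N = e * l - f * f"
  define d1 where "d1 = e1*l + e*l1 - 2*f*f1"
  define d2 where "d2 = e2*l + e*l2 - 2*f*f2"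
  show thesis
  proof (rule that)
    fix u assume u: "u \<in> smooth_functions A"
    let ?v = "u \<circ> chart_inv ?c"
    have "laplacian u p = laplacian_expr e e1 e2 f f1 f2 l l1 l2 (partial 1 ?v ?y) (partial 2 ?v ?y)
        (partial 1 (partial 1 ?v) ?y) (partial 2 (partial 1 ?v) ?y) (partial 2 (partial 2 ?v) ?y)"
      unfolding laplacian_chart[OF chart_at u]
      by (rule P.local_laplacian_jet[OF E F G
          has_jet_self[OF open_image[OF chart_at(1)] smoothD[OF u chart_at(1)] in_chart_image[OF chart_at(2)]]])
    then show "laplacian u p = (let c = chart_at A p; y = snd c p; v = u \<circ> chart_inv c in
       ((l1 - f2) / N - (l * d1 - f * d2) / (2 * N\<^sup>2)) * partial 1 v y
       + ((e2 - f1) / N - (e * d2 - f * d1) / (2 * N\<^sup>2)) * partial 2 v y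
       + (l / N) * partial 1 (partial 1 v) y + (- 2 * f / N) * partial 2 (partial 1 v) y
       + (e / N) * partial 2 (partial 2 v) y)"
      unfolding Let_def laplacian_expr_def N_def[symmetric] d1_def[symmetric] d2_def[symmetric]
      by (simp add: add_divide_distrib diff_divide_distrib algebra_simps)
  qed
qed

lemma laplacian_add_scaled:
  assumes "a \<in> smooth_functions A" "b \<in> smooth_functions A"
  shows "laplacian (\<lambda>q. s * a q + t * b q) p = s * laplacian a p + t * laplacian b p"
proof -
  let ?c = "chart_at A p"
  let ?y = "snd ?c p" and ?a = "a \<circ> chart_inv ?c" and ?b = "b \<circ> chart_inv ?c" and ?I = "chart_image ?c"
  obtain k1 k2 k11 k12 k22 where k: "\<And>u. u \<in> smooth_functions A \<Longrightarrow> laplacian u p =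
     (let c = chart_at A p; y = snd c p; v = u \<circ> chart_inv c in
       k1 * partial 1 v y + k2 * partial 2 v y + k11 * partial 1 (partial 1 v) y
       + k12 * partial 2 (partial 1 v) y + k22 * partial 2 (partial 2 v) y)"
    using laplacian_linear_form[of p] by blast
  have I: "open ?I" "?y \<in> ?I" using open_image[OF chart_at(1)] in_chart_image[OF chart_at(2)] by auto
  have sab: "smooth_on ?a ?I" "smooth_on ?b ?I" using assms smoothD chart_at by blast+
  have "(\<lambda>q. s * a q + t * b q) \<in> smooth_functions A"
    by (intro sm_add sm_mult sm_const assms)
  note l = k[OF this] k[OF assms(1)] k[OF assms(2)]
  note d = smooth_on_differentiable
  have p1: "partial i ((\<lambda>q. s * a q + t * b q) \<circ> chart_inv ?c) y = s * partial i ?a y + t * partial i ?b y"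
    if "y \<in> ?I" for i y
  proof -
    have "partial i ((\<lambda>q. s * a q + t * b q) \<circ> chart_inv ?c) y = partial i (\<lambda>y. s * ?a y + t * ?b y) y" by (simp add: o_def)
    also have "\<dots> = s * partial i ?a y + t * partial i ?b y"
      using d[OF sab(1) that] d[OF sab(2) that] by (simp add: partial_add partial_cmult del: o_apply)
    finally show ?thesis .
  qed
  have p2: "partial j (partial i ((\<lambda>q. s * a q + t * b q) \<circ> chart_inv ?c)) ?y
    = s * partial j (partial i ?a) ?y + t * partial j (partial i ?b) ?y" for i j
  proof -
    have "partial j (partial i ((\<lambda>q. s * a q + t * b q) \<circ> chart_inv ?c)) ?y
       = partial j (\<lambda>y. s * partial i ?a y + t * partial i ?b y) ?y"
      by (rule partial_cong[OF I p1])
    also have "\<dots> = s * partial j (partial i ?a) ?y + t * partial j (partial i ?b) ?y"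
      using d[OF smooth_on_partial[OF sab(1)] I(2)] d[OF smooth_on_partial[OF sab(2)] I(2)]
      by (simp add: partial_add partial_cmult)
    finally show ?thesis .
  qed
  show ?thesis unfolding l Let_def p1[OF I(2)] p2 by (simp add: algebra_simps)
qed

lemma grad_inner_commute: "grad_inner A g a b p = grad_inner A g b a p"
  using plane_metric.local_inner_gradient[OF plane_metric[OF chart_at(1)] in_chart_image[OF chart_at(2)]]
  by (simp add: grad_inner_def Let_def local_inner_def algebra_simps)

lemma grad_inner_at:
  "grad_inner A g a b p = (let c = chart_at A p in local_inner (g c) (a \<circ> chart_inv c) (b \<circ> chart_inv c) (snd c p))"
  using plane_metric.local_inner_gradient[OF plane_metric[OF chart_at(1)] in_chart_image[OF chart_at(2)]]
  by (simp add: grad_inner_def Let_def)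

lemma grad_inner_add:
  assumes "a \<in> smooth_functions A" "b \<in> smooth_functions A"
  shows "grad_inner A g (\<lambda>q. a q + b q) h p = grad_inner A g a h p + grad_inner A g b h p"
proof -
  let ?c = "chart_at A p"
  have "(a \<circ> chart_inv ?c) differentiable (at (snd ?c p))" "(b \<circ> chart_inv ?c) differentiable (at (snd ?c p))"
    using assms[THEN sm_differentiable] chart_at unfolding differentiable_at_def by blast+
  then have s: "partial i ((\<lambda>q. a q + b q) \<circ> chart_inv ?c) (snd ?c p)
     = partial i (a \<circ> chart_inv ?c) (snd ?c p) + partial i (b \<circ> chart_inv ?c) (snd ?c p)" for i
    using partial_add[of "a \<circ> chart_inv ?c" "snd ?c p" "b \<circ> chart_inv ?c" i] by (simp add: o_def)
  show ?thesis
    unfolding grad_inner_at Let_def local_inner_def s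
    by (simp add: algebra_simps add_divide_distrib diff_divide_distrib)
qed

lemma grad_inner_mult:
  assumes "a \<in> smooth_functions A" "b \<in> smooth_functions A"
  shows "grad_inner A g (\<lambda>q. a q * b q) h p = a p * grad_inner A g b h p + b p * grad_inner A g a h p"
proof -
  let ?c = "chart_at A p"
  have "(a \<circ> chart_inv ?c) differentiable (at (snd ?c p))" "(b \<circ> chart_inv ?c) differentiable (at (snd ?c p))"
    using assms[THEN sm_differentiable] chart_at unfolding differentiable_at_def by blast+
  then have s: "partial i ((\<lambda>q. a q * b q) \<circ> chart_inv ?c) (snd ?c p)
     = partial i (a \<circ> chart_inv ?c) (snd ?c p) * b p + a p * partial i (b \<circ> chart_inv ?c) (snd ?c p)" for i
    using partial_mult[of "a \<circ> chart_inv ?c" "snd ?c p" "b \<circ> chart_inv ?c" i] inv_left[OF chart_at] by (simp add: o_def)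
  show ?thesis
    unfolding grad_inner_at Let_def local_inner_def s
    by (simp add: algebra_simps add_divide_distrib diff_divide_distrib)
qed

lemma conformal_zero: "conformal g (\<lambda>p. 0) = g"
  by (simp add: conformal_def)

lemma laplacian_zero: "laplacian (\<lambda>p. 0) p = 0"
  by (simp add: laplacian_def conformal_zero)

text \<open>The metric entries in the numerator scale by the conformal factor, the determinant by
  its square.\<close>

lemma grad_inner_conformal:
  assumes "u \<in> smooth_functions A"
  shows "grad_inner A (conformal g u) a b p = exp (- 2 * u p) * grad_inner A g a b p"
proof -
  interpret C: riemannian_surface A "conformal g u" by (rule riemannian_conformal[OF assms])
  have "local_inner (\<lambda>y. exp (2 * v y) *\<^sub>R h y) x z y = exp (- 2 * v y) * local_inner h x z y" for v h x z y
  proof -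
    have "det (exp (2 * v y) *\<^sub>R h y) = exp (2 * v y) * (exp (2 * v y) * det (h y))"
      by (simp add: det_2 algebra_simps)
    moreover have "(c * l * a1 * b1 - c * k * w + c * e * a2 * b2) / (c * (c * d))
        = inverse c * ((l * a1 * b1 - k * w + e * a2 * b2) / d)" if "c > 0"
      for c l a1 b1 k w e a2 b2 d :: real
    proof -
      have "c * l * a1 * b1 - c * k * w + c * e * a2 * b2 = c * (l * a1 * b1 - k * w + e * a2 * b2)"
        by (simp add: algebra_simps)
      then show ?thesis using that by (simp add: divide_inverse)
    qed
    ultimately show ?thesis by (simp add: local_inner_def exp_minus)
  qed
  then show ?thesis
    unfolding C.grad_inner_at grad_inner_at conformal_chart Let_def by (simp add: inv_left[OF chart_at])
qed

end

section \<open>Parameter derivatives of families of functions\<close>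

locale surface_family = riemannian_surface A g for A :: "('a::t2_space) chart set" and g +
  fixes U :: "(real \<times> real) set"
  assumes open_U: "open U"
begin

definition fam :: "(real \<times> real \<Rightarrow> 'a \<Rightarrow> real) \<Rightarrow> bool" where
  "fam F \<longleftrightarrow> (\<forall>c\<in>A. smooth_on (\<lambda>(z, y). F z (chart_inv c y)) (U \<times> chart_image c))"

definition D :: "real \<times> real \<Rightarrow> (real \<times> real \<Rightarrow> 'a \<Rightarrow> real) \<Rightarrow> real \<times> real \<Rightarrow> 'a \<Rightarrow> real" where
  "D v F z p = dir_deriv v (\<lambda>z. F z p) z"

lemma fam_product: "fam F \<Longrightarrow> c \<in> A \<Longrightarrow> smooth_product U (chart_image c) (\<lambda>(z, y). F z (chart_inv c y))"
  unfolding smooth_product_def fam_def using open_U open_image by auto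

lemma D_chart:
  assumes "fam F" "c \<in> A" "x \<in> U" "y \<in> chart_image c"
  shows "D v F x (chart_inv c y) = dir_deriv (v, 0) (\<lambda>(z, y). F z (chart_inv c y)) (x, y)"
proof -
  interpret smooth_product U "chart_image c" "\<lambda>(z, y). F z (chart_inv c y)" by (rule fam_product[OF assms(1,2)])
  show ?thesis unfolding D_def
    using dir_deriv_eqI[OF param_derivative[OF assms(3,4) smooth_G]] by simp
qed

lemma fam_D: assumes "fam F" shows "fam (D v F)"
  unfolding fam_def
proof
  fix c assume c: "c \<in> A"
  interpret smooth_product U "chart_image c" "\<lambda>(z, y). F z (chart_inv c y)" by (rule fam_product[OF assms c])
  show "smooth_on (\<lambda>(z, y). D v F z (chart_inv c y)) (U \<times> chart_image c)"
    by (rule smooth_on_cong[OF open_UI _ smooth_on_dir_deriv[OF smooth_G, of "(v, 0)"]])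
      (auto simp: D_chart[OF assms c])
qed

lemma fam_smooth: assumes "fam F" "x \<in> U" shows "F x \<in> smooth_functions A"
  unfolding smooth_functions_def
proof (safe)
  fix c assume c: "c \<in> A"
  have "smooth_on (\<lambda>y. (x, 0) + (0, y)) (chart_image c)"
    by (intro smooth_on_add open_image[OF c] smooth_on_const smooth_on_bounded_linear)
      (intro bounded_linear_Pair bounded_linear_zero bounded_linear_ident)
  then have "smooth_on (\<lambda>y. (x, y)) (chart_image c)" by simp
  from smooth_on_compose[OF open_image[OF c] _ this, of "U \<times> chart_image c" "\<lambda>(z, y). F z (chart_inv c y)"]
  show "smooth_on (F x \<circ> chart_inv c) (chart_image c)"
    using assms c by (auto simp: fam_def o_def)
qed

lemma fam_has_derivative:
  assumes "fam F" "x \<in> U"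
  shows "((\<lambda>z. F z p) has_derivative (\<lambda>v. D v F x p)) (at x)"
proof -
  let ?c = "chart_at A p"
  interpret smooth_product U "chart_image ?c" "\<lambda>(z, y). F z (chart_inv ?c y)"
    by (rule fam_product[OF assms(1) chart_at(1)])
  have "(\<lambda>z. F z p) differentiable (at x)"
    using param_derivative[OF assms(2) in_chart_image[OF chart_at(2)] smooth_G] inv_left[OF chart_at]
    by (auto simp: differentiable_def)
  then show ?thesis unfolding D_def by (rule dir_deriv_works)
qed

lemma D_commute:
  assumes "fam F" "x \<in> U" shows "D u (D v F) x p = D v (D u F) x p"
proof -
  let ?c = "chart_at A p"
  let ?y = "snd ?c p" and ?G = "\<lambda>(z, y). F z (chart_inv ?c y)"
  interpret smooth_product U "chart_image ?c" ?G
    by (rule fam_product[OF assms(1) chart_at(1)])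
  have y: "?y \<in> chart_image ?c" "chart_inv ?c ?y = p" using chart_at inv_left[OF chart_at] by auto
  have xy: "(x, ?y) \<in> U \<times> chart_image ?c" using assms(2) y by blast
  have "D u (D v F) x p = dir_deriv (u, 0) (dir_deriv (v, 0) ?G) (x, ?y)" for u v
  proof -
    have "D u (D v F) x p = dir_deriv (u, 0) (\<lambda>(z, y). D v F z (chart_inv ?c y)) (x, ?y)"
      using D_chart[OF fam_D[OF assms(1)] chart_at(1) assms(2) y(1)] y(2) by simp
    also have "\<dots> = dir_deriv (u, 0) (dir_deriv (v, 0) ?G) (x, ?y)"
      by (rule dir_deriv_cong[OF open_UI xy]) (auto simp: D_chart[OF assms(1) chart_at(1)])
    finally show ?thesis .
  qed
  then show ?thesis using dir_deriv_commute[OF open_UI smooth_G xy] by simp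
qed

lemma fam_partial_derivatives:
  assumes "fam F" "x \<in> U" "c \<in> A" "y \<in> chart_image c"
  shows "((\<lambda>z. partial i (F z \<circ> chart_inv c) y) has_derivative (\<lambda>v. partial i (D v F x \<circ> chart_inv c) y)) (at x)"
    and "((\<lambda>z. partial j (partial i (F z \<circ> chart_inv c)) y) has_derivative
      (\<lambda>v. partial j (partial i (D v F x \<circ> chart_inv c)) y)) (at x)"
proof -
  interpret smooth_product U "chart_image c" "\<lambda>(z, y). F z (chart_inv c y)" by (rule fam_product[OF assms(1,3)])
  have 1: "partial i (\<lambda>y. dir_deriv (v, 0) (\<lambda>(z, y). F z (chart_inv c y)) (x, y)) y = partial i (D v F x \<circ> chart_inv c) y"
    if "y \<in> chart_image c" for i v y
    by (rule partial_cong[OF I that]) (simp add: D_chart[OF assms(1,3,2)])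
  then have 2: "partial j (partial i (\<lambda>y. dir_deriv (v, 0) (\<lambda>(z, y). F z (chart_inv c y)) (x, y))) y
      = partial j (partial i (D v F x \<circ> chart_inv c)) y" for i j v
    by (rule partial_cong[OF I assms(4)])
  show "((\<lambda>z. partial i (F z \<circ> chart_inv c) y) has_derivative (\<lambda>v. partial i (D v F x \<circ> chart_inv c) y)) (at x)"
    using param_derivative_partial[OF assms(2,4), of i] unfolding 1[OF assms(4)] by (simp add: o_def)
  show "((\<lambda>z. partial j (partial i (F z \<circ> chart_inv c)) y) has_derivative
      (\<lambda>v. partial j (partial i (D v F x \<circ> chart_inv c)) y)) (at x)"
    using param_derivative_partial2[OF assms(2,4), of j i] unfolding 2 by (simp add: o_def)
qed

lemma fam_grad_inner_derivative:
  assumes "fam F" "fam H" "x \<in> U"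
  shows "((\<lambda>z. grad_inner A g (F z) (H z) p) has_derivative
    (\<lambda>v. grad_inner A g (D v F x) (H x) p + grad_inner A g (F x) (D v H x) p)) (at x)"
proof -
  note d = fam_partial_derivatives(1)[OF assms(1,3) chart_at(1) in_chart_image[OF chart_at(2)]]
    fam_partial_derivatives(1)[OF assms(2,3) chart_at(1) in_chart_image[OF chart_at(2)]]
  show ?thesis
    unfolding grad_inner_at Let_def local_inner_def divide_inverse
    by (rule has_derivative_eq_rhs, (rule derivative_intros d)+) (simp add: fun_eq_iff algebra_simps)
qed

lemma fam_laplacian_derivative:
  assumes "fam F" "x \<in> U"
  shows "((\<lambda>z. laplacian (F z) p) has_derivative (\<lambda>v. laplacian (D v F x) p)) (at x)"
proof -
  obtain k1 k2 k11 k12 k22 where k: "\<And>u. u \<in> smooth_functions A \<Longrightarrow> laplacian u p =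
     (let c = chart_at A p; y = snd c p; v = u \<circ> chart_inv c in
       k1 * partial 1 v y + k2 * partial 2 v y + k11 * partial 1 (partial 1 v) y
       + k12 * partial 2 (partial 1 v) y + k22 * partial 2 (partial 2 v) y)"
    using laplacian_linear_form[of p] by blast
  note d = fam_partial_derivatives[OF assms chart_at(1) in_chart_image[OF chart_at(2)]]
  have "((\<lambda>z. let c = chart_at A p; y = snd c p; v = F z \<circ> chart_inv c in
       k1 * partial 1 v y + k2 * partial 2 v y + k11 * partial 1 (partial 1 v) y
       + k12 * partial 2 (partial 1 v) y + k22 * partial 2 (partial 2 v) y) has_derivative (\<lambda>v. laplacian (D v F x) p)) (at x)"
    unfolding k[OF fam_smooth[OF fam_D[OF assms(1)] assms(2)]] Let_def
    by (intro has_derivative_add has_derivative_mult_right d)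
  then show ?thesis
    by (rule has_derivative_transform_within_open[OF _ open_U assms(2)]) (simp add: k[OF fam_smooth[OF assms(1)]])
qed

end

section \<open>The curvature of the space of conformal factors\<close>

lemma deriv_slice:
  fixes \<Phi> :: "real \<times> real \<Rightarrow> real"
  assumes "(\<Phi> has_derivative \<Phi>') (at (s, t))"
  shows "deriv (\<lambda>\<sigma>. \<Phi> (\<sigma>, t)) s = \<Phi>' (1, 0)" and "deriv (\<lambda>\<tau>. \<Phi> (s, \<tau>)) t = \<Phi>' (0, 1)"
proof -
  have lin: "linear \<Phi>'" using assms by (rule has_derivative_linear)
  have sc: "\<Phi>' (h, 0) = \<Phi>' (1, 0) * h" "\<Phi>' (0, h) = \<Phi>' (0, 1) * h" for h
  proof -
    have "\<Phi>' (h *\<^sub>R (1, 0)) = h *\<^sub>R \<Phi>' (1, 0)" "\<Phi>' (h *\<^sub>R (0, 1)) = h *\<^sub>R \<Phi>' (0, 1)"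
      by (rule linear_cmul[OF lin])+
    then show "\<Phi>' (h, 0) = \<Phi>' (1, 0) * h" "\<Phi>' (0, h) = \<Phi>' (0, 1) * h" by simp_all
  qed
  have scale: "(\<lambda>h. \<Phi>' (h, 0)) = (*) (\<Phi>' (1, 0))" "(\<lambda>h. \<Phi>' (0, h)) = (*) (\<Phi>' (0, 1))"
    by (rule ext, rule sc)+
  have "((\<lambda>\<sigma>. (\<sigma>, t)) has_derivative (\<lambda>h. (h, 0))) (at s)"
    by (intro has_derivative_Pair has_derivative_ident has_derivative_const)
  from has_derivative_compose[where f = "\<lambda>\<sigma>. (\<sigma>, t)" and g = \<Phi>, OF this assms]
  show "deriv (\<lambda>\<sigma>. \<Phi> (\<sigma>, t)) s = \<Phi>' (1, 0)"
    unfolding scale by (intro DERIV_imp_deriv) (simp add: has_field_derivative_def)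
  have "((\<lambda>\<tau>. (s, \<tau>)) has_derivative (\<lambda>h. (0, h))) (at t)"
    by (intro has_derivative_Pair has_derivative_ident has_derivative_const)
  from has_derivative_compose[where f = "\<lambda>\<tau>. (s, \<tau>)" and g = \<Phi>, OF this assms]
  show "deriv (\<lambda>\<tau>. \<Phi> (s, \<tau>)) t = \<Phi>' (0, 1)"
    unfolding scale by (intro DERIV_imp_deriv) (simp add: has_field_derivative_def)
qed

text \<open>\<open>deriv\<close> chooses among derivatives, and both functions have the same ones.
  So passing from \<open>W\<close> to \<open>W - w\<close> changes no parameter derivative, not even
  outside the set where the family is smooth.\<close>

lemma deriv_diff_const: "deriv (\<lambda>x. f x - c) x = deriv f x"
proof -
  have "((\<lambda>x. f x - c) has_field_derivative d) (at x) \<longleftrightarrow> (f has_field_derivative d) (at x)" for d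
    using DERIV_diff[OF _ DERIV_const, of f d x UNIV c] DERIV_add[OF _ DERIV_const, of "\<lambda>x. f x - c" d x UNIV c] by auto
  then show ?thesis by (simp add: deriv_def)
qed

locale curvature_family = surface_family A g U
  for A :: "('a::t2_space) chart set" and g U +
  fixes V :: "real \<times> real \<Rightarrow> 'a \<Rightarrow> real"
  assumes fam_V: "fam V" and base: "(0, 0) \<in> U" and V0: "V (0, 0) = (\<lambda>p. 0)"
    and negative: "z \<in> U \<Longrightarrow> gauss_curvature A (conformal g (V z)) p < 0"
begin

text \<open>The curvature of the varied metric times \<open>exp (2 * V z p)\<close>. Unlike that
  curvature, it depends affinely on \<open>V\<close>.\<close>

definition E :: "real \<times> real \<Rightarrow> 'a \<Rightarrow> real" where
  "E z p = gauss_curvature A g p - laplacian (V z) p"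

lemma E_neg: "z \<in> U \<Longrightarrow> E z p < 0"
  using negative[of z p] by (simp add: E_def gauss_curvature_conformal mult_less_0_iff)

lemma E_base: "E (0, 0) p = gauss_curvature A g p"
  by (simp add: E_def V0 laplacian_zero)

definition cov :: "real \<times> real \<Rightarrow> (real \<times> real \<Rightarrow> 'a \<Rightarrow> real) \<Rightarrow> real \<times> real \<Rightarrow> 'a \<Rightarrow> real" where
  "cov v F z p = D v F z p + grad_inner A g (F z) (D v V z) p / E z p"

lemma connection_term:
  assumes "z \<in> U"
  shows "1 / gauss_curvature A (conformal g (V z)) p * grad_inner A (conformal g (V z)) a b p
    = grad_inner A g a b p / E z p"
  unfolding gauss_curvature_conformal grad_inner_conformal[OF fam_smooth[OF fam_V assms]] E_def by simp

lemma deriv_V: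
  assumes "(s, t) \<in> U"
  shows "deriv (\<lambda>\<sigma>. V (\<sigma>, t) p) s = D (1, 0) V (s, t) p" "deriv (\<lambda>\<tau>. V (s, \<tau>) p) t = D (0, 1) V (s, t) p"
  by (rule deriv_slice[OF fam_has_derivative[OF fam_V assms]])+

text \<open>Stated for a field differentiable at a single point, so that it applies a second time to
  a covariant derivative, for which only a pointwise derivative \<open>dcov\<close> is
  computed.\<close>

lemma cov_deriv_eq:
  assumes "(s, t) \<in> U" "((\<lambda>z. \<alpha> z p) has_derivative \<alpha>') (at (s, t))"
  shows "cov_deriv A g (\<lambda>\<sigma>. V (\<sigma>, t)) (\<lambda>\<sigma>. \<alpha> (\<sigma>, t)) s p
      = \<alpha>' (1, 0) + grad_inner A g (\<alpha> (s, t)) (D (1, 0) V (s, t)) p / E (s, t) p"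
    and "cov_deriv A g (\<lambda>\<tau>. V (s, \<tau>)) (\<lambda>\<tau>. \<alpha> (s, \<tau>)) t p
      = \<alpha>' (0, 1) + grad_inner A g (\<alpha> (s, t)) (D (0, 1) V (s, t)) p / E (s, t) p"
  unfolding cov_deriv_def connection_term[OF assms(1)] deriv_slice[OF assms(2)] deriv_V[OF assms(1)] by simp_all

text \<open>The derivative of \<open>cov v F z p\<close> in the parameter direction
  \<open>u\<close>, by the quotient rule. The last term is positive because \<open>E\<close>
  contains the Laplacian of \<open>V\<close> with a minus sign.\<close>

definition dcov :: "real \<times> real \<Rightarrow> (real \<times> real \<Rightarrow> 'a \<Rightarrow> real) \<Rightarrow> real \<times> real \<Rightarrow> 'a \<Rightarrow> real \<times> real \<Rightarrow> real" where
  "dcov v F z p u = D u (D v F) z p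
     + ((grad_inner A g (D u F z) (D v V z) p + grad_inner A g (F z) (D u (D v V) z) p) * E z p
       + grad_inner A g (F z) (D v V z) p * laplacian (D u V z) p) / (E z p)\<^sup>2"

lemma cov_has_derivative:
  assumes "fam F" "z \<in> U"
  shows "((\<lambda>z. cov v F z p) has_derivative dcov v F z p) (at z)"
proof -
  have "((\<lambda>z. E z p) has_derivative (\<lambda>u. 0 - laplacian (D u V z) p)) (at z)"
    unfolding E_def by (intro has_derivative_diff has_derivative_const fam_laplacian_derivative fam_V assms(2))
  moreover have "E z p \<noteq> 0" using E_neg[OF assms(2), of p] by simp
  ultimately show ?thesis
    unfolding cov_def dcov_def[abs_def]
    by (intro has_derivative_eq_rhs[OF has_derivative_add[OF fam_has_derivative[OF fam_D[OF assms(1)] assms(2)]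
            has_derivative_divide'[OF fam_grad_inner_derivative[OF assms(1) fam_D[OF fam_V] assms(2)]]]])
      (auto simp: power2_eq_square)
qed

text \<open>In the commutator of the covariant derivatives all derivatives of \<open>V\<close> of order two and more cancel.\<close>

lemma commutator:
  fixes \<phi> \<psi> K u v
  defines "\<phi> \<equiv> D (1, 0) V (0, 0)" and "\<psi> \<equiv> D (0, 1) V (0, 0)" and "K \<equiv> gauss_curvature A g"
  defines "u \<equiv> \<lambda>p. grad_inner A g \<psi> \<psi> p / K p" and "v \<equiv> \<lambda>p. grad_inner A g \<psi> \<phi> p / K p"
  defines "Vt \<equiv> \<lambda>s t p. deriv (\<lambda>\<tau>. V (s, \<tau>) p) t"
  defines "Ds \<equiv> \<lambda>\<alpha> s t. cov_deriv A g (\<lambda>\<sigma>. V (\<sigma>, t)) (\<lambda>\<sigma>. \<alpha> \<sigma> t) s"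
    and "Dt \<equiv> \<lambda>\<alpha> s t. cov_deriv A g (\<lambda>\<tau>. V (s, \<tau>)) (\<lambda>\<tau>. \<alpha> s \<tau>) t"
  shows "Ds (Dt Vt) 0 0 p - Dt (Ds Vt) 0 0 p = (grad_inner A g u \<phi> p + u p * laplacian \<phi> p
     - (grad_inner A g v \<psi> p + v p * laplacian \<psi> p)) / K p"
proof -
  define W where "W = D (0, 1) V"
  have fW: "fam W" unfolding W_def by (rule fam_D[OF fam_V])
  have Vt: "Vt s t = W (s, t)" if "(s, t) \<in> U" for s t
    unfolding Vt_def W_def using deriv_V(2)[OF that] by (intro ext)
  \<comment> \<open>\<open>Vt\<close> is a choice of derivatives at every parameter and is known to
    equal \<open>W\<close> on \<open>U\<close> only, hence the passage through an open set.\<close>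
  have Vt_d: "((\<lambda>z. Vt (fst z) (snd z) p) has_derivative (\<lambda>u. D u W z p)) (at z)" if "z \<in> U" for z p
    by (rule has_derivative_transform_within_open[OF fam_has_derivative[OF fW that] open_U that])
      (simp add: Vt)
  have DtVt: "Dt Vt s t = cov (0, 1) W (s, t)" and DsVt: "Ds Vt s t = cov (1, 0) W (s, t)" if "(s, t) \<in> U" for s t
    using cov_deriv_eq[OF that Vt_d[OF that]] Vt[OF that]
    unfolding Dt_def Ds_def cov_def by (auto simp: fun_eq_iff)
  have d1: "((\<lambda>z. Dt Vt (fst z) (snd z) p) has_derivative dcov (0, 1) W (0, 0) p) (at (0, 0))"
    by (rule has_derivative_transform_within_open[OF cov_has_derivative[OF fW base] open_U base]) (simp add: DtVt)
  have d2: "((\<lambda>z. Ds Vt (fst z) (snd z) p) has_derivative dcov (1, 0) W (0, 0) p) (at (0, 0))"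
    by (rule has_derivative_transform_within_open[OF cov_has_derivative[OF fW base] open_U base]) (simp add: DsVt)
  define \<omega> where "\<omega> = D (0, 1) W (0, 0)"
  define \<zeta> where "\<zeta> = D (1, 0) W (0, 0)"
  have W0: "W (0, 0) = \<psi>" by (simp add: W_def \<psi>_def)
  have com: "D (0, 1) (D (1, 0) V) (0, 0) = \<zeta>" "D (1, 0) (D (0, 1) V) (0, 0) = \<zeta>"
    unfolding \<zeta>_def W_def using D_commute[OF fam_V base] by auto
  have com3: "D (1, 0) (D (0, 1) W) (0, 0) p = D (0, 1) (D (1, 0) W) (0, 0) p" by (rule D_commute[OF fW base])
  have K: "K p \<noteq> 0" for p using E_neg[OF base, of p] by (simp add: E_base K_def)
  have sm: "\<phi> \<in> smooth_functions A" "\<psi> \<in> smooth_functions A" "\<omega> \<in> smooth_functions A" "\<zeta> \<in> smooth_functions A"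
    unfolding \<phi>_def \<psi>_def \<omega>_def \<zeta>_def W_def by (intro fam_smooth fam_D fam_V base)+
  have smuv: "u \<in> smooth_functions A" "v \<in> smooth_functions A"
    unfolding u_def v_def using K by (auto intro!: sm_divide sm_grad_inner sm sm_gauss_curvature simp: K_def)
  have c1: "cov (0, 1) W (0, 0) = (\<lambda>p. \<omega> p + u p)" and c2: "cov (1, 0) W (0, 0) = (\<lambda>p. \<zeta> p + v p)"
    by (simp_all add: cov_def fun_eq_iff \<omega>_def \<zeta>_def u_def v_def W0 E_base K_def flip: \<psi>_def \<phi>_def)
  have "Ds (Dt Vt) 0 0 p = D (1, 0) (D (0, 1) W) (0, 0) p
     + ((grad_inner A g \<zeta> \<psi> p + grad_inner A g \<psi> \<zeta> p) * K p + grad_inner A g \<psi> \<psi> p * laplacian \<phi> p) / (K p)\<^sup>2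
     + (grad_inner A g \<omega> \<phi> p + grad_inner A g u \<phi> p) / K p"
    unfolding Ds_def using cov_deriv_eq(1)[where \<alpha> = "\<lambda>z. Dt Vt (fst z) (snd z)", OF base d1] DtVt[OF base]
    by (simp add: dcov_def W0 com E_base c1 grad_inner_add[OF sm(3) smuv(1)] flip: \<psi>_def \<phi>_def K_def \<zeta>_def)
  moreover have "Dt (Ds Vt) 0 0 p = D (0, 1) (D (1, 0) W) (0, 0) p
     + ((grad_inner A g \<omega> \<phi> p + grad_inner A g \<psi> \<zeta> p) * K p + grad_inner A g \<psi> \<phi> p * laplacian \<psi> p) / (K p)\<^sup>2
     + (grad_inner A g \<zeta> \<psi> p + grad_inner A g v \<psi> p) / K p"
    unfolding Dt_def using cov_deriv_eq(2)[where \<alpha> = "\<lambda>z. Ds Vt (fst z) (snd z)", OF base d2] DsVt[OF base]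
    by (simp add: dcov_def W0 com E_base c2 grad_inner_add[OF sm(4) smuv(2)] flip: \<psi>_def \<phi>_def K_def \<omega>_def)
  \<comment> \<open>Here \<open>a\<close> is the third derivative of \<open>V\<close>,
    \<open>x\<close> and \<open>y\<close> are the two products of \<psi> with \<zeta>, and
    \<open>w\<close> is that of \<omega> with \<phi>. All four drop out; \<open>r\<close>,
    \<open>q\<close> and the Laplacians \<open>lp\<close>, \<open>lq\<close> remain.\<close>
  moreover have "(a + ((x + y) * k + m * lp) / k\<^sup>2 + (w + r) / k) - (a + ((w + y) * k + n * lq) / k\<^sup>2 + (x + q) / k)
     = (r + m / k * lp - (q + n / k * lq)) / k" if "k \<noteq> 0" for a x y k m lp w r n lq q :: real
    using that by (simp add: field_simps power2_eq_square)
  ultimately show ?thesis using K by (simp add: com3 u_def v_def)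
qed

lemma family_curvature_eq:
  fixes \<phi> \<psi> K
  defines "\<phi> \<equiv> D (1, 0) V (0, 0)" and "\<psi> \<equiv> D (0, 1) V (0, 0)" and "K \<equiv> gauss_curvature A g"
  shows "family_curvature A g (\<lambda>s t. V (s, t)) = (LINT p|area_measure A g.
      1 / (- K p) * (- (grad_inner A g \<phi> \<phi> p * grad_inner A g \<psi> \<psi> p) + (grad_inner A g \<phi> \<psi> p)\<^sup>2))"
proof -
  define u where "u p = grad_inner A g \<psi> \<psi> p / K p" for p
  define v where "v p = grad_inner A g \<psi> \<phi> p / K p" for p
  have u: "u = (\<lambda>p. grad_inner A g \<psi> \<psi> p / K p)" and v: "v = (\<lambda>p. grad_inner A g \<psi> \<phi> p / K p)"
    by (simp_all add: fun_eq_iff u_def v_def)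
  have K: "K p \<noteq> 0" for p using E_neg[OF base, of p] by (simp add: E_base K_def)
  have sm: "\<phi> \<in> smooth_functions A" "\<psi> \<in> smooth_functions A"
    unfolding \<phi>_def \<psi>_def by (intro fam_smooth fam_D fam_V base)+
  have smuv: "u \<in> smooth_functions A" "v \<in> smooth_functions A"
    unfolding u_def[abs_def] v_def[abs_def] using K by (auto intro!: sm_divide sm_grad_inner sm sm_gauss_curvature simp: K_def)
  have smp: "(\<lambda>p. \<phi> p * u p) \<in> smooth_functions A" "(\<lambda>p. \<phi> p * v p) \<in> smooth_functions A"
    by (intro sm_mult sm smuv)+
  define P where "P p = 1 / (- K p) * (- (grad_inner A g \<phi> \<phi> p * grad_inner A g \<psi> \<psi> p) + (grad_inner A g \<phi> \<psi> p)\<^sup>2)" for p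
  \<comment> \<open>\<open>Q\<close> and \<open>R\<close> are the Green integrands of the pairs
    \<phi> u, \<phi> and \<phi> v, \<psi>, so both integrate to zero. The paired commutator equals
    \<open>P - Q + R\<close> pointwise, the weight \<open>- K\<close> having cancelled the
    denominator.\<close>
  define Q where "Q p = \<phi> p * u p * laplacian \<phi> p + grad_inner A g (\<lambda>p. \<phi> p * u p) \<phi> p" for p
  define R where "R p = \<phi> p * v p * laplacian \<psi> p + grad_inner A g (\<lambda>p. \<phi> p * v p) \<psi> p" for p
  have int: "integrable (area_measure A g) Q" "integrable (area_measure A g) R"
    unfolding Q_def[abs_def] R_def[abs_def]
    by (intro integrable_continuous continuous_green_integrand C1_smooth smp sm)+
  have P: "P = (\<lambda>p. u p * grad_inner A g \<phi> \<phi> p - v p * grad_inner A g \<phi> \<psi> p)"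
    using K by (simp add: fun_eq_iff P_def u_def v_def power2_eq_square field_simps grad_inner_commute[of \<psi> \<phi>])
  have "P \<in> smooth_functions A"
    unfolding P by (intro sm_diff sm_mult sm_grad_inner sm smuv)
  then have intP: "integrable (area_measure A g) P"
    by (intro integrable_continuous C1_continuous C1_smooth)
  have "family_curvature A g (\<lambda>s t. V (s, t)) = (LINT p|area_measure A g.
     (grad_inner A g u \<phi> p + u p * laplacian \<phi> p - (grad_inner A g v \<psi> p + v p * laplacian \<psi> p)) / K p * \<phi> p * (- K p))"
    unfolding family_curvature_def Let_def formal_metric_def V0 conformal_zero
    by (simp only: commutator deriv_V(1)[OF base] u v \<phi>_def \<psi>_def K_def)
  also have "\<dots> = (LINT p|area_measure A g. P p - Q p + R p)"
  proof (rule Bochner_Integration.integral_cong[OF refl])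
    fix p
    have "(grad_inner A g u \<phi> p + u p * laplacian \<phi> p - (grad_inner A g v \<psi> p + v p * laplacian \<psi> p)) / K p * \<phi> p * (- K p)
      = - (\<phi> p * (grad_inner A g u \<phi> p + u p * laplacian \<phi> p - (grad_inner A g v \<psi> p + v p * laplacian \<psi> p)))"
      using K[of p] by simp
    then show "(grad_inner A g u \<phi> p + u p * laplacian \<phi> p - (grad_inner A g v \<psi> p + v p * laplacian \<psi> p)) / K p * \<phi> p * (- K p)
      = P p - Q p + R p"
      unfolding P Q_def R_def grad_inner_mult[OF sm(1) smuv(1)] grad_inner_mult[OF sm(1) smuv(2)]
      by (simp add: algebra_simps)
  qed
  also have "\<dots> = (LINT p|area_measure A g. P p) - (LINT p|area_measure A g. Q p) + (LINT p|area_measure A g. R p)"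
    using int intP by simp
  also have "\<dots> = (LINT p|area_measure A g. P p)"
    unfolding Q_def R_def using green[OF C1_smooth[OF smp(1)] sm(1)] green[OF C1_smooth[OF smp(2)] sm(2)] by simp
  finally show ?thesis by (simp add: P_def)
qed

end

section \<open>Existence of families and independence of the choice\<close>

context riemannian_surface
begin

lemma conformal_conformal: "conformal (conformal g w) (\<lambda>p. u p - w p) = conformal g u"
  by (simp add: conformal_def fun_eq_iff exp_add[symmetric] algebra_simps)

text \<open>Lagrange's identity in dimension two: in terms of numerators, the defect is the
  determinant times the square of \<open>a1*b2 - a2*b1\<close>.\<close>

lemma grad_inner_Cauchy_Schwarz:
  "(grad_inner A g a b p)\<^sup>2 \<le> grad_inner A g a a p * grad_inner A g b b p"
proof -
  let ?c = "chart_at A p"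
  let ?y = "snd ?c p"
  interpret P: plane_metric "g ?c" "chart_image ?c" by (rule plane_metric[OF chart_at(1)])
  have y: "?y \<in> chart_image ?c" using chart_at by simp
  have *: "((l*a1*b1 - k*(a1*b2 + a2*b1) + e*a2*b2) / d)\<^sup>2
     \<le> ((l*a1*a1 - k*(a1*a2 + a2*a1) + e*a2*a2) / d) * ((l*b1*b1 - k*(b1*b2 + b2*b1) + e*b2*b2) / d)"
    if "d = e * l - k * k" "d > 0" for e k l d a1 a2 b1 b2 :: real
  proof -
    have "(l*a1*a1 - k*(a1*a2 + a2*a1) + e*a2*a2) * (l*b1*b1 - k*(b1*b2 + b2*b1) + e*b2*b2)
      = (l*a1*b1 - k*(a1*b2 + a2*b1) + e*a2*b2)\<^sup>2 + d * (a1*b2 - a2*b1)\<^sup>2"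
      unfolding that(1) by algebra
    moreover have "d * (a1*b2 - a2*b1)\<^sup>2 \<ge> 0" using that(2) by simp
    ultimately show ?thesis by (simp add: power_divide power2_eq_square[of d] divide_right_mono)
  qed
  show ?thesis
    unfolding grad_inner_at Let_def local_inner_def by (rule *[OF P.det_h[OF y] P.det_pos[OF y]])
qed

lemma smooth_bounded: assumes "f \<in> smooth_functions A" obtains C where "\<And>p. \<bar>f p\<bar> \<le> C"
proof -
  have "compact (range f)"
    by (intro compact_continuous_image C1_continuous C1_smooth assms compact_surface)
  then have "bounded (range f)" by (rule compact_imp_bounded)
  then obtain C where "\<forall>x\<in>range f. \<bar>x\<bar> \<le> C" unfolding bounded_real by blast
  then show ?thesis using that[of C] by auto
qed

text \<open>The reciprocal of \<open>f\<close> is again smooth, hence bounded on the compact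
  surface, and this keeps \<open>f\<close> away from zero.\<close>

lemma smooth_negative_bound:
  assumes "f \<in> smooth_functions A" "\<And>p. f p < 0" obtains \<epsilon> where "\<epsilon> > 0" "\<And>p. f p \<le> - \<epsilon>"
proof -
  obtain C where C: "\<And>p. \<bar>1 / f p\<bar> \<le> C"
    using smooth_bounded[OF sm_divide[OF sm_const[of 1] assms(1)]] assms(2) by (metis less_irrefl)
  \<comment> \<open>Any point serves: the reciprocal is nonzero there, so its bound is strictly
    positive.\<close>
  have C0: "C > 0" using C[of undefined] assms(2)[of undefined] by (smt (verit) divide_eq_0_iff)
  have "f p \<le> - (1 / C)" for p
    using C[of p] assms(2)[of p] C0 by (simp add: field_simps)
  then show ?thesis using that[of "1 / C"] C0 by simp
qed

text \<open>Up to a positive factor the varied curvature is K minus s times one Laplacian minus t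
  times the other. With K at most -\<epsilon> and both Laplacians bounded by compactness, small s
  and t keep it negative at all points at once.\<close>

lemma linear_family_negative:
  assumes "\<phi> \<in> smooth_functions A" "\<psi> \<in> smooth_functions A" "\<And>p. gauss_curvature A g p < 0"
  obtains U :: "(real \<times> real) set" where "open U" "(0, 0) \<in> U"
    "\<And>s t p. (s, t) \<in> U \<Longrightarrow> gauss_curvature A (conformal g (\<lambda>q. s * \<phi> q + t * \<psi> q)) p < 0"
proof -
  obtain \<epsilon> where e: "\<epsilon> > 0" "\<And>p. gauss_curvature A g p \<le> - \<epsilon>"
    using smooth_negative_bound[OF sm_gauss_curvature assms(3)] by blast
  obtain C1 where C1: "\<And>p. \<bar>laplacian \<phi> p\<bar> \<le> C1" using smooth_bounded[OF sm_laplacian[OF assms(1)]] by blast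
  obtain C2 where C2: "\<And>p. \<bar>laplacian \<psi> p\<bar> \<le> C2" using smooth_bounded[OF sm_laplacian[OF assms(2)]] by blast
  define U where "U = {z :: real \<times> real. \<bar>fst z\<bar> * C1 + \<bar>snd z\<bar> * C2 < \<epsilon>}"
  show thesis
  proof (rule that[of U])
    show "open U" unfolding U_def by (intro open_Collect_less continuous_intros)
    show "(0, 0) \<in> U" using e by (simp add: U_def)
    fix s t p assume "(s, t) \<in> U"
    then have st: "\<bar>s\<bar> * C1 + \<bar>t\<bar> * C2 < \<epsilon>" by (simp add: U_def)
    have "\<bar>s * laplacian \<phi> p\<bar> \<le> \<bar>s\<bar> * C1" "\<bar>t * laplacian \<psi> p\<bar> \<le> \<bar>t\<bar> * C2"
      using C1[of p] C2[of p] by (simp_all add: abs_mult mult_left_mono)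
    then have "gauss_curvature A g p - (s * laplacian \<phi> p + t * laplacian \<psi> p) < 0" using st e(2)[of p] by linarith
    then show "gauss_curvature A (conformal g (\<lambda>q. s * \<phi> q + t * \<psi> q)) p < 0"
      by (simp add: gauss_curvature_conformal laplacian_add_scaled assms mult_less_0_iff)
  qed
qed

text \<open>The affine family through \<open>w\<close> settles the existence clause of
  \<open>has_sectional_curvature\<close>. Its negativity is that of the linear family over the
  metric of \<open>w\<close>.\<close>

lemma two_parameter_family_exists:
  assumes w: "w \<in> Gamma_minus A g" and \<phi>: "\<phi> \<in> smooth_functions A" and \<psi>: "\<psi> \<in> smooth_functions A"
  shows "two_parameter_family A g w \<phi> \<psi> (\<lambda>s t p. w p + (s * \<phi> p + t * \<psi> p))"
proof -
  have sw: "w \<in> smooth_functions A" and neg: "\<And>p. gauss_curvature A (conformal g w) p < 0"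
    using w by (auto simp: Gamma_minus_def)
  interpret C: riemannian_surface A "conformal g w" by (rule riemannian_conformal[OF sw])
  obtain U :: "(real \<times> real) set" where U: "open U" "(0, 0) \<in> U"
    "\<And>s t p. (s, t) \<in> U \<Longrightarrow> gauss_curvature A (conformal (conformal g w) (\<lambda>q. s * \<phi> q + t * \<psi> q)) p < 0"
    using C.linear_family_negative[OF \<phi> \<psi> neg] by blast
  have "conformal (conformal g w) (\<lambda>q. s * \<phi> q + t * \<psi> q) = conformal g (\<lambda>q. w q + (s * \<phi> q + t * \<psi> q))" for s t
    using conformal_conformal[of w "\<lambda>q. w q + (s * \<phi> q + t * \<psi> q)"] by simp
  then have "(\<lambda>q. w q + (s * \<phi> q + t * \<psi> q)) \<in> Gamma_minus A g" if "(s, t) \<in> U" for s t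
    using U(3)[OF that] unfolding Gamma_minus_def by (auto intro!: sm_add sm_mult sm_const sw \<phi> \<psi>)
  moreover have "smooth_on (\<lambda>((s, t), y). w (chart_inv c y) + (s * \<phi> (chart_inv c y) + t * \<psi> (chart_inv c y))) (U \<times> chart_image c)"
    if c: "c \<in> A" for c
  proof -
    have o: "open (U \<times> chart_image c)" using U(1) open_image[OF c] by (rule open_Times)
    have sf: "smooth_on (\<lambda>z. f (chart_inv c (snd z))) (U \<times> chart_image c)" if "f \<in> smooth_functions A" for f
      using smooth_on_compose[OF o _ smooth_on_bounded_linear[OF bounded_linear_snd] smoothD[OF that c]] by (auto simp: o_def)
    have st: "smooth_on (\<lambda>z. fst (fst z)) (U \<times> chart_image c)" "smooth_on (\<lambda>z. snd (fst z)) (U \<times> chart_image c)"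
      by (intro smooth_on_bounded_linear bounded_linear_compose[OF bounded_linear_fst bounded_linear_fst]
          bounded_linear_compose[OF bounded_linear_snd bounded_linear_fst])+
    show ?thesis unfolding case_prod_unfold
      by (intro smooth_on_add smooth_on_mult o sf st sw \<phi> \<psi>)
  qed
  moreover have "deriv (\<lambda>s. w p + (s * \<phi> p + 0 * \<psi> p)) 0 = \<phi> p" "deriv (\<lambda>t. w p + (0 * \<phi> p + t * \<psi> p)) 0 = \<psi> p" for p
    by (rule DERIV_imp_deriv; auto intro!: derivative_eq_intros)+
  ultimately show ?thesis using U(1,2) unfolding two_parameter_family_def by auto
qed

text \<open>Moving the base point to \<open>w\<close> turns an arbitrary family into one that
  vanishes at the origin. Conformal factors compose, so the metrics along both families
  coincide.\<close>

lemma family_curvature_family: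
  fixes W :: "real \<Rightarrow> real \<Rightarrow> 'a \<Rightarrow> real"
  assumes w: "w \<in> Gamma_minus A g" and W: "two_parameter_family A g w \<phi> \<psi> W"
  defines "h \<equiv> conformal g w"
  shows "family_curvature A g W = (LINT p|area_measure A h. 1 / (- gauss_curvature A h p) *
      (- (grad_inner A h \<phi> \<phi> p * grad_inner A h \<psi> \<psi> p) + (grad_inner A h \<phi> \<psi> p)\<^sup>2))"
proof -
  have sw: "w \<in> smooth_functions A" using w by (simp add: Gamma_minus_def)
  obtain U where U: "open U" "(0, 0) \<in> U" "\<And>s t. (s, t) \<in> U \<Longrightarrow> W s t \<in> Gamma_minus A g"
    "\<And>c. c \<in> A \<Longrightarrow> smooth_on (\<lambda>((s, t), y). W s t (chart_inv c y)) (U \<times> chart_image c)"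
    and W0: "W 0 0 = w" and d: "\<And>p. deriv (\<lambda>s. W s 0 p) 0 = \<phi> p" "\<And>p. deriv (\<lambda>t. W 0 t p) 0 = \<psi> p"
    using W unfolding two_parameter_family_def by fast
  define V where "V z p = W (fst z) (snd z) p - w p" for z p
  have conf: "conformal g (W s t) = conformal h (V (s, t))" for s t
    using conformal_conformal[of w "W s t"] by (simp add: h_def V_def[abs_def])
  have dV: "deriv (\<lambda>\<sigma>. W \<sigma> t p) s = deriv (\<lambda>\<sigma>. V (\<sigma>, t) p) s" "deriv (\<lambda>\<tau>. W s \<tau> p) t = deriv (\<lambda>\<tau>. V (s, \<tau>) p) t" for s t p
    by (simp_all add: V_def deriv_diff_const)
  interpret H: surface_family A h U
    using riemannian_conformal[OF sw] U(1) unfolding surface_family_def surface_family_axioms_def h_def by blast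
  have famV: "H.fam V" unfolding H.fam_def
  proof
    fix c assume c: "c \<in> A"
    have o: "open (U \<times> chart_image c)" using U(1) open_image[OF c] by (rule open_Times)
    have "smooth_on (\<lambda>z. w (chart_inv c (snd z))) (U \<times> chart_image c)"
      using smooth_on_compose[OF o _ smooth_on_bounded_linear[OF bounded_linear_snd] smoothD[OF sw c]] by (auto simp: o_def)
    from smooth_on_diff[OF o U(4)[OF c] this]
    show "smooth_on (\<lambda>(z, y). V z (chart_inv c y)) (U \<times> chart_image c)"
      by (simp add: case_prod_unfold V_def)
  qed
  interpret F: curvature_family A h U V
  proof
    show "H.fam V" by (rule famV)
    show "(0, 0) \<in> U" by (rule U(2))
    show "V (0, 0) = (\<lambda>p. 0)" by (simp add: V_def fun_eq_iff W0)
    show "gauss_curvature A (conformal h (V z)) p < 0" if "z \<in> U" for z p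
      using U(3)[of "fst z" "snd z"] that conf[of "fst z" "snd z"] by (simp add: Gamma_minus_def)
  qed
  \<comment> \<open>Both sides unfold to the same expression: the definition sees the family only
    through its metrics and its parameter derivatives, and neither changes when \<open>w\<close> is
    subtracted.\<close>
  have "family_curvature A g W = family_curvature A h (\<lambda>s t. V (s, t))"
    unfolding family_curvature_def cov_deriv_def formal_metric_def Let_def conf dV ..
  moreover have "H.D (1, 0) V (0, 0) = \<phi>" "H.D (0, 1) V (0, 0) = \<psi>"
    using F.deriv_V[OF U(2)] d by (auto simp: fun_eq_iff dV)
  ultimately show ?thesis using F.family_curvature_eq by simp
qed

end

theorem proposition2p7:
  fixes A :: "('a::t2_space) chart set"
    and g0 :: "'a metric_components"
    and w \<phi> \<psi> :: "'a \<Rightarrow> real"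
  defines "gw \<equiv> conformal g0 w"
  defines "I \<equiv> (LINT p|area_measure A gw.
      1 / (- gauss_curvature A gw p) *
      (- (grad_inner A gw \<phi> \<phi> p * grad_inner A gw \<psi> \<psi> p) + (grad_inner A gw \<phi> \<psi> p)\<^sup>2))"
  assumes "closed_surface A"
    and "riemannian_metric A g0"
    and "\<forall>p. gauss_curvature A g0 p < 0"
    and "w \<in> Gamma_minus A g0"
    and "\<phi> \<in> smooth_functions A"
    and "\<psi> \<in> smooth_functions A"
  shows "has_sectional_curvature A g0 w \<phi> \<psi> I \<and> I \<le> 0"
proof
  interpret riemannian_surface A g0
    using assms by (simp add: riemannian_surface_def riemannian_surface_axioms_def surface_def)
  show "has_sectional_curvature A g0 w \<phi> \<psi> I"
    unfolding has_sectional_curvature_def I_def gw_def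
    using two_parameter_family_exists[OF assms(6-8)] family_curvature_family[OF assms(6)] by blast
  interpret C: riemannian_surface A gw
    unfolding gw_def using assms(6) by (intro riemannian_conformal) (simp add: Gamma_minus_def)
  have "0 \<le> (LINT p|area_measure A gw. - (1 / (- gauss_curvature A gw p) *
      (- (grad_inner A gw \<phi> \<phi> p * grad_inner A gw \<psi> \<psi> p) + (grad_inner A gw \<phi> \<psi> p)\<^sup>2)))"
  proof (rule Bochner_Integration.integral_nonneg)
    fix p
    have "gauss_curvature A gw p < 0" using assms(6) by (simp add: Gamma_minus_def gw_def)
    then show "0 \<le> - (1 / (- gauss_curvature A gw p) *
      (- (grad_inner A gw \<phi> \<phi> p * grad_inner A gw \<psi> \<psi> p) + (grad_inner A gw \<phi> \<psi> p)\<^sup>2))"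
      using C.grad_inner_Cauchy_Schwarz[of \<phi> \<psi> p] by (simp add: divide_nonpos_neg divide_nonneg_neg)
  qed
  then show "I \<le> 0" unfolding I_def by simp
qed

end
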